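(* In the operator setting, let $\alpha\in\mathbb{R}^d$ have either all coordinates positive or all coordinates negative, and let $A\in L(\mathcal{X},\mathcal{Y})$ be $\mathcal{T}_{\mathcal{X}\mathcal{Y}}$-continuous with $A\in D(\mathbf{e}_\alpha)$. If $A$ is invertible with $B=A^{-1}\in L(\mathcal{Y},\mathcal{X})$, then there is $\beta\in\mathbb{R}^d$ whose coordinates all have the same sign as those of $\alpha$ such that $B$ is $\mathcal{T}_{\mathcal{Y}\mathcal{X}}$-continuous and $B\in D(\mathbf{e}_\beta)$.
   Context: Fourier transform $\hat f(\lambda)=\int f(t)e^{-it\cdot\lambda}dt$. A Banach $L^1(\mathbb{R}^d)$-module structure on a Banach space $\mathcal{M}$ associated with a representation $\mathcal{T}:\mathbb{R}^d\to B(\mathcal{M})$ by invertible isometries is a bilinear map $(f,x)\mapsto fx$ with $(f*g)x=f(gx)$, $\|fx\|\le\|f\|_1\|x\|$, $\mathcal{T}(t)(fx)=(f(\cdot+t))x=f(\mathcal{T}(t)x)$, non-degenerate; $x$ is $\mathcal{T}$-continuous if $t\mapsto\mathcal{T}(t)x$ is norm continuous, and then $fx=\int f(t)\mathcal{T}(-t)x\,dt$. Beurling spectrum $\Lambda(x,\mathcal{T})$: set of $\gamma$ with $\hat f(\gamma)=0$ for all $f$ with $fx=0$. Operator setting: $\mathcal{X},\mathcal{Y}$ complex Banach spaces; each of $L(\mathcal{X},\mathcal{Y}),L(\mathcal{Y},\mathcal{X}),B(\mathcal{X}),B(\mathcal{Y})$ carries such a module structure with representations $\mathcal{T}_{\mathcal{U}\mathcal{V}}$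 satisfying $\mathcal{T}_{\mathcal{U}\mathcal{W}}(t)(BA)=(\mathcal{T}_{\mathcal{V}\mathcal{W}}(t)B)(\mathcal{T}_{\mathcal{U}\mathcal{V}}(t)A)$, and coupled: $A\in L(\mathcal{X},\mathcal{Y})$, $B\in L(\mathcal{Y},\mathcal{X})$ are mutually inverse iff $\mathcal{T}_{\mathcal{X}\mathcal{Y}}(t)A$, $\mathcal{T}_{\mathcal{Y}\mathcal{X}}(t)B$ are, for every $t$. Functional calculus: for $h$ such that $h\hat\varphi$ is an $L^1$-Fourier transform whenever $\hat\varphi$ is compactly supported, set $h\diamond x=(h\hat\varphi)^\vee x$ for $x$ of compact spectrum ($\hat\varphi$ compactly supported, $\equiv1$ near $\Lambda(x)$); $D(h)$ is the domain of the closure of this operator. $\mathbf{e}_\alpha(\lambda)=e^{\alpha\cdot\lambda}$. *)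

theory Defs
  imports "HOL-Analysis.Analysis"
begin

class complex_normed_vector = real_normed_vector +
  fixes scaleC :: "complex \<Rightarrow> 'a \<Rightarrow> 'a"  (infixr \<open>*\<^sub>C\<close> 75)
  assumes scaleC_add_right: "a *\<^sub>C (x + y) = a *\<^sub>C x + a *\<^sub>C y"
    and scaleC_add_left: "(a + b) *\<^sub>C x = a *\<^sub>C x + b *\<^sub>C x"
    and scaleC_scaleC: "a *\<^sub>C (b *\<^sub>C x) = (a * b) *\<^sub>C x"
    and scaleC_one: "1 *\<^sub>C x = x"
    and scaleC_of_real: "complex_of_real r *\<^sub>C x = r *\<^sub>R x"
    and norm_scaleC: "norm (a *\<^sub>C x) = norm a * norm x"

text \<open>Functions on R^d are modelled on \<open>real^'d\<close> ('d a finite index type).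
  Elements of L^1(R^d) are (representatives) \<open>f :: real^'d \<Rightarrow> complex\<close> with
  \<open>integrable lborel f\<close>.\<close>

definition L1norm :: "(real^'d \<Rightarrow> complex) \<Rightarrow> real" where
  "L1norm f = (\<integral>t. norm (f t) \<partial>lborel)"

definition conv :: "(real^'d \<Rightarrow> complex) \<Rightarrow> (real^'d \<Rightarrow> complex) \<Rightarrow> real^'d \<Rightarrow> complex" where
  "conv f g t = (\<integral>s. f s * g (t - s) \<partial>lborel)"

definition fourier :: "(real^'d \<Rightarrow> complex) \<Rightarrow> real^'d \<Rightarrow> complex" where
  "fourier f \<xi> = (\<integral>t. f t * exp (- \<i> * complex_of_real (t \<bullet> \<xi>)) \<partial>lborel)"

definition cblin :: "('u::complex_normed_vector \<Rightarrow> 'v::complex_normed_vector) set" where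
  "cblin = {A. bounded_linear A \<and> (\<forall>c v. A (c *\<^sub>C v) = c *\<^sub>C A v)}"

definition opdiff :: "('u \<Rightarrow> 'v::ab_group_add) \<Rightarrow> ('u \<Rightarrow> 'v) \<Rightarrow> 'u \<Rightarrow> 'v" where
  "opdiff A B = (\<lambda>v. A v - B v)"

definition L1_module ::
  "(real^'d \<Rightarrow> ('u::complex_normed_vector \<Rightarrow> 'v::complex_normed_vector) \<Rightarrow> ('u \<Rightarrow> 'v))
   \<Rightarrow> ((real^'d \<Rightarrow> complex) \<Rightarrow> ('u \<Rightarrow> 'v) \<Rightarrow> ('u \<Rightarrow> 'v)) \<Rightarrow> bool" where
  "L1_module T act \<longleftrightarrow>
     \<comment> \<open>T is a representation by invertible (linear) isometries\<close>
     (\<forall>t A. A \<in> cblin \<longrightarrow> T t A \<in> cblin) \<and>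
     (\<forall>t A B. A \<in> cblin \<longrightarrow> B \<in> cblin \<longrightarrow> T t (\<lambda>v. A v + B v) = (\<lambda>v. T t A v + T t B v)) \<and>
     (\<forall>t c A. A \<in> cblin \<longrightarrow> T t (\<lambda>v. c *\<^sub>C A v) = (\<lambda>v. c *\<^sub>C T t A v)) \<and>
     (\<forall>t A. A \<in> cblin \<longrightarrow> onorm (T t A) = onorm A) \<and>
     (\<forall>A. A \<in> cblin \<longrightarrow> T 0 A = A) \<and>
     (\<forall>s t A. A \<in> cblin \<longrightarrow> T (s + t) A = T s (T t A)) \<and>
     \<comment> \<open>module axioms\<close>
     (\<forall>f A. integrable lborel f \<longrightarrow> A \<in> cblin \<longrightarrow> act f A \<in> cblin) \<and>
     (\<forall>f g A. integrable lborel f \<longrightarrow> integrable lborel g \<longrightarrow> A \<in> cblin \<longrightarrow>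
        act (\<lambda>s. f s + g s) A = (\<lambda>v. act f A v + act g A v)) \<and>
     (\<forall>f c A. integrable lborel f \<longrightarrow> A \<in> cblin \<longrightarrow>
        act (\<lambda>s. c * f s) A = (\<lambda>v. c *\<^sub>C act f A v)) \<and>
     (\<forall>f A B. integrable lborel f \<longrightarrow> A \<in> cblin \<longrightarrow> B \<in> cblin \<longrightarrow>
        act f (\<lambda>v. A v + B v) = (\<lambda>v. act f A v + act f B v)) \<and>
     (\<forall>f c A. integrable lborel f \<longrightarrow> A \<in> cblin \<longrightarrow>
        act f (\<lambda>v. c *\<^sub>C A v) = (\<lambda>v. c *\<^sub>C act f A v)) \<and>
     (\<forall>f g A. integrable lborel f \<longrightarrow> integrable lborel g \<longrightarrow> A \<in> cblin \<longrightarrow>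
        act (conv f g) A = act f (act g A)) \<and>
     (\<forall>f A. integrable lborel f \<longrightarrow> A \<in> cblin \<longrightarrow> onorm (act f A) \<le> L1norm f * onorm A) \<and>
     (\<forall>t f A. integrable lborel f \<longrightarrow> A \<in> cblin \<longrightarrow>
        T t (act f A) = act (\<lambda>s. f (s + t)) A \<and> T t (act f A) = act f (T t A)) \<and>
     \<comment> \<open>non-degeneracy\<close>
     (\<forall>A. A \<in> cblin \<longrightarrow> (\<forall>f. integrable lborel f \<longrightarrow> act f A = (\<lambda>_. 0)) \<longrightarrow> A = (\<lambda>_. 0))"

definition T_continuous :: "(real^'d \<Rightarrow> ('u::real_normed_vector \<Rightarrow> 'v::real_normed_vector) \<Rightarrow> ('u \<Rightarrow> 'v)) \<Rightarrow> ('u \<Rightarrow> 'v) \<Rightarrow> bool" where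
  "T_continuous T A \<longleftrightarrow> (\<forall>t. ((\<lambda>s. onorm (opdiff (T s A) (T t A))) \<longlongrightarrow> 0) (at t))"

definition beurling_spectrum ::
  "((real^'d \<Rightarrow> complex) \<Rightarrow> ('u \<Rightarrow> 'v::zero) \<Rightarrow> ('u \<Rightarrow> 'v)) \<Rightarrow> ('u \<Rightarrow> 'v) \<Rightarrow> (real^'d) set" where
  "beurling_spectrum act A =
     {\<gamma>. \<forall>f. integrable lborel f \<longrightarrow> act f A = (\<lambda>_. 0) \<longrightarrow> fourier f \<gamma> = 0}"

text \<open>Graph of the operator \<open>x \<mapsto> h \<diamond> x = (h \<hat>\<phi>)\<^sup>\<or> x\<close> on elements of compact spectrum,
  where \<open>\<hat>\<phi>\<close> is compactly supported and \<open>\<equiv> 1\<close> near the spectrum.\<close>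
definition fc_graph ::
  "((real^'d \<Rightarrow> complex) \<Rightarrow> ('u::complex_normed_vector \<Rightarrow> 'v::complex_normed_vector) \<Rightarrow> ('u \<Rightarrow> 'v))
   \<Rightarrow> (real^'d \<Rightarrow> complex) \<Rightarrow> (('u \<Rightarrow> 'v) \<times> ('u \<Rightarrow> 'v)) set" where
  "fc_graph act h =
     {(A, act g A) | A g \<phi>. A \<in> cblin \<and> compact (beurling_spectrum act A) \<and>
        integrable lborel \<phi> \<and> compact (closure {\<xi>. fourier \<phi> \<xi> \<noteq> 0}) \<and>
        (\<exists>U. open U \<and> beurling_spectrum act A \<subseteq> U \<and> (\<forall>\<xi>\<in>U. fourier \<phi> \<xi> = 1)) \<and>
        integrable lborel g \<and> (\<forall>\<xi>. fourier g \<xi> = h \<xi> * fourier \<phi> \<xi>)}"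

text \<open>D(h): domain of the closure of that operator (closure of its graph in L(U,V) x L(U,V)).\<close>
definition fc_domain ::
  "((real^'d \<Rightarrow> complex) \<Rightarrow> ('u::complex_normed_vector \<Rightarrow> 'v::complex_normed_vector) \<Rightarrow> ('u \<Rightarrow> 'v))
   \<Rightarrow> (real^'d \<Rightarrow> complex) \<Rightarrow> ('u \<Rightarrow> 'v) set" where
  "fc_domain act h =
     {A \<in> cblin. \<exists>C \<in> cblin. \<exists>As Cs. (\<forall>n. (As n, Cs n) \<in> fc_graph act h) \<and>
        (\<lambda>n. onorm (opdiff (As n) A)) \<longlonglongrightarrow> 0 \<and> (\<lambda>n. onorm (opdiff (Cs n) C)) \<longlonglongrightarrow> 0}"

definition exp_fun :: "real^'d \<Rightarrow> real^'d \<Rightarrow> complex" where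
  "exp_fun \<alpha> \<xi> = complex_of_real (exp (\<alpha> \<bullet> \<xi>))"

definition rep_compat where
  "rep_compat T1 T2 T3 \<longleftrightarrow>
     (\<forall>t A B. A \<in> cblin \<longrightarrow> B \<in> cblin \<longrightarrow> T3 t (B \<circ> A) = T2 t B \<circ> T1 t A)"

definition mutually_inverse :: "('x \<Rightarrow> 'y) \<Rightarrow> ('y \<Rightarrow> 'x) \<Rightarrow> bool" where
  "mutually_inverse A B \<longleftrightarrow> B \<circ> A = id \<and> A \<circ> B = id"

end

theory Submission
  imports Defs "HOL-Probability.Sinc_Integral"
begin

text \<open>
  Formally \<open>e\<^sub>\<alpha> \<diamond> x = T(-\<i>\<alpha>) x\<close>, so \<open>A \<in> D(e\<^sub>\<alpha>)\<close> should mean that \<open>t \<mapsto> T(t\<alpha>) A\<close> continues analytically to a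
  strip of width one. Elements of compact spectrum are fixed by every kernel whose transform is one near the
  spectrum (Wiener's local theorem), hence have an entire extension; a three lines inequality makes the
  extensions \<open>A\<^sub>n(s)\<close> of the approximants of \<open>A\<close> converge uniformly for \<open>0 \<le> s \<le> 1\<close>. Since \<open>A\<close> is invertible, so
  are the \<open>A\<^sub>n(s)\<close> for \<open>0 \<le> s \<le> \<delta>\<close>. The inverses \<open>R\<^sub>n(s)\<close> satisfy the same Cauchy-Riemann equation as the
  \<open>A\<^sub>n(s)\<close>, because \<open>T(t)\<close> maps inverse pairs to inverse pairs. After smoothing by a kernel \<open>k\<close> of compactly
  supported transform this equation lives in a space where its generator is bounded, so \<open>k R\<^sub>n(\<delta>)\<close> is
  the continuation of \<open>k R\<^sub>n(0)\<close>. In the limit \<open>k R = e\<^sub>\<delta>\<^sub>\<alpha> \<diamond> k B\<close> with \<open>R = lim R\<^sub>n(\<delta>)\<close>, and letting \<open>k\<close> run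
  through an approximate identity shows \<open>B \<in> D(e\<^sub>\<delta>\<^sub>\<alpha>)\<close>.
\<close>

section \<open>Integrable functions and the Fourier transform\<close>

text \<open>Inversion destroys compactness of the spectrum: the inverse of a band-limited operator
  need not be band-limited, so the power series that continue an approximant cannot be applied to
  its inverse. Only first-order expansions in the real and imaginary directions are available for
  the inverse, and they can be integrated only after a kernel has been applied. The action is known
  through its axioms alone. Nondegeneracy makes two elements equal when every \<open>act f\<close>
  agrees on them, and \<open>act f x\<close> depends only on the transform of \<open>f\<close>, so
  most identities are checked between transforms. All kernels descend from one tent: its translates
  add up to cutoffs equal to one on a cube and to a multiplier equal to \<alpha> \<bullet> \<xi>
  there, and exponential multipliers are power series in the latter. The number \<delta> is not
  explicit: it is a time during which the continuation of a single late approximant stays within the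
  radius where a perturbation of \<open>A\<close> remains invertible. As \<delta> is positive,
  \<delta>\<alpha> has the signs of \<alpha>.\<close>

lemma
  fixes f :: "'a::euclidean_space \<Rightarrow> 'b::{banach,second_countable_topology}"
  shows integrable_lborel_shift: "integrable lborel f \<Longrightarrow> integrable lborel (\<lambda>x. f (x + a))"
    and integral_lborel_shift: "f \<in> borel_measurable borel \<Longrightarrow> (\<integral>x. f (x + a) \<partial>lborel) = (\<integral>x. f x \<partial>lborel)"
proof -
  assume f: "integrable lborel f"
  then have "integrable (distr lborel borel ((+) a)) f" by (simp add: lborel_distr_plus)
  then show "integrable lborel (\<lambda>x. f (x + a))"
    using f by (subst (asm) integrable_distr_eq) (auto simp: add.commute)
next
  assume f: "f \<in> borel_measurable borel"
  have "(\<integral>x. f x \<partial>lborel) = (\<integral>x. f x \<partial>distr lborel borel ((+) a))" by (simp add: lborel_distr_plus)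
  also have "\<dots> = (\<integral>x. f (x + a) \<partial>lborel)"
    using f by (subst integral_distr) (auto simp: add.commute)
  finally show "(\<integral>x. f (x + a) \<partial>lborel) = (\<integral>x. f x \<partial>lborel)" ..
qed

lemma integrable_lborel_shift_minus:
  fixes f :: "'a::euclidean_space \<Rightarrow> 'b::{banach,second_countable_topology}"
  shows "integrable lborel f \<Longrightarrow> integrable lborel (\<lambda>x. f (x - a))"
  using integrable_lborel_shift[of f "-a"] by simp

lemma integral_lborel_shift_minus:
  fixes f :: "'a::euclidean_space \<Rightarrow> 'b::{banach,second_countable_topology}"
  shows "f \<in> borel_measurable borel \<Longrightarrow> (\<integral>x. f (x - a) \<partial>lborel) = (\<integral>x. f x \<partial>lborel)"
  using integral_lborel_shift[of f "-a"] by simp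

lemma integral_lborel_affine:
  fixes f :: "'a::euclidean_space \<Rightarrow> 'b::{banach,second_countable_topology}"
  assumes f: "f \<in> borel_measurable borel" and c: "c \<noteq> 0"
  shows "(\<integral>x. f x \<partial>lborel) = \<bar>c\<bar> ^ DIM('a) *\<^sub>R (\<integral>x. f (a + c *\<^sub>R x) \<partial>lborel)"
proof -
  have eq: "lborel = density (distr lborel borel (\<lambda>x. a + c *\<^sub>R x)) (\<lambda>_. ennreal (\<bar>c\<bar>^DIM('a)))"
    using lborel_affine[OF c, of a] by simp
  have [measurable]: "f \<in> borel_measurable borel" by fact
  show ?thesis
    by (subst eq, subst integral_density) (simp_all add: integral_distr)
qed

lemma integral_lborel_reflect:
  fixes f :: "'a::euclidean_space \<Rightarrow> 'b::{banach,second_countable_topology}"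
  assumes "f \<in> borel_measurable borel"
  shows "(\<integral>x. f (a - x) \<partial>lborel) = (\<integral>x. f x \<partial>lborel)"
  using integral_lborel_affine[OF assms, of "-1" a] by simp

lemma L1norm_nonneg: "0 \<le> L1norm f"
  by (simp add: L1norm_def)

lemma L1norm_add_le:
  "integrable lborel f \<Longrightarrow> integrable lborel g \<Longrightarrow> L1norm (\<lambda>t. f t + g t) \<le> L1norm f + L1norm g"
  unfolding L1norm_def
  by (subst Bochner_Integration.integral_add[symmetric])
     (auto intro!: integral_mono norm_triangle_ineq simp del: Bochner_Integration.integral_add)

lemma L1norm_diff_le:
  "integrable lborel f \<Longrightarrow> integrable lborel g \<Longrightarrow> L1norm (\<lambda>t. f t - g t) \<le> L1norm f + L1norm g"
  using L1norm_add_le[of f "\<lambda>t. - g t"] by (simp add: L1norm_def)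

lemma L1norm_shift:
  "f \<in> borel_measurable borel \<Longrightarrow> L1norm (\<lambda>t. f (t - s)) = L1norm f"
  unfolding L1norm_def by (rule integral_lborel_shift_minus[where f="\<lambda>t. norm (f t)"]) auto

section \<open>Convolution and Fubini on sheared products\<close>

text \<open>Translation invariance makes the inner integral independent of the shift, so
  \<open>p\<close> can be any measurable map. One Fubini argument then covers convolutions
  (\<open>p s = s\<close>), plain products (\<open>p = 0\<close>) and finite sums of translates
  (\<open>p\<close> simple).\<close>

lemma integrable_shear:
  fixes k g :: "real^'d \<Rightarrow> complex" and p :: "real^'d \<Rightarrow> real^'d"
  assumes k: "integrable lborel k" and g: "integrable lborel g" and p: "p \<in> borel_measurable borel"
  shows "integrable (lborel \<Otimes>\<^sub>M lborel) (\<lambda>(s,t). k s * g (t - p s))"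
proof (rule lborel_pair.Fubini_integrable)
  have [measurable]: "k \<in> borel_measurable borel" "g \<in> borel_measurable borel" "p \<in> borel_measurable borel"
    using k g p by auto
  show "(\<lambda>(s, t). k s * g (t - p s)) \<in> borel_measurable (lborel \<Otimes>\<^sub>M lborel)" by simp
  have "(\<integral>t. norm (k s * g (t - p s)) \<partial>lborel) = norm (k s) * L1norm g" for s
    using L1norm_shift[of g "p s"] by (simp add: norm_mult L1norm_def)
  then show "integrable lborel (\<lambda>s. LINT t|lborel. norm (case (s, t) of (s, t) \<Rightarrow> k s * g (t - p s)))"
    using k by simp
  show "AE s in lborel. integrable lborel (\<lambda>t. case (s, t) of (s, t) \<Rightarrow> k s * g (t - p s))"
    using g by (simp add: integrable_lborel_shift_minus)
qed

lemma
  fixes F :: "real^'d \<Rightarrow> real^'d \<Rightarrow> complex"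
  assumes F: "integrable (lborel \<Otimes>\<^sub>M lborel) (\<lambda>(s,t). F s t)"
  shows integrable_Minkowski: "integrable lborel (\<lambda>t. \<integral>s. F s t \<partial>lborel)"
    and L1norm_integral_le: "L1norm (\<lambda>t. \<integral>s. F s t \<partial>lborel) \<le> (\<integral>s. L1norm (F s) \<partial>lborel)"
proof -
  show i1: "integrable lborel (\<lambda>t. \<integral>s. F s t \<partial>lborel)"
    using lborel_pair.integrable_snd[OF F] by simp
  have nF: "integrable (lborel \<Otimes>\<^sub>M lborel) (\<lambda>(s,t). norm (F s t))"
    using integrable_norm[OF F] by (simp add: case_prod_unfold)
  have i2: "integrable lborel (\<lambda>t. \<integral>s. norm (F s t) \<partial>lborel)"
    using lborel_pair.integrable_snd[OF nF] by simp
  have "L1norm (\<lambda>t. \<integral>s. F s t \<partial>lborel) \<le> (\<integral>t. (\<integral>s. norm (F s t) \<partial>lborel) \<partial>lborel)"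
    unfolding L1norm_def using i1 i2 by (intro integral_mono) auto
  also have "\<dots> = (\<integral>s. L1norm (F s) \<partial>lborel)"
    unfolding L1norm_def using lborel_pair.Fubini_integral[OF nF] .
  finally show "L1norm (\<lambda>t. \<integral>s. F s t \<partial>lborel) \<le> (\<integral>s. L1norm (F s) \<partial>lborel)" .
qed

lemma integrable_conv:
  assumes "integrable lborel f" "integrable lborel g"
  shows "integrable lborel (conv f g)"
  using integrable_Minkowski[OF integrable_shear[OF assms, of "\<lambda>s. s"]]
  unfolding conv_def by simp

lemma L1norm_conv_le:
  assumes f: "integrable lborel f" and g: "integrable lborel g"
  shows "L1norm (conv f g) \<le> L1norm f * L1norm g"
proof -
  have "L1norm (\<lambda>t. f s * g (t - s)) = norm (f s) * L1norm g" for s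
    using L1norm_shift[of g s] g by (simp add: norm_mult L1norm_def)
  then show ?thesis
    using L1norm_integral_le[OF integrable_shear[OF f g, of "\<lambda>s. s"]]
    unfolding conv_def by (simp add: L1norm_def)
qed

lemma conv_commute:
  assumes "f \<in> borel_measurable borel" "g \<in> borel_measurable borel"
  shows "conv f g = conv g f"
proof
  fix t
  have [measurable]: "f \<in> borel_measurable borel" "g \<in> borel_measurable borel" by fact+
  show "conv f g t = conv g f t"
    unfolding conv_def
    using integral_lborel_reflect[of "\<lambda>s. f s * g (t - s)" t] by (simp add: mult.commute)
qed

section \<open>The Fourier transform: algebra and continuity\<close>

lemma integrable_mult_character:
  "integrable lborel f \<Longrightarrow> integrable lborel (\<lambda>t. f t * exp (- \<i> * complex_of_real (t \<bullet> \<xi>)))"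
  by (rule Bochner_Integration.integrable_bound[of _ f]) (auto simp: norm_mult)

lemma fourier_conv:
  assumes f: "integrable lborel f" and g: "integrable lborel g"
  shows "fourier (conv f g) \<xi> = fourier f \<xi> * fourier g \<xi>"
proof -
  let ?e = "\<lambda>t. exp (- \<i> * complex_of_real (t \<bullet> \<xi>))"
  have [measurable]: "f \<in> borel_measurable borel" "g \<in> borel_measurable borel" using f g by auto
  have i: "integrable (lborel \<Otimes>\<^sub>M lborel) (\<lambda>(s,t). f s * g (t - s) * ?e t)"
    by (rule Bochner_Integration.integrable_bound[OF integrable_shear[OF f g, of "\<lambda>s. s"]])
       (auto simp: norm_mult)
  have "fourier (conv f g) \<xi> = (\<integral>t. (\<integral>s. f s * g (t - s) * ?e t \<partial>lborel) \<partial>lborel)"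
    unfolding fourier_def conv_def by (simp add: integral_mult_left_zero)
  also have "\<dots> = (\<integral>s. (\<integral>t. f s * g (t - s) * ?e t \<partial>lborel) \<partial>lborel)"
    using lborel_pair.Fubini_integral[OF i] .
  also have "\<dots> = (\<integral>s. f s * ?e s * fourier g \<xi> \<partial>lborel)"
  proof (intro Bochner_Integration.integral_cong refl)
    fix s
    have e: "?e t = ?e s * ?e (t - s)" for t
      unfolding exp_add[symmetric] by (simp add: algebra_simps inner_diff_left)
    have "f s * g (t - s) * ?e t = (f s * ?e s) * (g (t - s) * ?e (t - s))" for t
      by (subst e) (simp add: mult_ac)
    then have "(\<integral>t. f s * g (t - s) * ?e t \<partial>lborel) = (\<integral>t. (f s * ?e s) * (g (t - s) * ?e (t - s)) \<partial>lborel)"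
      by (simp only:)
    also have "\<dots> = (f s * ?e s) * (\<integral>t. g (t - s) * ?e (t - s) \<partial>lborel)" by simp
    also have "(\<integral>t. g (t - s) * ?e (t - s) \<partial>lborel) = fourier g \<xi>"
      unfolding fourier_def by (rule integral_lborel_shift_minus[where f="\<lambda>t. g t * ?e t"]) simp
    finally show "(\<integral>t. f s * g (t - s) * ?e t \<partial>lborel) = f s * ?e s * fourier g \<xi>" .
  qed
  also have "\<dots> = fourier f \<xi> * fourier g \<xi>" unfolding fourier_def by simp
  finally show ?thesis .
qed

lemma fourier_diff: "integrable lborel f \<Longrightarrow> integrable lborel g \<Longrightarrow>
    fourier (\<lambda>t. f t - g t) \<xi> = fourier f \<xi> - fourier g \<xi>"
  using integrable_mult_character[of f \<xi>] integrable_mult_character[of g \<xi>]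
  by (simp add: fourier_def left_diff_distrib)

lemma fourier_cmult: "fourier (\<lambda>t. c * f t) \<xi> = c * fourier f \<xi>"
  by (simp add: fourier_def mult.assoc)

lemma fourier_sum: "(\<And>j. j \<in> J \<Longrightarrow> integrable lborel (f j)) \<Longrightarrow>
    fourier (\<lambda>t. \<Sum>j\<in>J. f j t) \<xi> = (\<Sum>j\<in>J. fourier (f j) \<xi>)"
  using integrable_mult_character[of "f _" \<xi>]
  by (simp add: fourier_def sum_distrib_right)

lemma fourier_shift:
  assumes "f \<in> borel_measurable borel"
  shows "fourier (\<lambda>t. f (t + a)) \<xi> = exp (\<i> * complex_of_real (a \<bullet> \<xi>)) * fourier f \<xi>"
proof -
  let ?e = "\<lambda>t. exp (- \<i> * complex_of_real (t \<bullet> \<xi>))"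
  have [measurable]: "f \<in> borel_measurable borel" by fact
  have *: "?e t = exp (\<i> * complex_of_real (a \<bullet> \<xi>)) * ?e (t + a)" for t
    unfolding exp_add[symmetric] by (simp add: algebra_simps inner_add_left)
  have "f (t + a) * ?e t = exp (\<i> * complex_of_real (a \<bullet> \<xi>)) * (f (t + a) * ?e (t + a))" for t
    by (subst *) (simp add: mult_ac)
  then have "fourier (\<lambda>t. f (t + a)) \<xi> = exp (\<i> * complex_of_real (a \<bullet> \<xi>)) * (\<integral>t. f (t + a) * ?e (t + a) \<partial>lborel)"
    unfolding fourier_def by (simp only: integral_mult_right_zero)
  also have "(\<integral>t. f (t + a) * ?e (t + a) \<partial>lborel) = fourier f \<xi>"
    unfolding fourier_def by (rule integral_lborel_shift[where f="\<lambda>t. f t * ?e t"]) simp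
  finally show ?thesis .
qed

lemma continuous_on_fourier:
  assumes f: "integrable lborel f"
  shows "continuous_on UNIV (fourier f)"
proof (rule continuous_at_imp_continuous_on, rule ballI)
  fix \<xi>
  have [measurable]: "f \<in> borel_measurable borel" using f by auto
  show "isCont (fourier f) \<xi>"
    unfolding continuous_at_sequentially
  proof (intro allI impI)
    fix X assume X: "X \<longlonglongrightarrow> \<xi>"
    show "(fourier f \<circ> X) \<longlonglongrightarrow> fourier f \<xi>"
      unfolding fourier_def o_def
    proof (rule integral_dominated_convergence[where w="\<lambda>t. norm (f t)"])
      show "AE t in lborel. (\<lambda>i. f t * exp (- \<i> * complex_of_real (t \<bullet> X i))) \<longlonglongrightarrow> f t * exp (- \<i> * complex_of_real (t \<bullet> \<xi>))"
        using X by (auto intro!: tendsto_eq_intros)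
    qed (use f in \<open>auto simp: norm_mult\<close>)
  qed
qed

section \<open>Continuity of translation in L^1\<close>

text \<open>Openness gives pointwise convergence only at points of \<open>U\<close>, and only the
  part of the difference living on \<open>U\<close> has a fixed dominating function. That part
  suffices: \<open>U\<close> and its translate have equal measure, so the positive and negative
  parts of the difference have the same integral.\<close>

lemma integral_abs_diff_shift_open:
  fixes U :: "'a::euclidean_space set"
  assumes U: "open U" "emeasure lborel U < \<infinity>" and X: "X \<longlonglongrightarrow> 0"
  shows "(\<lambda>n. \<integral>t. norm (indicator U (t - X n) - indicator U t :: real) \<partial>lborel) \<longlonglongrightarrow> 0"
proof -
  let ?u = "indicator U :: 'a \<Rightarrow> real"
  have [measurable]: "U \<in> sets borel" using U by auto
  have iU: "integrable lborel ?u" using U by (auto simp: integrable_indicator_iff)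
  have iUn: "integrable lborel (\<lambda>t. ?u (t - s))" for s
    by (rule integrable_lborel_shift_minus[OF iU])
  have "(\<lambda>n. \<integral>t. max 0 (?u t - ?u (t - X n)) \<partial>lborel) \<longlonglongrightarrow> (\<integral>t. 0 \<partial>(lborel :: 'a measure))"
  proof (rule integral_dominated_convergence[where w="?u"])
    show "AE t in lborel. (\<lambda>n. max 0 (?u t - ?u (t - X n))) \<longlonglongrightarrow> 0"
    proof (rule AE_I2)
      fix t
      show "(\<lambda>n. max 0 (?u t - ?u (t - X n))) \<longlonglongrightarrow> 0"
      proof (cases "t \<in> U")
        case True
        have "(\<lambda>n. t - X n) \<longlonglongrightarrow> t" using tendsto_diff[OF tendsto_const[of t] X] by simp
        then have "\<forall>\<^sub>F n in sequentially. t - X n \<in> U"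
          using U(1) True by (rule topological_tendstoD)
        then show ?thesis
          by (intro tendsto_eventually) (auto elim!: eventually_mono)
      qed simp
    qed
  qed (use iU in \<open>auto simp: indicator_def\<close>)
  moreover have "(\<integral>t. norm (?u (t - s) - ?u t) \<partial>lborel) = 2 * (\<integral>t. max 0 (?u t - ?u (t - s)) \<partial>lborel)" for s
  proof -
    have eq: "norm (?u (t - s) - ?u t) = 2 * max 0 (?u t - ?u (t - s)) + (?u (t - s) - ?u t)" for t
      by (auto simp: max_def)
    have i: "integrable lborel (\<lambda>t. max 0 (?u t - ?u (t - s)))"
      by (rule Bochner_Integration.integrable_bound[OF iU]) (auto simp: indicator_def)
    have "(\<integral>t. ?u (t - s) \<partial>lborel) = (\<integral>t. ?u t \<partial>lborel)"
      by (rule integral_lborel_shift_minus) simp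
    then show ?thesis unfolding eq using i iU iUn[of s] by simp
  qed
  ultimately show ?thesis
    using tendsto_mult_right_zero[of "\<lambda>n. \<integral>t. max 0 (?u t - ?u (t - X n)) \<partial>lborel" sequentially 2]
    by simp
qed

text \<open>The property is linear and closed under L^1 limits, so it is enough to know it for
  indicators; measurable sets reduce to open ones by outer regularity.\<close>

lemma L1_translation_continuous:
  fixes f :: "'a::euclidean_space \<Rightarrow> 'b::{banach,second_countable_topology}"
  assumes "integrable lborel f" and X: "X \<longlonglongrightarrow> 0"
  shows "(\<lambda>n. \<integral>t. norm (f (t - X n) - f t) \<partial>lborel) \<longlonglongrightarrow> 0"
proof -
  \<comment> \<open>Closure under L^1 limits. Two of the three error terms agree by translation
    invariance. It serves twice: in the limit case and in passing from open to measurable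
    sets.\<close>
  have approx: "(\<lambda>n. \<integral>t. norm (f (t - X n) - f t) \<partial>lborel) \<longlonglongrightarrow> 0"
    if f: "integrable lborel f"
      and *: "\<And>e. e > 0 \<Longrightarrow> \<exists>g. integrable lborel g \<and> (\<integral>t. norm (f t - g t) \<partial>lborel) \<le> e \<and>
         (\<lambda>n. \<integral>t. norm (g (t - X n) - g t) \<partial>lborel) \<longlonglongrightarrow> 0" for f :: "'a \<Rightarrow> 'b"
  proof (rule tendstoI)
    fix e :: real assume e: "e > 0"
    obtain g where g: "integrable lborel g" "(\<integral>t. norm (f t - g t) \<partial>lborel) \<le> e/4"
        "(\<lambda>n. \<integral>t. norm (g (t - X n) - g t) \<partial>lborel) \<longlonglongrightarrow> 0"
      using *[of "e/4"] e by auto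
    have "\<forall>\<^sub>F n in sequentially. (\<integral>t. norm (g (t - X n) - g t) \<partial>lborel) < e/4"
      using order_tendstoD(2)[OF g(3), of "e/4"] e by simp
    then show "\<forall>\<^sub>F n in sequentially. dist (\<integral>t. norm (f (t - X n) - f t) \<partial>lborel) 0 < e"
    proof eventually_elim
      case (elim n)
      have i: "integrable lborel (\<lambda>t. norm (f t - g t))" "integrable lborel (\<lambda>t. norm (f (t - X n) - g (t - X n)))"
          "integrable lborel (\<lambda>t. norm (g (t - X n) - g t))" "integrable lborel (\<lambda>t. norm (f (t - X n) - f t))"
        using f g(1) integrable_lborel_shift_minus[OF f] integrable_lborel_shift_minus[OF g(1)] by auto
      have sh: "(\<integral>t. norm (f (t - X n) - g (t - X n)) \<partial>lborel) = (\<integral>t. norm (f t - g t) \<partial>lborel)"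
        using f g(1) by (intro integral_lborel_shift_minus[where f="\<lambda>t. norm (f t - g t)"]) auto
      have "norm (f (t - X n) - f t) \<le> (norm (f (t - X n) - g (t - X n)) + norm (g (t - X n) - g t)) + norm (f t - g t)" for t
        by norm
      then have "(\<integral>t. norm (f (t - X n) - f t) \<partial>lborel) \<le>
          (\<integral>t. (norm (f (t - X n) - g (t - X n)) + norm (g (t - X n) - g t)) + norm (f t - g t) \<partial>lborel)"
        using i by (intro integral_mono) auto
      also have "\<dots> \<le> e/4 + e/4 + e/4"
        using i g(2) elim sh by simp
      also have "\<dots> < e" using e by simp
      finally show ?case by simp
    qed
  qed
  show ?thesis
    using assms(1)
  proof (induction f rule: integrable_induct)
    case (base A c)
    show ?case
    proof (rule approx)
      have A: "A \<in> sets borel" using base by simp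
      show "integrable lborel (\<lambda>x. indicator A x *\<^sub>R c)" using base by simp
      fix e :: real assume e: "e > 0"
      \<comment> \<open>The added one keeps the denominator positive when \<open>c\<close> is
        zero.\<close>
      define e' where "e' = e / (norm c + 1)"
      have e': "e' > 0" using e by (simp add: e'_def add_nonneg_pos)
      obtain U where U: "open U" "A \<subseteq> U" "emeasure lborel (U - A) \<le> ennreal e'"
        using outer_regular_lborel_le[OF A e'] .
      have [measurable]: "A \<in> sets borel" "U \<in> sets borel" using A U by auto
      have "emeasure lborel U = emeasure lborel A + emeasure lborel (U - A)"
        using U(2) by (subst plus_emeasure) (auto simp: Un_absorb1)
      also have "\<dots> < \<infinity>"
        using base(2) le_less_trans[OF U(3) ennreal_less_top] by simp
      finally have Uf: "emeasure lborel U < \<infinity>" .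
      let ?g = "\<lambda>x. indicator U x *\<^sub>R c"
      have "(\<integral>t. norm (indicator A t *\<^sub>R c - ?g t) \<partial>lborel) = (\<integral>t. norm c * indicator (U - A) t \<partial>lborel)"
        using U(2) by (intro Bochner_Integration.integral_cong) (auto simp: indicator_def)
      also have "\<dots> = norm c * measure lborel (U - A)"
        by simp
      also have "measure lborel (U - A) \<le> e'"
        using U(3) e' by (simp add: measure_def enn2real_leI)
      then have "norm c * measure lborel (U - A) \<le> norm c * e'" by (rule mult_left_mono) simp
      also have "\<dots> \<le> (norm c + 1) * e'" using e' by (intro mult_right_mono) auto
      also have "\<dots> = e" using norm_ge_zero[of c] by (simp add: e'_def add_nonneg_eq_0_iff)
      finally have 1: "(\<integral>t. norm (indicator A t *\<^sub>R c - ?g t) \<partial>lborel) \<le> e" by simp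
      have "norm (?g (t - X n) - ?g t) = norm (indicator U (t - X n) - indicator U t :: real) * norm c" for n t
        by (auto simp: indicator_def)
      then have 2: "(\<lambda>n. \<integral>t. norm (?g (t - X n) - ?g t) \<partial>lborel) \<longlonglongrightarrow> 0"
        using tendsto_mult_left_zero[OF integral_abs_diff_shift_open[OF U(1) Uf X], of "norm c"] by simp
      show "\<exists>g. integrable lborel g \<and> (\<integral>t. norm (indicator A t *\<^sub>R c - g t) \<partial>lborel) \<le> e \<and>
         (\<lambda>n. \<integral>t. norm (g (t - X n) - g t) \<partial>lborel) \<longlonglongrightarrow> 0"
        using 1 2 Uf by (intro exI[of _ ?g]) auto
    qed
  next
    case (add f g)
    show ?case
    proof (rule tendsto_sandwich[OF _ _ tendsto_const])
      show "(\<lambda>n. (\<integral>t. norm (f (t - X n) - f t) \<partial>lborel) + (\<integral>t. norm (g (t - X n) - g t) \<partial>lborel)) \<longlonglongrightarrow> 0"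
        using tendsto_add[OF add.IH] by simp
      show "\<forall>\<^sub>F n in sequentially. (\<integral>t. norm (f (t - X n) + g (t - X n) - (f t + g t)) \<partial>lborel)
        \<le> (\<integral>t. norm (f (t - X n) - f t) \<partial>lborel) + (\<integral>t. norm (g (t - X n) - g t) \<partial>lborel)"
      proof (intro always_eventually allI)
        fix n
        have i: "integrable lborel (\<lambda>t. f (t - X n))" "integrable lborel (\<lambda>t. g (t - X n))"
          using add.hyps integrable_lborel_shift_minus by auto
        show "(\<integral>t. norm (f (t - X n) + g (t - X n) - (f t + g t)) \<partial>lborel)
          \<le> (\<integral>t. norm (f (t - X n) - f t) \<partial>lborel) + (\<integral>t. norm (g (t - X n) - g t) \<partial>lborel)"
          using i add.hyps
          by (subst Bochner_Integration.integral_add[symmetric])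
             (auto intro!: integral_mono norm_diff_triangle_ineq simp del: Bochner_Integration.integral_add)
      qed
    qed auto
  next
    case (lim f s)
    show ?case
    proof (rule approx)
      fix e :: real assume e: "e > 0"
      have "(\<lambda>i. \<integral>t. norm (f t - s i t) \<partial>lborel) \<longlonglongrightarrow> (\<integral>t. 0 \<partial>(lborel :: 'a measure))"
      proof (rule integral_dominated_convergence[where w="\<lambda>t. 3 * norm (f t)"])
        show "AE t in lborel. (\<lambda>i. norm (f t - s i t)) \<longlonglongrightarrow> 0"
          using lim.hyps(2) by (intro AE_I2) (auto intro!: tendsto_eq_intros)
        show "AE t in lborel. norm (norm (f t - s i t)) \<le> 3 * norm (f t)" for i
        proof (intro AE_I2)
          fix t
          show "norm (norm (f t - s i t)) \<le> 3 * norm (f t)"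
            using lim.hyps(3)[of t i] norm_triangle_ineq4[of "f t" "s i t"] by simp
        qed
      qed (use lim in auto)
      then have "\<forall>\<^sub>F i in sequentially. (\<integral>t. norm (f t - s i t) \<partial>lborel) < e"
        using e by (intro order_tendstoD) auto
      then obtain i where "(\<integral>t. norm (f t - s i t) \<partial>lborel) < e"
        by (auto simp: eventually_sequentially)
      then show "\<exists>g. integrable lborel g \<and> (\<integral>t. norm (f t - g t) \<partial>lborel) \<le> e \<and>
         (\<lambda>n. \<integral>t. norm (g (t - X n) - g t) \<partial>lborel) \<longlonglongrightarrow> 0"
        using lim.hyps lim.IH by (intro exI[of _ "s i"]) auto
    qed (use lim in auto)
  qed
qed

lemma tendsto_L1norm_shift:
  assumes "integrable lborel f" "X \<longlonglongrightarrow> 0"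
  shows "(\<lambda>n. L1norm (\<lambda>t. f (t - X n) - f t)) \<longlonglongrightarrow> 0"
  using L1_translation_continuous[OF assms] by (simp add: L1norm_def)

section \<open>Absolutely convergent series in L^1\<close>

text \<open>Monotone convergence gives absolute convergence almost everywhere, after which the sum
  and its transform are computed termwise. This is how kernels whose transform is a prescribed power
  series are produced.\<close>

lemma L1_series:
  fixes f :: "nat \<Rightarrow> real^'d \<Rightarrow> complex"
  assumes f: "\<And>k. integrable lborel (f k)" and s: "summable (\<lambda>k. L1norm (f k))"
  obtains g where "integrable lborel g" "\<And>\<xi>. (\<lambda>k. fourier (f k) \<xi>) sums fourier g \<xi>"
    "L1norm g \<le> (\<Sum>k. L1norm (f k))"
proof -
  have [measurable]: "f k \<in> borel_measurable borel" for k using f[of k] by auto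
  have "(\<integral>\<^sup>+t. (\<Sum>k. ennreal (norm (f k t))) \<partial>lborel) = (\<Sum>k. \<integral>\<^sup>+t. ennreal (norm (f k t)) \<partial>lborel)"
    by (intro nn_integral_suminf) auto
  also have "\<dots> = (\<Sum>k. ennreal (L1norm (f k)))"
    unfolding L1norm_def using f by (subst nn_integral_eq_integral) auto
  also have "\<dots> \<noteq> \<infinity>" using s by (simp add: ennreal_suminf_neq_top L1norm_nonneg)
  finally have "AE t in lborel. (\<Sum>k. ennreal (norm (f k t))) \<noteq> \<infinity>"
    by (intro nn_integral_PInf_AE) auto
  then have ae: "AE t in lborel. summable (\<lambda>k. norm (f k t))"
    by eventually_elim (auto intro!: summable_suminf_not_top)
  have sn: "summable (\<lambda>k. \<integral>t. norm (f k t) \<partial>lborel)" using s by (simp add: L1norm_def)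
  let ?g = "\<lambda>t. \<Sum>k. f k t"
  have ig: "integrable lborel ?g" by (rule integrable_suminf[OF f ae sn])
  have "(\<lambda>k. fourier (f k) \<xi>) sums fourier ?g \<xi>" for \<xi>
  proof -
    let ?e = "\<lambda>t. exp (- \<i> * complex_of_real (t \<bullet> \<xi>))"
    have "(\<lambda>k. \<integral>t. f k t * ?e t \<partial>lborel) sums (\<integral>t. (\<Sum>k. f k t * ?e t) \<partial>lborel)"
      using ae sn f by (intro sums_integral integrable_mult_character) (auto simp: norm_mult)
    moreover have "(\<integral>t. (\<Sum>k. f k t * ?e t) \<partial>lborel) = (\<integral>t. (\<Sum>k. f k t) * ?e t \<partial>lborel)"
    proof (rule integral_cong_AE)
      show "AE t in lborel. (\<Sum>k. f k t * ?e t) = (\<Sum>k. f k t) * ?e t"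
        using ae by eventually_elim (rule suminf_mult2[symmetric], rule summable_norm_cancel)
    qed auto
    ultimately show ?thesis by (simp add: fourier_def)
  qed
  moreover have "L1norm ?g \<le> (\<Sum>k. L1norm (f k))"
  proof -
    have "L1norm ?g \<le> (\<integral>t. (\<Sum>k. norm (f k t)) \<partial>lborel)"
      unfolding L1norm_def
    proof (rule integral_mono_AE)
      show "integrable lborel (\<lambda>t. \<Sum>k. norm (f k t))"
        using ae sn f by (intro integrable_suminf) auto
      show "AE t in lborel. norm (?g t) \<le> (\<Sum>k. norm (f k t))"
        using ae by eventually_elim (rule summable_norm)
    qed (use ig in auto)
    also have "\<dots> = (\<Sum>k. L1norm (f k))"
      unfolding L1norm_def using ae sn f by (intro integral_suminf) auto
    finally show ?thesis .
  qed
  ultimately show ?thesis using that ig by blast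
qed

section \<open>Kernels with compactly supported transform\<close>

text \<open>Chosen because its Fourier integral is explicit and nonnegative and because its integer
  translates reproduce both constants and linear functions.\<close>

definition tent :: "real \<Rightarrow> real" where "tent u = max 0 (1 - \<bar>u\<bar>)"

lemma tent_nonneg: "0 \<le> tent u" by (simp add: tent_def)
lemma tent_0: "tent 0 = 1" by (simp add: tent_def)
lemma tent_eq_0: "1 \<le> \<bar>u\<bar> \<Longrightarrow> tent u = 0" by (simp add: tent_def)
lemma tent_measurable[measurable]: "tent \<in> borel_measurable borel"
  unfolding tent_def by measurable

lemma integrable_tent:
  assumes r: "r > 0" shows "integrable lborel (\<lambda>u. tent (u / r))"
proof (rule Bochner_Integration.integrable_bound[of _ "indicator {-r..r} :: real \<Rightarrow> real"])
  show "AE x in lborel. norm (tent (x / r)) \<le> norm (indicator {- r..r} x :: real)"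
    using r by (intro AE_I2) (auto simp: indicator_def tent_def divide_simps abs_if)
qed (use r in \<open>auto simp: integrable_indicator_iff emeasure_lborel_Icc_eq\<close>)

text \<open>Piecewise linear interpolation of \<open>g\<close> at the integers: only the two nodes
  enclosing \<open>u\<close> contribute.\<close>

lemma sum_tent:
  fixes u :: real and N :: nat and g :: "int \<Rightarrow> real"
  assumes u: "\<bar>u\<bar> \<le> N"
  defines "m \<equiv> \<lfloor>u\<rfloor>"
  shows "(\<Sum>n\<in>{- int N..int N}. g n * tent (u - n)) = (m + 1 - u) * g m + (u - m) * g (m + 1)"
proof -
  have m: "of_int m \<le> u" "u < of_int m + 1" by (auto simp: m_def)
  have t0: "tent (u - of_int n) = 0" if "n \<noteq> m" "n \<noteq> m + 1" for n
  proof (rule tent_eq_0)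
    have "n \<le> m - 1 \<or> m + 2 \<le> n" using that by linarith
    then have "real_of_int n \<le> of_int m - 1 \<or> of_int m + 2 \<le> real_of_int n" by linarith
    then show "1 \<le> \<bar>u - of_int n\<bar>" using m by linarith
  qed
  \<comment> \<open>For \<open>u = N\<close> the node to the right of \<open>u\<close> is
    \<open>N + 1\<close>, which is missing from the sum. Its tent vanishes on the admissible range,
    so it can be added.\<close>
  have tN: "tent (u - of_int (int N + 1)) = 0" using u by (intro tent_eq_0) auto
  have sub: "{m, m+1} \<subseteq> {- int N..int N + 1}"
  proof -
    have "- real N \<le> u" "u \<le> real N" using u by auto
    then have "- int N \<le> m" "m \<le> int N" unfolding m_def by linarith+
    then show ?thesis by auto
  qed
  have "{- int N..int N + 1} = insert (int N + 1) {- int N..int N}" by auto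
  then have "(\<Sum>n\<in>{- int N..int N}. g n * tent (u - n)) = (\<Sum>n\<in>{- int N..int N + 1}. g n * tent (u - n))"
    using tN by (simp add: algebra_simps)
  also have "\<dots> = (\<Sum>n\<in>{m, m+1}. g n * tent (u - n))"
    using sub by (intro sum.mono_neutral_right) (auto simp: t0)
  also have "\<dots> = g m * tent (u - m) + g (m + 1) * tent (u - (m + 1))" by simp
  also have "tent (u - m) = m + 1 - u" using m by (simp add: tent_def)
  also have "tent (u - (m + 1)) = u - m" using m by (simp add: tent_def)
  finally show ?thesis by (simp add: algebra_simps)
qed

lemma sum_tent_1: fixes u :: real shows "\<bar>u\<bar> \<le> real N \<Longrightarrow> (\<Sum>n\<in>{- int N..int N}. tent (u - n)) = 1"
  using sum_tent[of u N "\<lambda>_. 1"] by simp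

lemma sum_tent_id: fixes u :: real shows "\<bar>u\<bar> \<le> real N \<Longrightarrow> (\<Sum>n\<in>{- int N..int N}. n * tent (u - n)) = u"
  using sum_tent[of u N real_of_int] by (simp add: algebra_simps)

section \<open>The Fejer kernel in one variable\<close>

definition fejer_mass :: real where "fejer_mass = (\<integral>t. (1 - cos t) / t\<^sup>2 \<partial>lborel)"

lemma one_minus_cos_le: "1 - cos t \<le> t\<^sup>2 / 2" for t :: real
proof -
  have "1 - cos t = 2 * (sin (t / 2))\<^sup>2" using cos_double_sin[of "t / 2"] by simp
  moreover have "\<bar>sin (t / 2)\<bar> \<le> \<bar>t / 2\<bar>" by (rule abs_sin_x_le_abs_x)
  then have "(sin (t / 2))\<^sup>2 \<le> (t / 2)\<^sup>2" by (rule abs_le_square_iff[THEN iffD1])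
  ultimately show ?thesis by (simp add: power_divide)
qed

lemma integrable_fejer: "integrable lborel (\<lambda>t::real. (1 - cos t) / t\<^sup>2)"
proof (rule Bochner_Integration.integrable_bound[of _ "\<lambda>t. 3 * inverse (1 + t\<^sup>2)"])
  show "integrable lborel (\<lambda>t::real. 3 * inverse (1 + t\<^sup>2))"
    using integrable_inverse_1_plus_square by (simp add: set_integrable_def)
  show "AE t in lborel. norm ((1 - cos t) / t\<^sup>2) \<le> norm (3 * inverse (1 + t\<^sup>2) :: real)"
  proof (rule AE_I2)
    fix t :: real
    show "norm ((1 - cos t) / t\<^sup>2) \<le> norm (3 * inverse (1 + t\<^sup>2) :: real)"
    proof (cases "t = 0")
      case False
      have "(1 - cos t) * (1 + t\<^sup>2) = (1 - cos t) + (1 - cos t) * t\<^sup>2" by (simp add: algebra_simps)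
      \<comment> \<open>The first summand is controlled by the quadratic bound, the second by
        \<open>1 - cos t \<le> 2\<close>; the sum 5/2 is rounded up to the constant 3.\<close>
      also have "\<dots> \<le> t\<^sup>2 / 2 + 2 * t\<^sup>2"
        using one_minus_cos_le[of t] cos_ge_minus_one[of t] by (intro add_mono mult_right_mono) auto
      also have "\<dots> \<le> 3 * t\<^sup>2" by simp
      finally have "(1 - cos t) * (1 + t\<^sup>2) \<le> 3 * t\<^sup>2" .
      moreover have "0 < 1 + t\<^sup>2" by (simp add: add_pos_nonneg)
      ultimately have "(1 - cos t) / t\<^sup>2 \<le> 3 * inverse (1 + t\<^sup>2)" using False
        by (simp add: field_simps)
      moreover have "0 \<le> (1 - cos t) / t\<^sup>2" by simp
      ultimately show ?thesis using \<open>0 < 1 + t\<^sup>2\<close> by simp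
    qed simp
  qed
qed auto

lemma fejer_mass_pos: "fejer_mass > 0"
proof -
  have "0 < (1 - cos 1) / 4 * (\<integral>t. indicator {1..2::real} t \<partial>lborel :: real)"
    using cos_monotone_0_pi[of 0 1] pi_gt3 by simp
  also have "\<dots> = (\<integral>t. (1 - cos 1) / 4 * indicator {1..2::real} t \<partial>lborel)" by simp
  also have "\<dots> \<le> fejer_mass"
    unfolding fejer_mass_def
  proof (intro integral_mono)
    fix t :: real
    show "(1 - cos 1) / 4 * indicator {1..2} t \<le> (1 - cos t) / t\<^sup>2"
    proof (cases "t \<in> {1..2}")
      case True
      have "cos t \<le> cos 1" using True pi_gt3 by (intro cos_monotone_0_pi_le) auto
      moreover have "t\<^sup>2 \<le> 2\<^sup>2" using True by (intro power_mono) auto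
      moreover have "t\<^sup>2 > 0" using True by auto
      ultimately have "(1 - cos 1) / 4 \<le> (1 - cos t) / t\<^sup>2" by (intro frac_le) auto
      then show ?thesis using True by simp
    qed simp
  qed (use integrable_fejer in auto)
  finally show ?thesis .
qed

text \<open>A substitution. The point is the dependence on \<open>\<bar>a\<bar>\<close>: a tent is a
  second difference of the absolute value, which is how it emerges in
  \<open>integral_fejer_cos\<close>.\<close>

lemma
  fixes a :: real
  shows integrable_fejer_scaled: "integrable lborel (\<lambda>t::real. (1 - cos (a * t)) / t\<^sup>2)"
    and integral_fejer_scaled: "(\<integral>t. (1 - cos (a * t)) / t\<^sup>2 \<partial>lborel) = fejer_mass * \<bar>a\<bar>"
proof -
  have *: "(1 - cos (a * t)) / t\<^sup>2 = a\<^sup>2 * ((1 - cos (0 + a * t)) / (0 + a * t)\<^sup>2)" for t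
    by (cases "a = 0") (auto simp: power_mult_distrib)
  show "integrable lborel (\<lambda>t::real. (1 - cos (a * t)) / t\<^sup>2)"
    unfolding * using lborel_integrable_real_affine[OF integrable_fejer, of a 0]
    by (cases "a = 0") (auto intro!: integrable_mult_right simp del: times_divide_eq_right)
  show "(\<integral>t. (1 - cos (a * t)) / t\<^sup>2 \<partial>lborel) = fejer_mass * \<bar>a\<bar>"
  proof (cases "a = 0")
    case False
    have "(\<integral>t. a\<^sup>2 * ((1 - cos (0 + a * t)) / (0 + a * t)\<^sup>2) \<partial>lborel)
        = a\<^sup>2 * (\<integral>t. (1 - cos (0 + a * t)) / (0 + a * t)\<^sup>2 \<partial>lborel)"
      by (rule integral_mult_right_zero)
    moreover have "fejer_mass = \<bar>a\<bar> * (\<integral>t. (1 - cos (0 + a * t)) / (0 + a * t)\<^sup>2 \<partial>lborel)"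
      using lborel_integral_real_affine[OF False, of "\<lambda>t. (1 - cos t) / t\<^sup>2" 0]
      by (simp add: fejer_mass_def)
    moreover have "a\<^sup>2 = \<bar>a\<bar> * \<bar>a\<bar>" by (simp add: power2_eq_square)
    ultimately show ?thesis unfolding * by (simp only: mult_ac)
  qed simp
qed

lemma integral_odd:
  fixes f :: "real \<Rightarrow> real"
  assumes "\<And>t. f (- t) = - f t"
  shows "(\<integral>t. f t \<partial>lborel) = 0"
  using lborel_integral_real_affine[of "-1" f 0] assms by simp

text \<open>The kernel is defined as the inverse Fourier integral of its own transform, so that no Fourier
  inversion theorem is needed; normalising by \<open>fejer_mass\<close> avoids computing the value \<open>\<pi>\<close> of that integral.\<close>
definition fejer :: "real \<Rightarrow> real \<Rightarrow> real" where
  "fejer r t = (\<integral>u. tent (u / r) * cos (t * u) \<partial>lborel) / (2 * fejer_mass)"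

text \<open>An explicit antiderivative handles the half-line of positive \<open>u\<close>,
  reflection the other. Both halves count the point 0, so the splitting holds only almost
  everywhere.\<close>

lemma integral_tent_cos:
  assumes r: "r > 0" and t: "t \<noteq> 0"
  shows "(\<integral>u. tent (u / r) * cos (t * u) \<partial>lborel) = 2 * (1 - cos (r * t)) / (r * t\<^sup>2)"
proof -
  let ?F = "\<lambda>u. (1 - u / r) * sin (t * u) / t - cos (t * u) / (r * t\<^sup>2)"
  let ?f = "\<lambda>u. (1 - u / r) * cos (t * u)"
  have D: "DERIV ?F u :> ?f u" for u
    using r t by (auto intro!: derivative_eq_intros simp: power2_eq_square field_simps)
  have hb: "has_bochner_integral lborel (\<lambda>u. ?f u * indicator {0..r} u) (?F r - ?F 0)"
    using r D by (intro has_bochner_integral_FTC_Icc_real) auto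
  then have hb': "has_bochner_integral lborel (\<lambda>u. ?f (-u) * indicator {0..r} (-u)) (?F r - ?F 0)"
    using lborel_has_bochner_integral_real_affine_iff[of "-1" "\<lambda>u. ?f u * indicator {0..r} u" "?F r - ?F 0" 0]
    by simp
  have FF: "?F r - ?F 0 = (1 - cos (r * t)) / (r * t\<^sup>2)"
    using r t by (simp add: field_simps)
  have "(\<integral>u. tent (u / r) * cos (t * u) \<partial>lborel)
     = (\<integral>u. ?f u * indicator {0..r} u + ?f (-u) * indicator {0..r} (-u) \<partial>lborel)"
  proof (rule integral_cong_AE)
    have "AE u in lborel. u \<noteq> (0::real)" by (rule AE_lborel_singleton)
    then show "AE u in lborel. tent (u / r) * cos (t * u) = ?f u * indicator {0..r} u + ?f (-u) * indicator {0..r} (-u)"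
    proof eventually_elim
      case (elim u)
      then show ?case using r by (cases "u < 0") (auto simp: tent_def indicator_def max_def field_simps)
    qed
  qed auto
  also have "\<dots> = 2 * ((1 - cos (r * t)) / (r * t\<^sup>2))"
    using hb hb' FF by (subst Bochner_Integration.integral_add)
      (auto simp: has_bochner_integral_iff)
  finally show ?thesis by simp
qed

lemma fejer_eq: "r > 0 \<Longrightarrow> t \<noteq> 0 \<Longrightarrow> fejer r t = (1 - cos (r * t)) / t\<^sup>2 / (r * fejer_mass)"
  using fejer_mass_pos by (simp add: fejer_def integral_tent_cos) (simp add: field_simps)

lemma fejer_scale:
  assumes r: "r > 0" shows "fejer r t = r * fejer 1 (r * t)"
  using lborel_integral_real_affine[of r "\<lambda>u. tent (u / r) * cos (t * u)" 0] r
  by (simp add: fejer_def mult_ac)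

lemma fejer_nonneg:
  assumes r: "r > 0" shows "0 \<le> fejer r t"
proof (cases "t = 0")
  case True
  then show ?thesis using fejer_mass_pos by (simp add: fejer_def tent_nonneg)
next
  case False
  then show ?thesis using r fejer_mass_pos by (simp add: fejer_eq)
qed

lemma fejer_measurable[measurable]: "fejer r \<in> borel_measurable borel"
  unfolding fejer_def by measurable

lemma AE_fejer_eq: "r > 0 \<Longrightarrow> AE t in lborel. fejer r t = (1 - cos (r * t)) / t\<^sup>2 / (r * fejer_mass)"
  using AE_lborel_singleton[of "0::real"] by eventually_elim (simp add: fejer_eq)

lemma integrable_fejer_kernel: "r > 0 \<Longrightarrow> integrable lborel (fejer r)"
  using AE_fejer_eq[of r] integrable_fejer_scaled[of r]
  by (subst integrable_cong_AE[where g="\<lambda>t. (1 - cos (r * t)) / t\<^sup>2 / (r * fejer_mass)"])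
     (auto intro!: integrable_divide simp del: divide_divide_eq_left)

text \<open>The addition formulas turn \<open>(1 - cos (r * t)) * cos (t * x)\<close> into a
  combination of three functions \<open>1 - cos (a * t)\<close>. Integrated against the inverse
  square of \<open>t\<close> they leave \<open>\<bar>r + x\<bar> / 2 + \<bar>r - x\<bar> / 2 -
  \<bar>x\<bar>\<close>, which is \<open>r * tent (x / r)\<close>.\<close>

lemma integral_fejer_cos:
  assumes r: "r > 0"
  shows "(\<integral>t. fejer r t * cos (t * x) \<partial>lborel) = tent (x / r)"
proof -
  let ?h = "\<lambda>a t::real. (1 - cos (a * t)) / t\<^sup>2"
  have "(\<integral>t. fejer r t * cos (t * x) \<partial>lborel)
     = (\<integral>t. (?h (r + x) t / 2 + ?h (r - x) t / 2 - ?h x t) / (r * fejer_mass) \<partial>lborel)"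
  proof (rule integral_cong_AE)
    show "AE t in lborel. fejer r t * cos (t * x) = (?h (r + x) t / 2 + ?h (r - x) t / 2 - ?h x t) / (r * fejer_mass)"
      using AE_fejer_eq[OF r]
    proof eventually_elim
      case (elim t)
      have "cos ((r + x) * t) + cos ((r - x) * t) = 2 * (cos (r * t) * cos (t * x))"
        unfolding distrib_right left_diff_distrib cos_add cos_diff by (simp add: mult.commute)
      moreover have "(1 - cos (r * t)) * cos (t * x) = cos (x * t) - cos (r * t) * cos (t * x)"
        by (simp add: algebra_simps)
      ultimately have "(1 - cos (r * t)) * cos (t * x) = (1 - cos ((r + x) * t)) / 2 + (1 - cos ((r - x) * t)) / 2 - (1 - cos (x * t))"
        by argo
      then have "(1 - cos (r * t)) * cos (t * x) / t\<^sup>2 = ?h (r + x) t / 2 + ?h (r - x) t / 2 - ?h x t"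
        by (simp add: add_divide_distrib diff_divide_distrib)
      then show ?case unfolding elim by (simp add: divide_simps mult_ac)
    qed
  qed auto
  also have "\<dots> = (\<bar>r + x\<bar> / 2 + \<bar>r - x\<bar> / 2 - \<bar>x\<bar>) / r"
  proof -
    have i: "integrable lborel (\<lambda>t. ?h a t / 2)" for a
      using integrable_fejer_scaled[of a] by (intro integrable_divide)
    have "(\<integral>t. (?h (r + x) t / 2 + ?h (r - x) t / 2 - ?h x t) / (r * fejer_mass) \<partial>lborel)
      = (\<integral>t. ?h (r + x) t / 2 + ?h (r - x) t / 2 - ?h x t \<partial>lborel) / (r * fejer_mass)"
      by (rule integral_divide_zero)
    also have "(\<integral>t. ?h (r + x) t / 2 + ?h (r - x) t / 2 - ?h x t \<partial>lborel)
      = (\<integral>t. ?h (r + x) t / 2 \<partial>lborel) + (\<integral>t. ?h (r - x) t / 2 \<partial>lborel) - (\<integral>t. ?h x t \<partial>lborel)"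
      by (simp only: i integrable_fejer_scaled Bochner_Integration.integral_add
          Bochner_Integration.integral_diff Bochner_Integration.integrable_add)
    also have "\<dots> = fejer_mass * (\<bar>r + x\<bar> / 2 + \<bar>r - x\<bar> / 2 - \<bar>x\<bar>)"
      by (simp only: integral_divide_zero integral_fejer_scaled) (simp add: algebra_simps)
    finally show ?thesis using fejer_mass_pos by simp
  qed
  also have "\<dots> = tent (x / r)"
    using r by (auto simp: tent_def max_def field_simps abs_if)
  finally show ?thesis .
qed

text \<open>The sine part of the exponential is odd against an even function and integrates to
  zero.\<close>

lemma integrable_of_real_cis:
  fixes f :: "real \<Rightarrow> real"
  assumes f: "integrable lborel f" and e: "\<And>t. f (- t) = f t"
  shows "integrable lborel (\<lambda>t. complex_of_real (f t) * exp (\<i> * complex_of_real (t * x)))"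
    and "(\<integral>t. complex_of_real (f t) * exp (\<i> * complex_of_real (t * x)) \<partial>lborel)
      = complex_of_real (\<integral>t. f t * cos (t * x) \<partial>lborel)"
proof -
  have [measurable]: "f \<in> borel_measurable borel" using f by auto
  have ic: "integrable lborel (\<lambda>t. f t * cos (t * x))" and isn: "integrable lborel (\<lambda>t. f t * sin (t * x))"
    by (rule Bochner_Integration.integrable_bound[OF f]; auto simp: abs_mult mult_left_le)+
  have eq: "complex_of_real (f t) * exp (\<i> * complex_of_real (t * x)) =
     complex_of_real (f t * cos (t * x)) + \<i> * complex_of_real (f t * sin (t * x))" for t
    by (simp add: exp_Euler cos_of_real sin_of_real algebra_simps flip: of_real_mult)
  have "integrable lborel (\<lambda>t. complex_of_real (f t * cos (t * x)))"
    "integrable lborel (\<lambda>t. \<i> * complex_of_real (f t * sin (t * x)))"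
    using ic isn by (auto intro!: integrable_mult_right integrable_of_real simp del: of_real_mult)
  note i = this
  show "integrable lborel (\<lambda>t. complex_of_real (f t) * exp (\<i> * complex_of_real (t * x)))"
    unfolding eq by (rule Bochner_Integration.integrable_add[OF i])
  have "(\<integral>t. f t * sin (t * x) \<partial>lborel) = 0" using e by (intro integral_odd) simp
  then show "(\<integral>t. complex_of_real (f t) * exp (\<i> * complex_of_real (t * x)) \<partial>lborel)
      = complex_of_real (\<integral>t. f t * cos (t * x) \<partial>lborel)"
    unfolding eq by (subst Bochner_Integration.integral_add[OF i]) (simp del: of_real_mult)
qed

lemma fejer_even: "fejer r (- t) = fejer r t" by (simp add: fejer_def)

section \<open>Product kernels on R^d\<close>

text \<open>Lebesgue measure on \<open>real^'d\<close> is the image of a product measure indexed by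
  \<open>Basis\<close>, whose elements are the vectors \<open>axis l 1\<close>. The auxiliary
  \<open>ix\<close> recovers the coordinate from the basis vector, so that products over
  \<open>Basis\<close> become products over coordinates.\<close>

lemma
  fixes f :: "'d::finite \<Rightarrow> real \<Rightarrow> complex"
  assumes f: "\<And>l. integrable lborel (f l)"
  shows integrable_lborel_prod: "integrable lborel (\<lambda>x::real^'d. \<Prod>l\<in>UNIV. f l (x $ l))"
    and integral_lborel_prod: "(\<integral>x. (\<Prod>l\<in>UNIV. f l (x $ l)) \<partial>(lborel :: (real^'d) measure)) = (\<Prod>l\<in>UNIV. integral\<^sup>L lborel (f l))"
proof -
  interpret product_sigma_finite "\<lambda>_::real^'d. lborel :: real measure" ..
  define ix where "ix b = (SOME l. b = axis l (1::real))" for b :: "real^'d"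
  have ix: "ix (axis l 1) = l" for l :: 'd
    unfolding ix_def by (rule some_equality) (auto simp: axis_eq_axis)
  have B: "(Basis :: (real^'d) set) = (\<lambda>l. axis l 1) ` UNIV" by (auto simp: Basis_vec_def)
  have inj: "inj (\<lambda>l::'d. axis l (1::real))" by (auto simp: inj_on_def axis_eq_axis)
  have re: "(\<Prod>b\<in>Basis. h b) = (\<Prod>l\<in>UNIV. h (axis l 1))" for h :: "real^'d \<Rightarrow> complex"
    unfolding B by (subst prod.reindex[OF inj]) simp
  let ?P = "\<Pi>\<^sub>M b\<in>Basis. (lborel :: real measure)"
  let ?S = "\<lambda>g. \<Sum>b\<in>Basis. g b *\<^sub>R b :: real^'d"
  let ?F = "\<lambda>x::real^'d. \<Prod>l\<in>UNIV. f l (x $ l)"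
  have [measurable]: "f l \<in> borel_measurable borel" for l using f[of l] by auto
  have nth: "?S g $ l = g (axis l 1)" for g l
    unfolding B by (subst sum.reindex[OF inj]) (simp add: axis_def if_distrib cong: if_cong)
  have M: "?S \<in> ?P \<rightarrow>\<^sub>M borel" by measurable
  have F: "?F \<in> borel_measurable borel" by measurable
  have comp: "?F (?S g) = (\<Prod>b\<in>Basis. f (ix b) (g b))" for g
    unfolding re nth ix ..
  have "integrable ?P (\<lambda>g. \<Prod>b\<in>Basis. f (ix b) (g b))"
    using f by (intro product_integrable_prod) auto
  then show "integrable lborel ?F"
    unfolding lborel_eq[where 'a="real^'d"] by (subst integrable_distr_eq[OF M F]) (simp only: comp)
  have "(\<integral>x. ?F x \<partial>lborel) = (\<integral>g. (\<Prod>b\<in>Basis. f (ix b) (g b)) \<partial>?P)"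
    unfolding lborel_eq[where 'a="real^'d"] by (subst integral_distr[OF M F]) (simp only: comp)
  also have "\<dots> = (\<Prod>b\<in>Basis. integral\<^sup>L lborel (f (ix b)))"
    using f by (intro product_integral_prod) auto
  also have "\<dots> = (\<Prod>l\<in>UNIV. integral\<^sup>L lborel (f l))" unfolding re ix ..
  finally show "(\<integral>x. ?F x \<partial>lborel) = (\<Prod>l\<in>UNIV. integral\<^sup>L lborel (f l))" .
qed

text \<open>Modulated product of Fejer kernels: \<open>c\<close> is the centre and \<open>r\<close>
  the half-width of the cube carrying the transform, which is a product of tents.\<close>

definition ker :: "real \<Rightarrow> real^'d \<Rightarrow> real^'d \<Rightarrow> complex" where
  "ker r c t = (\<Prod>l\<in>UNIV. complex_of_real (fejer r (t $ l)) * exp (\<i> * complex_of_real (t $ l * c $ l)))"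

lemma integrable_ker: "r > 0 \<Longrightarrow> integrable lborel (ker r c)"
  unfolding ker_def[abs_def]
  by (intro integrable_lborel_prod integrable_of_real_cis integrable_fejer_kernel fejer_even)

lemma ker_measurable[measurable]: "ker r c \<in> borel_measurable borel"
  unfolding ker_def[abs_def] by measurable

lemma exp_inner: "exp (c * complex_of_real (t \<bullet> \<xi>)) = (\<Prod>l\<in>UNIV. exp (c * complex_of_real (t $ l * \<xi> $ l)))"
  for t \<xi> :: "real^'d"
  unfolding inner_vec_def by (simp add: exp_sum sum_distrib_left)

lemma fourier_ker:
  fixes c \<xi> :: "real^'d"
  assumes r: "r > 0"
  shows "fourier (ker r c) \<xi> = complex_of_real (\<Prod>l\<in>UNIV. tent ((\<xi> $ l - c $ l) / r))"
proof -
  have "complex_of_real (fejer r (t $ l)) * exp (\<i> * complex_of_real (t $ l * c $ l)) * exp (- \<i> * complex_of_real (t $ l * \<xi> $ l))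
    = complex_of_real (fejer r (t $ l)) * exp (\<i> * complex_of_real (t $ l * (c $ l - \<xi> $ l)))" for t :: "real^'d" and l
    by (simp add: mult.assoc flip: exp_add) (simp add: algebra_simps)
  then have "ker r c t * exp (- \<i> * complex_of_real (t \<bullet> \<xi>)) =
     (\<Prod>l\<in>UNIV. complex_of_real (fejer r (t $ l)) * exp (\<i> * complex_of_real (t $ l * (c $ l - \<xi> $ l))))" for t
    unfolding ker_def exp_inner prod.distrib[symmetric] by (intro prod.cong) auto
  then have "fourier (ker r c) \<xi> = (\<integral>t. (\<Prod>l\<in>UNIV. complex_of_real (fejer r (t $ l)) * exp (\<i> * complex_of_real (t $ l * (c $ l - \<xi> $ l)))) \<partial>lborel)"
    unfolding fourier_def by (simp only:)
  also have "\<dots> = (\<Prod>l\<in>UNIV. complex_of_real (tent ((c $ l - \<xi> $ l) / r)))"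
    using r by (subst integral_lborel_prod)
      (simp_all only: integrable_of_real_cis[OF integrable_fejer_kernel fejer_even] integral_fejer_cos)
  also have "\<dots> = complex_of_real (\<Prod>l\<in>UNIV. tent ((\<xi> $ l - c $ l) / r))"
    unfolding of_real_prod by (intro prod.cong refl) (simp add: tent_def abs_minus_commute)
  finally show ?thesis .
qed

lemma fourier_ker_0:
  assumes r: "r > 0" and l: "r \<le> \<bar>\<xi> $ l - c $ l\<bar>"
  shows "fourier (ker r c) \<xi> = 0"
proof -
  have "tent ((\<xi> $ l - c $ l) / r) = 0" using r l by (intro tent_eq_0) simp
  then have "(\<Prod>l\<in>UNIV. tent ((\<xi> $ l - c $ l) / r)) = 0" by (intro prod_zero) auto
  then show ?thesis unfolding fourier_ker[OF r] by (simp only: of_real_0)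
qed

lemma ker_shift: "ker r (c + \<gamma>) t = exp (\<i> * complex_of_real (t \<bullet> \<gamma>)) * ker r c t"
  unfolding ker_def exp_inner prod.distrib[symmetric]
  by (intro prod.cong refl) (simp add: algebra_simps exp_add)

lemma ker_scale:
  fixes t :: "real^'d"
  assumes r: "r > 0"
  shows "ker r (r *\<^sub>R c) t = complex_of_real r ^ CARD('d) * ker 1 c (r *\<^sub>R t)"
  unfolding ker_def using r
  by (simp add: fejer_scale[OF r] prod.distrib mult_ac)

lemma norm_ker:
  assumes r: "r > 0"
  shows "norm (ker r 0 t) = (\<Prod>l\<in>UNIV. fejer r (t $ l))"
  unfolding ker_def using fejer_nonneg[OF r] by (simp add: prod_norm[symmetric] norm_mult)

lemma ker_0_eq_norm:
  assumes r: "r > 0" shows "ker r 0 t = complex_of_real (norm (ker r 0 t))"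
  unfolding norm_ker[OF r] by (simp add: ker_def)

lemma integral_ker_0:
  assumes r: "r > 0" shows "(\<integral>t. ker r 0 t \<partial>lborel) = 1"
  using fourier_ker[OF r, of 0 0] by (simp add: fourier_def tent_0)

lemma L1norm_ker_0:
  assumes r: "r > 0" shows "L1norm (ker r 0 :: real^'d \<Rightarrow> complex) = 1"
proof -
  have "complex_of_real (L1norm (ker r 0 :: real^'d \<Rightarrow> complex)) = (\<integral>t. ker r 0 t \<partial>(lborel :: (real^'d) measure))"
    unfolding L1norm_def by (subst (2) ker_0_eq_norm[OF r]) simp
  then show ?thesis unfolding integral_ker_0[OF r] by (simp only: of_real_eq_1_iff)
qed

section \<open>Approximate identities\<close>

text \<open>A substitution moves the dilation from the kernel onto \<open>w\<close>, and dominated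
  convergence applies. The weight is kept abstract because it is used both for translation errors in
  L^1 and for \<open>norm (T (- s) x - x)\<close> in a module.\<close>

lemma approx_identity:
  fixes w :: "real^'d \<Rightarrow> real"
  assumes w: "w \<in> borel_measurable borel" "\<And>s. \<bar>w s\<bar> \<le> C"
    and lim: "\<And>X. X \<longlonglongrightarrow> 0 \<Longrightarrow> (\<lambda>n. w (X n)) \<longlonglongrightarrow> 0"
  shows "(\<lambda>n. \<integral>s. norm (ker (real (Suc n)) 0 s) * w s \<partial>lborel) \<longlonglongrightarrow> 0"
proof -
  have [measurable]: "w \<in> borel_measurable borel" by fact
  have eq: "(\<integral>s. norm (ker r 0 s) * w s \<partial>lborel) = (\<integral>s. norm (ker 1 0 s) * w (inverse r *\<^sub>R s) \<partial>lborel)"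
    if r: "r > 0" for r
  proof -
    have k: "norm (ker r 0 s) = r ^ CARD('d) * norm (ker 1 0 (r *\<^sub>R s))" for s :: "real^'d"
      using ker_scale[OF r, of 0 s] r by (simp add: norm_mult norm_power)
    have "(\<integral>s. norm (ker 1 0 s) * w (inverse r *\<^sub>R s) \<partial>lborel)
        = r ^ CARD('d) * (\<integral>s. norm (ker 1 0 (r *\<^sub>R s)) * w (inverse r *\<^sub>R (r *\<^sub>R s)) \<partial>lborel)"
      using integral_lborel_affine[of "\<lambda>s. norm (ker 1 0 s) * w (inverse r *\<^sub>R s)" r 0] r by simp
    also have "\<dots> = (\<integral>s. norm (ker r 0 s) * w s \<partial>lborel)"
      unfolding k using r by (simp add: mult.assoc)
    finally show ?thesis ..
  qed
  have "(\<lambda>n. \<integral>s. norm (ker 1 0 s) * w (inverse (real (Suc n)) *\<^sub>R s) \<partial>lborel) \<longlonglongrightarrow> (\<integral>s. 0 \<partial>(lborel :: (real^'d) measure))"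
  proof (rule integral_dominated_convergence[where w="\<lambda>s. norm (ker 1 0 s) * C"])
    show "AE s in lborel. (\<lambda>n. norm (ker 1 0 s) * w (inverse (real (Suc n)) *\<^sub>R s)) \<longlonglongrightarrow> 0"
    proof (rule AE_I2)
      fix s :: "real^'d"
      have "(\<lambda>n. inverse (real (Suc n)) *\<^sub>R s) \<longlonglongrightarrow> 0"
        using tendsto_scaleR[OF LIMSEQ_inverse_real_of_nat tendsto_const[of s]] by simp
      from lim[OF this] show "(\<lambda>n. norm (ker 1 0 s) * w (inverse (real (Suc n)) *\<^sub>R s)) \<longlonglongrightarrow> 0"
        by (rule tendsto_mult_right_zero)
    qed
  qed (use w(2) integrable_ker[of 1 "0::real^'d"] in \<open>auto simp: abs_mult intro!: mult_left_mono\<close>)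
  then show ?thesis by (subst eq) auto
qed

text \<open>\<open>ker r 0\<close> is itself a Fourier integral, so convolving with it only sees the transform of \<open>f\<close>.\<close>
lemma conv_ker_eq_0:
  fixes f :: "real^'d \<Rightarrow> complex"
  assumes f: "integrable lborel f" and 0: "\<And>\<xi>. fourier f \<xi> = 0" and r: "r > 0"
  shows "conv f (ker r 0) = (\<lambda>_. 0)"
proof
  fix t
  define u where "u \<xi> = (\<Prod>l\<in>UNIV. complex_of_real (tent (\<xi> $ l / r) / (2 * fejer_mass)))" for \<xi> :: "real^'d"
  have iu: "integrable lborel u"
    unfolding u_def[abs_def] using integrable_tent[OF r] by (intro integrable_lborel_prod) auto
  have [measurable]: "f \<in> borel_measurable borel" "u \<in> borel_measurable borel" using f iu by auto
  have k: "ker r 0 s = (\<integral>\<xi>. u \<xi> * exp (\<i> * complex_of_real (s \<bullet> \<xi>)) \<partial>lborel)" for s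
  proof -
    have 1: "integrable lborel (\<lambda>u. tent (u / r) / (2 * fejer_mass))" using integrable_tent[OF r] by simp
    have 2: "tent (- u / r) / (2 * fejer_mass) = tent (u / r) / (2 * fejer_mass)" for u
      by (simp add: tent_def)
    have "(\<integral>\<xi>. u \<xi> * exp (\<i> * complex_of_real (s \<bullet> \<xi>)) \<partial>lborel)
      = (\<integral>\<xi>. (\<Prod>l\<in>UNIV. complex_of_real (tent (\<xi> $ l / r) / (2 * fejer_mass)) * exp (\<i> * complex_of_real (\<xi> $ l * s $ l))) \<partial>lborel)"
      unfolding u_def exp_inner prod.distrib[symmetric] by (simp only: mult.commute)
    also have "\<dots> = (\<Prod>l\<in>UNIV. complex_of_real (\<integral>x. tent (x / r) / (2 * fejer_mass) * cos (x * s $ l) \<partial>lborel))"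
      by (subst integral_lborel_prod)
        (simp_all only: integrable_of_real_cis[OF 1 2])
    also have "\<dots> = (\<Prod>l\<in>UNIV. complex_of_real (fejer r (s $ l)))"
      unfolding fejer_def by (simp add: mult.commute)
    finally show ?thesis by (simp add: ker_def)
  qed
  have i: "integrable (lborel \<Otimes>\<^sub>M lborel) (\<lambda>(s,\<xi>). f s * (u \<xi> * exp (\<i> * complex_of_real ((t - s) \<bullet> \<xi>))))"
  proof (rule Bochner_Integration.integrable_bound)
    show "integrable (lborel \<Otimes>\<^sub>M lborel) (\<lambda>(s,\<xi>). f s * u \<xi>)"
      using integrable_shear[OF f iu, of "\<lambda>_. 0"] by simp
  qed (auto simp: norm_mult)
  have "conv f (ker r 0) t = (\<integral>s. (\<integral>\<xi>. f s * (u \<xi> * exp (\<i> * complex_of_real ((t - s) \<bullet> \<xi>))) \<partial>lborel) \<partial>lborel)"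
    unfolding conv_def k by simp
  also have "\<dots> = (\<integral>\<xi>. (\<integral>s. f s * (u \<xi> * exp (\<i> * complex_of_real ((t - s) \<bullet> \<xi>))) \<partial>lborel) \<partial>lborel)"
    using lborel_pair.Fubini_integral[OF i] by simp
  also have "\<dots> = (\<integral>\<xi>. u \<xi> * exp (\<i> * complex_of_real (t \<bullet> \<xi>)) * fourier f \<xi> \<partial>lborel)"
  proof (intro Bochner_Integration.integral_cong refl)
    fix \<xi>
    have "f s * (u \<xi> * exp (\<i> * complex_of_real ((t - s) \<bullet> \<xi>)))
        = u \<xi> * exp (\<i> * complex_of_real (t \<bullet> \<xi>)) * (f s * exp (- \<i> * complex_of_real (s \<bullet> \<xi>)))" for s
      by (simp add: inner_diff_left algebra_simps flip: exp_add)
    then show "(\<integral>s. f s * (u \<xi> * exp (\<i> * complex_of_real ((t - s) \<bullet> \<xi>))) \<partial>lborel) = u \<xi> * exp (\<i> * complex_of_real (t \<bullet> \<xi>)) * fourier f \<xi>"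
      unfolding fourier_def by (simp only: integral_mult_right_zero)
  qed
  finally show "conv f (ker r 0) t = 0" by (simp add: 0)
qed

text \<open>The L^1 error of changing the shift inside a convolution is at most a weighted average
  of translation errors. Taking \<open>p = 0\<close> and \<open>w = 1\<close> compares
  \<open>conv k g\<close> with a multiple of \<open>g\<close> itself, a simple function
  \<open>p\<close> compares it with a finite sum of translates, and \<open>p = 0\<close> with a
  character \<open>w\<close> brings in a value of the transform of \<open>k\<close>. The last
  identity holds only almost everywhere because the two sections are integrable only for almost
  every \<open>t\<close>.\<close>

lemma
  fixes k g :: "real^'d \<Rightarrow> complex"
  assumes k: "integrable lborel k" and g: "integrable lborel g"
    and p: "p \<in> borel_measurable borel" and w: "w \<in> borel_measurable borel" "\<And>s. norm (w s) \<le> 1"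
  shows integrable_shear_diff: "integrable lborel (\<lambda>t. \<integral>s. k s * (g (t - s) - w s * g (t - p s)) \<partial>lborel)"
    and L1norm_shear_diff_le: "L1norm (\<lambda>t. \<integral>s. k s * (g (t - s) - w s * g (t - p s)) \<partial>lborel) \<le>
      (\<integral>s. norm (k s) * L1norm (\<lambda>t. g (t - s) - w s * g (t - p s)) \<partial>lborel)"
    and integral_shear_diff: "AE t in lborel. (\<integral>s. k s * (g (t - s) - w s * g (t - p s)) \<partial>lborel) =
      conv k g t - (\<integral>s. k s * w s * g (t - p s) \<partial>lborel)"
    and measurable_shear_diff: "(\<lambda>s. L1norm (\<lambda>t. g (t - s) - w s * g (t - p s))) \<in> borel_measurable borel"
proof -
  have [measurable]: "k \<in> borel_measurable borel" "g \<in> borel_measurable borel" "p \<in> borel_measurable borel"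
    "w \<in> borel_measurable borel" using k g p w by auto
  have kw: "integrable lborel (\<lambda>s. k s * w s)"
    using w(2) by (intro Bochner_Integration.integrable_bound[OF k]) (auto simp: norm_mult mult_left_le)
  have i1: "integrable (lborel \<Otimes>\<^sub>M lborel) (\<lambda>(s,t). k s * g (t - s))"
    using integrable_shear[OF k g, of "\<lambda>s. s"] by simp
  have i2: "integrable (lborel \<Otimes>\<^sub>M lborel) (\<lambda>(s,t). k s * w s * g (t - p s))"
    using integrable_shear[OF kw g p] by simp
  have i: "integrable (lborel \<Otimes>\<^sub>M lborel) (\<lambda>(s,t). k s * (g (t - s) - w s * g (t - p s)))"
    using Bochner_Integration.integrable_diff[OF i1 i2] by (simp add: case_prod_unfold algebra_simps)
  show "integrable lborel (\<lambda>t. \<integral>s. k s * (g (t - s) - w s * g (t - p s)) \<partial>lborel)"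
    by (rule integrable_Minkowski[OF i])
  show "L1norm (\<lambda>t. \<integral>s. k s * (g (t - s) - w s * g (t - p s)) \<partial>lborel) \<le>
      (\<integral>s. norm (k s) * L1norm (\<lambda>t. g (t - s) - w s * g (t - p s)) \<partial>lborel)"
    using L1norm_integral_le[OF i] by (simp add: L1norm_def norm_mult)
  show "(\<lambda>s. L1norm (\<lambda>t. g (t - s) - w s * g (t - p s))) \<in> borel_measurable borel"
    unfolding L1norm_def by measurable
  have "AE t in lborel. integrable lborel (\<lambda>s. k s * g (t - s))"
    using lborel_pair.AE_integrable_snd[OF i1] by simp
  moreover have "AE t in lborel. integrable lborel (\<lambda>s. k s * w s * g (t - p s))"
    using lborel_pair.AE_integrable_snd[OF i2] by simp
  ultimately show "AE t in lborel. (\<integral>s. k s * (g (t - s) - w s * g (t - p s)) \<partial>lborel) =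
      conv k g t - (\<integral>s. k s * w s * g (t - p s) \<partial>lborel)"
    by eventually_elim (simp add: conv_def right_diff_distrib mult.assoc)
qed

lemma L1norm_cong_AE:
  "f \<in> borel_measurable borel \<Longrightarrow> g \<in> borel_measurable borel \<Longrightarrow> AE t in lborel. f t = g t \<Longrightarrow> L1norm f = L1norm g"
  unfolding L1norm_def by (rule integral_cong_AE) auto

lemma tendsto_conv_ker:
  fixes f :: "real^'d \<Rightarrow> complex"
  assumes f: "integrable lborel f"
  shows "(\<lambda>n. L1norm (\<lambda>t. conv f (ker (real (Suc n)) 0) t - f t)) \<longlonglongrightarrow> 0"
proof (rule tendsto_sandwich[OF _ _ tendsto_const])
  let ?w = "\<lambda>s. L1norm (\<lambda>t. f (t - s) - 1 * f (t - 0))"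
  have [measurable]: "f \<in> borel_measurable borel" using f by auto
  show "(\<lambda>n. \<integral>s. norm (ker (real (Suc n)) 0 s) * ?w s \<partial>lborel) \<longlonglongrightarrow> 0"
  proof (rule approx_identity)
    show "?w \<in> borel_measurable borel"
      by (rule measurable_shear_diff[OF f f, of "\<lambda>_. 0" "\<lambda>_. 1"]) auto
    show "\<bar>?w s\<bar> \<le> L1norm f + L1norm f" for s
      using L1norm_diff_le[OF integrable_lborel_shift_minus[OF f] f, of s] L1norm_shift[of f s] L1norm_nonneg[of "\<lambda>t. f (t - s) - f t"]
      by simp
    show "(\<lambda>n. ?w (X n)) \<longlonglongrightarrow> 0" if "X \<longlonglongrightarrow> 0" for X
      using tendsto_L1norm_shift[OF f that] by simp
  qed
  show "\<forall>\<^sub>F n in sequentially. L1norm (\<lambda>t. conv f (ker (real (Suc n)) 0) t - f t)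
      \<le> (\<integral>s. norm (ker (real (Suc n)) 0 s) * ?w s \<partial>lborel)"
  proof (intro always_eventually allI)
    fix n
    define k where "k = (ker (real (Suc n)) 0 :: real^'d \<Rightarrow> complex)"
    have k: "integrable lborel k" "(\<integral>s. k s \<partial>lborel) = 1"
      unfolding k_def by (auto intro: integrable_ker integral_ker_0)
    have [measurable]: "k \<in> borel_measurable borel" using k by auto
    have "AE t in lborel. (\<integral>s. k s * (f (t - s) - 1 * f (t - 0)) \<partial>lborel) = conv k f t - f t"
      using integral_shear_diff[OF k(1) f, of "\<lambda>_. 0" "\<lambda>_. 1"] k(2) by simp
    moreover have "conv f k = conv k f" by (rule conv_commute) auto
    ultimately have "L1norm (\<lambda>t. conv f k t - f t) = L1norm (\<lambda>t. \<integral>s. k s * (f (t - s) - 1 * f (t - 0)) \<partial>lborel)"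
      using integrable_shear_diff[OF k(1) f, of "\<lambda>_. 0" "\<lambda>_. 1"] integrable_conv[OF k(1) f] f
      by (intro L1norm_cong_AE) (auto elim!: AE_mp)
    also have "\<dots> \<le> (\<integral>s. norm (k s) * ?w s \<partial>lborel)"
      by (rule L1norm_shear_diff_le[OF k(1) f]) auto
    finally show "L1norm (\<lambda>t. conv f (ker (real (Suc n)) 0) t - f t)
      \<le> (\<integral>s. norm (ker (real (Suc n)) 0 s) * ?w s \<partial>lborel)" unfolding k_def .
  qed
qed (simp add: L1norm_nonneg)

section \<open>Lattice sums of kernels: cutoffs and the linear multiplier\<close>

definition lattice :: "nat \<Rightarrow> ('d::finite \<Rightarrow> int) set" where
  "lattice N = PiE UNIV (\<lambda>_. {- int N..int N})"

definition lvec :: "('d::finite \<Rightarrow> int) \<Rightarrow> real^'d" where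
  "lvec j = (\<chi> l. of_int (j l))"

lemma finite_lattice: "finite (lattice N)"
  unfolding lattice_def by (rule finite_PiE) auto

lemma sum_lattice_prod: "(\<Sum>j\<in>lattice N. \<Prod>l\<in>UNIV. f l (j l)) = (\<Prod>l\<in>UNIV. \<Sum>n\<in>{- int N..int N}. f l n)"
  for f :: "'d::finite \<Rightarrow> int \<Rightarrow> real"
  unfolding lattice_def by (rule prod_sum_PiE[symmetric]) auto

lemma sum_lattice_tent:
  fixes v :: "real^'d"
  assumes "\<And>l. \<bar>v $ l\<bar> \<le> real N"
  shows "(\<Sum>j\<in>lattice N. \<Prod>l\<in>UNIV. tent (v $ l - j l)) = 1"
  using sum_lattice_prod[where N=N and f="\<lambda>l n. tent (v $ l - n)"] sum_tent_1[OF assms] by simp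

text \<open>The weight sits in coordinate \<open>i\<close> alone. Summing coordinatewise, that
  factor reproduces \<open>v $ i\<close> and every other factor is one.\<close>

lemma sum_lattice_tent_coord:
  fixes v :: "real^'d"
  assumes "\<And>l. \<bar>v $ l\<bar> \<le> real N"
  shows "(\<Sum>j\<in>lattice N. j i * (\<Prod>l\<in>UNIV. tent (v $ l - j l))) = v $ i"
proof -
  let ?f = "\<lambda>l n. (if l = i then real_of_int n else 1) * tent (v $ l - n)"
  have "(\<Prod>l\<in>UNIV. ?f l (j l)) = j i * (\<Prod>l\<in>UNIV. tent (v $ l - j l))" for j
    by (simp add: prod.distrib)
  moreover have "(\<Prod>l\<in>UNIV. \<Sum>n\<in>{- int N..int N}. ?f l n) = (\<Prod>l\<in>UNIV. if l = i then v $ i else 1)"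
    using sum_tent_1[OF assms] sum_tent_id[OF assms] by (intro prod.cong) auto
  ultimately show ?thesis using sum_lattice_prod[where N=N and f="?f"] by simp
qed

text \<open>Sums of modulated kernels over the lattice interpolate: their transform is piecewise multilinear.\<close>
definition plateau :: "nat \<Rightarrow> real \<Rightarrow> real^'d \<Rightarrow> real^'d \<Rightarrow> complex" where
  "plateau N r \<gamma> t = (\<Sum>j\<in>lattice N. ker r (r *\<^sub>R lvec j + \<gamma>) t)"

text \<open>A kernel for the multiplier \<alpha> \<bullet> \<xi>: sampling this linear function at
  the lattice points and interpolating is exact on the cube of half-side \<open>N\<close>. On
  band-limited elements it acts, up to a factor \<i>, as differentiation along \<alpha>.\<close>

definition lin_ker :: "real^'d \<Rightarrow> nat \<Rightarrow> real^'d \<Rightarrow> complex" where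
  "lin_ker \<alpha> N t = (\<Sum>j\<in>lattice N. complex_of_real (\<alpha> \<bullet> lvec j) * ker 1 (lvec j) t)"

lemma integrable_plateau: "r > 0 \<Longrightarrow> integrable lborel (plateau N r \<gamma>)"
  unfolding plateau_def[abs_def] by (intro Bochner_Integration.integrable_sum integrable_ker)

lemma integrable_lin_ker: "integrable lborel (lin_ker \<alpha> N)"
  unfolding lin_ker_def[abs_def] by (intro Bochner_Integration.integrable_sum integrable_mult_right integrable_ker) simp

lemma fourier_plateau:
  assumes r: "r > 0"
  shows "fourier (plateau N r \<gamma>) \<xi> = complex_of_real (\<Sum>j\<in>lattice N. \<Prod>l\<in>UNIV. tent ((\<xi> $ l - \<gamma> $ l) / r - j l))"
proof -
  have "(\<xi> $ l - (r *\<^sub>R lvec j + \<gamma>) $ l) / r = (\<xi> $ l - \<gamma> $ l) / r - j l" for j l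
    using r by (simp add: lvec_def field_simps)
  then show ?thesis
    unfolding plateau_def[abs_def] using r
    by (subst fourier_sum) (auto intro: integrable_ker simp: fourier_ker)
qed

lemma fourier_plateau_1:
  assumes r: "r > 0" and "\<And>l. \<bar>\<xi> $ l - \<gamma> $ l\<bar> \<le> r * real N"
  shows "fourier (plateau N r \<gamma>) \<xi> = 1"
proof -
  have "\<bar>(inverse r *\<^sub>R (\<xi> - \<gamma>)) $ l\<bar> \<le> real N" for l
    using assms(2)[of l] r by (simp add: abs_mult field_simps)
  from sum_lattice_tent[OF this] show ?thesis
    unfolding fourier_plateau[OF r] by (simp add: divide_inverse mult.commute)
qed

lemma fourier_plateau_0:
  assumes r: "r > 0" and l: "r * (real N + 1) \<le> \<bar>\<xi> $ l - \<gamma> $ l\<bar>"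
  shows "fourier (plateau N r \<gamma>) \<xi> = 0"
proof -
  have "(\<Prod>l\<in>UNIV. tent ((\<xi> $ l - \<gamma> $ l) / r - j l)) = 0" if j: "j \<in> lattice N" for j
  proof -
    have "real N + 1 \<le> \<bar>(\<xi> $ l - \<gamma> $ l) / r\<bar>" using l r by (simp add: field_simps)
    moreover have "\<bar>real_of_int (j l)\<bar> \<le> real N" using j by (auto simp: lattice_def PiE_def Pi_def abs_le_iff) (smt (verit, best) of_int_le_iff of_int_minus of_int_of_nat_eq)+
    ultimately have "tent ((\<xi> $ l - \<gamma> $ l) / r - j l) = 0" by (intro tent_eq_0) linarith
    then show ?thesis by (intro prod_zero) auto
  qed
  then have "(\<Sum>j\<in>lattice N. \<Prod>l\<in>UNIV. tent ((\<xi> $ l - \<gamma> $ l) / r - j l)) = 0" by (intro sum.neutral) blast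
  then show ?thesis unfolding fourier_plateau[OF r] by (simp only: of_real_0)
qed

lemma fourier_lin_ker:
  assumes "\<And>l. \<bar>\<xi> $ l\<bar> \<le> real N"
  shows "fourier (lin_ker \<alpha> N) \<xi> = complex_of_real (\<alpha> \<bullet> \<xi>)"
proof -
  have "fourier (lin_ker \<alpha> N) \<xi> = complex_of_real (\<Sum>j\<in>lattice N. (\<alpha> \<bullet> lvec j) * (\<Prod>l\<in>UNIV. tent (\<xi> $ l - j l)))"
    unfolding lin_ker_def[abs_def]
    by (subst fourier_sum) (auto intro!: integrable_ker simp: fourier_cmult fourier_ker lvec_def)
  also have "(\<Sum>j\<in>lattice N. (\<alpha> \<bullet> lvec j) * (\<Prod>l\<in>UNIV. tent (\<xi> $ l - j l)))
     = (\<Sum>j\<in>lattice N. \<Sum>i\<in>UNIV. \<alpha> $ i * (j i * (\<Prod>l\<in>UNIV. tent (\<xi> $ l - j l))))"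
    by (simp add: inner_vec_def lvec_def sum_distrib_right mult.assoc)
  also have "\<dots> = (\<Sum>i\<in>UNIV. \<alpha> $ i * (\<Sum>j\<in>lattice N. j i * (\<Prod>l\<in>UNIV. tent (\<xi> $ l - j l))))"
    by (subst sum.swap) (simp add: sum_distrib_left)
  also have "\<dots> = \<alpha> \<bullet> \<xi>"
    using sum_lattice_tent_coord[OF assms] by (simp add: inner_vec_def)
  finally show ?thesis .
qed

text \<open>Dilation and modulation preserve the L^1 norm, so cutoffs to ever smaller cubes around
  \<gamma> do not grow in norm. The local theorem of Wiener rests on this.\<close>

lemma plateau_scale:
  fixes t :: "real^'d"
  assumes r: "r > 0"
  shows "plateau N r \<gamma> t = exp (\<i> * complex_of_real (t \<bullet> \<gamma>)) * complex_of_real r ^ CARD('d) * plateau N 1 0 (r *\<^sub>R t)"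
  unfolding plateau_def ker_shift by (simp add: sum_distrib_left ker_scale[OF r] mult.assoc)

section \<open>Banach modules over \<open>L\<^sup>1\<close>\<close>

lemma tendsto_norm_diff_bound:
  fixes X :: "'b \<Rightarrow> 'a::real_normed_vector"
  assumes "\<And>n. norm (X n - x) \<le> a n" "(a \<longlongrightarrow> 0) F"
  shows "(X \<longlongrightarrow> x) F"
  by (rule LIM_zero_cancel, rule Lim_null_comparison[OF always_eventually assms(2)]) (use assms(1) in auto)

lemma scaleC_zero_left: "(0::complex) *\<^sub>C x = (0::'a::complex_normed_vector)"
  using scaleC_of_real[of 0 x] by simp

lemma scaleC_zero_right: "c *\<^sub>C (0::'a::complex_normed_vector) = 0"
  using norm_scaleC[of c "0::'a"] by simp

lemma scaleC_minus_right: "c *\<^sub>C (- x) = - (c *\<^sub>C (x::'a::complex_normed_vector))"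
  using scaleC_add_right[of c x "-x"] by (simp add: scaleC_zero_right eq_neg_iff_add_eq_0 add.commute)

lemma scaleC_minus_left: "(- c) *\<^sub>C x = - (c *\<^sub>C (x::'a::complex_normed_vector))"
  using scaleC_add_left[of c "-c" x] by (simp add: scaleC_zero_left eq_neg_iff_add_eq_0 add.commute)

lemma scaleC_diff_right: "c *\<^sub>C (x - y) = c *\<^sub>C x - c *\<^sub>C (y::'a::complex_normed_vector)"
  using scaleC_add_right[of c x "-y"] by (simp add: scaleC_minus_right)

lemma scaleC_sum_left: "(\<Sum>j\<in>J. c j) *\<^sub>C x = (\<Sum>j\<in>J. c j *\<^sub>C (x::'a::complex_normed_vector))"
  by (induction J rule: infinite_finite_induct) (simp_all add: scaleC_zero_left scaleC_add_left)

text \<open>The weights are integrals of \<open>k\<close> over the level sets of \<open>F\<close>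
  and do not depend on \<phi>, so one finite combination of translates can be used for all arguments
  at once.\<close>

lemma integral_simple_comp:
  fixes k :: "'a \<Rightarrow> 'b::{real_normed_field,banach,second_countable_topology}"
  assumes k: "integrable M k" and F: "simple_function M F"
  shows "(\<integral>s. k s * \<phi> (F s) \<partial>M) = (\<Sum>j\<in>F ` space M. (\<integral>s. k s * indicator (F -` {j} \<inter> space M) s \<partial>M) * \<phi> j)"
    and "integrable M (\<lambda>s. k s * \<phi> (F s))"
proof -
  have fin: "finite (F ` space M)" using F by (rule simple_functionD)
  have m: "F -` {j} \<inter> space M \<in> sets M" for j using F by (rule simple_functionD)
  have i: "integrable M (\<lambda>s. k s * indicator (F -` {j} \<inter> space M) s)" for j
    using integrable_mult_indicator[OF m[of j] k]
    by (rule Bochner_Integration.integrable_cong[THEN iffD1, rotated 2]) (auto simp: indicator_def)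
  have eq: "k s * \<phi> (F s) = (\<Sum>j\<in>F ` space M. k s * indicator (F -` {j} \<inter> space M) s * \<phi> j)" if "s \<in> space M" for s
  proof -
    have "(\<Sum>j\<in>F ` space M. k s * indicator (F -` {j} \<inter> space M) s * \<phi> j) = (\<Sum>j\<in>F ` space M. if j = F s then k s * \<phi> (F s) else 0)"
      using that by (intro sum.cong refl) (auto simp: indicator_def)
    then show ?thesis using fin that by simp
  qed
  have "(\<integral>s. k s * \<phi> (F s) \<partial>M) = (\<integral>s. (\<Sum>j\<in>F ` space M. k s * indicator (F -` {j} \<inter> space M) s * \<phi> j) \<partial>M)"
    using eq by (intro Bochner_Integration.integral_cong) auto
  also have "\<dots> = (\<Sum>j\<in>F ` space M. (\<integral>s. k s * indicator (F -` {j} \<inter> space M) s \<partial>M) * \<phi> j)"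
    using i by (subst Bochner_Integration.integral_sum) auto
  finally show "(\<integral>s. k s * \<phi> (F s) \<partial>M) = (\<Sum>j\<in>F ` space M. (\<integral>s. k s * indicator (F -` {j} \<inter> space M) s \<partial>M) * \<phi> j)" .
  show "integrable M (\<lambda>s. k s * \<phi> (F s))"
    using i eq by (subst Bochner_Integration.integrable_cong[OF refl eq]) auto
qed

section \<open>The action and its dependence on the transform\<close>

text \<open>The axioms of \<open>L1_module\<close> on a Banach space type, so that limits and
  completeness come from the type class. Continuity of orbits is not an axiom; it is imposed on
  single elements as continuity of \<open>\<lambda>s. T s x\<close>.\<close>

locale l1_banach_module =
  fixes T :: "real^'d \<Rightarrow> 'm::{complex_normed_vector,banach} \<Rightarrow> 'm"
    and act :: "(real^'d \<Rightarrow> complex) \<Rightarrow> 'm \<Rightarrow> 'm"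
  assumes T_add: "T t (x + y) = T t x + T t y"
    and T_scaleC: "T t (c *\<^sub>C x) = c *\<^sub>C T t x"
    and norm_T: "norm (T t x) = norm x"
    and T_zero: "T 0 x = x"
    and T_plus: "T (s + t) x = T s (T t x)"
    and act_add: "integrable lborel f \<Longrightarrow> integrable lborel g \<Longrightarrow> act (\<lambda>s. f s + g s) x = act f x + act g x"
    and act_cmult: "integrable lborel f \<Longrightarrow> act (\<lambda>s. c * f s) x = c *\<^sub>C act f x"
    and act_add_right: "integrable lborel f \<Longrightarrow> act f (x + y) = act f x + act f y"
    and act_scaleC: "integrable lborel f \<Longrightarrow> act f (c *\<^sub>C x) = c *\<^sub>C act f x"
    and act_conv: "integrable lborel f \<Longrightarrow> integrable lborel g \<Longrightarrow> act (conv f g) x = act f (act g x)"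
    and norm_act_le: "integrable lborel f \<Longrightarrow> norm (act f x) \<le> L1norm f * norm x"
    and T_act: "integrable lborel f \<Longrightarrow> T t (act f x) = act (\<lambda>s. f (s + t)) x"
    and T_act_comm: "integrable lborel f \<Longrightarrow> T t (act f x) = act f (T t x)"
    and nondegenerate: "(\<And>f. integrable lborel f \<Longrightarrow> act f x = 0) \<Longrightarrow> x = 0"
begin

lemma linear_act: "integrable lborel f \<Longrightarrow> linear (act f)"
  by (rule linearI) (simp_all add: act_add_right act_scaleC flip: scaleC_of_real)

lemma bounded_linear_act: "integrable lborel f \<Longrightarrow> bounded_linear (act f)"
  by (rule bounded_linear_intro[where K="L1norm f"])
     (simp_all add: act_add_right act_scaleC norm_act_le mult.commute flip: scaleC_of_real)

lemma act_diff_right: "integrable lborel f \<Longrightarrow> act f (x - y) = act f x - act f y"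
  by (rule linear_diff[OF linear_act])

lemma act_zero_right: "integrable lborel f \<Longrightarrow> act f 0 = 0"
  by (rule linear_0[OF linear_act])

lemma linear_T: "linear (T t)"
  by (rule linearI) (simp_all add: T_add T_scaleC flip: scaleC_of_real)

lemma T_diff: "T t (x - y) = T t x - T t y"
  by (rule linear_diff[OF linear_T])

lemma act_diff:
  assumes f: "integrable lborel f" and g: "integrable lborel g"
  shows "act (\<lambda>s. f s - g s) x = act f x - act g x"
proof -
  have "act (\<lambda>s. f s - g s) x + act g x = act (\<lambda>s. (f s - g s) + g s) x"
    using f g by (intro act_add[symmetric]) auto
  then show ?thesis by (simp add: algebra_simps)
qed

lemma act_zero: "act (\<lambda>_. 0) x = 0"
  using act_add[of "\<lambda>_. 0" "\<lambda>_. 0" x] by simp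

lemma act_sum:
  assumes "finite J" "\<And>j. j \<in> J \<Longrightarrow> integrable lborel (f j)"
  shows "act (\<lambda>s. \<Sum>j\<in>J. f j s) x = (\<Sum>j\<in>J. act (f j) x)"
  using assms
proof (induction J rule: finite_induct)
  case (insert i J)
  then have "act (\<lambda>s. f i s + (\<Sum>j\<in>J. f j s)) x = act (f i) x + act (\<lambda>s. \<Sum>j\<in>J. f j s) x"
    by (intro act_add) auto
  with insert show ?case by simp
qed (simp add: act_zero)

lemma norm_act_diff_le:
  assumes "integrable lborel f" "integrable lborel g"
  shows "norm (act f x - act g x) \<le> L1norm (\<lambda>t. f t - g t) * norm x"
  using assms norm_act_le[of "\<lambda>t. f t - g t" x] by (simp add: act_diff)

lemma tendsto_act:
  "integrable lborel f \<Longrightarrow> (X \<longlongrightarrow> x) F \<Longrightarrow> ((\<lambda>n. act f (X n)) \<longlongrightarrow> act f x) F"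
  by (rule bounded_linear.tendsto[OF bounded_linear_act])

lemma tendsto_act_conv_ker:
  assumes f: "integrable lborel f"
  shows "(\<lambda>n. act (conv f (ker (real (Suc n)) 0)) x) \<longlonglongrightarrow> act f x"
proof (rule tendsto_norm_diff_bound)
  show "norm (act (conv f (ker (real (Suc n)) 0)) x - act f x)
      \<le> L1norm (\<lambda>t. conv f (ker (real (Suc n)) 0) t - f t) * norm x" for n
    using f by (intro norm_act_diff_le integrable_conv integrable_ker) auto
  show "(\<lambda>n. L1norm (\<lambda>t. conv f (ker (real (Suc n)) 0) t - f t) * norm x) \<longlonglongrightarrow> 0"
    using tendsto_mult_left_zero[OF tendsto_conv_ker[OF f]] .
qed

text \<open>Injectivity of the Fourier transform, seen through the action: \<open>f\<close> is the
  L^1 limit of its convolutions with \<open>ker (Suc n) 0\<close>, and all of these vanish. From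
  here on a kernel may be replaced by any other with the same transform.\<close>

lemma act_eq_0_if_fourier_eq_0:
  assumes f: "integrable lborel f" and "\<And>\<xi>. fourier f \<xi> = 0"
  shows "act f x = 0"
proof -
  have "conv f (ker (real (Suc n)) 0) = (\<lambda>_. 0)" for n
    using assms by (intro conv_ker_eq_0) auto
  then show ?thesis
    using tendsto_act_conv_ker[OF f, of x] by (simp add: act_zero LIMSEQ_const_iff)
qed

lemma act_cong_fourier:
  assumes f: "integrable lborel f" and g: "integrable lborel g" and "\<And>\<xi>. fourier f \<xi> = fourier g \<xi>"
  shows "act f x = act g x"
  using act_eq_0_if_fourier_eq_0[of "\<lambda>t. f t - g t" x] assms by (simp add: fourier_diff act_diff)

lemma act_commute:
  assumes "integrable lborel f" "integrable lborel g"
  shows "act f (act g x) = act g (act f x)"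
  using act_cong_fourier[of "conv f g" "conv g f" x] assms
  by (simp add: integrable_conv fourier_conv act_conv mult.commute)

lemma eq_if_act_eq: "(\<And>f. integrable lborel f \<Longrightarrow> act f x = act f y) \<Longrightarrow> x = y"
  using nondegenerate[of "x - y"] by (simp add: act_diff_right)

lemma act_cong_AE:
  assumes "integrable lborel f" "integrable lborel g" "AE t in lborel. f t = g t"
  shows "act f x = act g x"
proof -
  have "L1norm (\<lambda>t. f t - g t) = L1norm (\<lambda>t::real^'d. 0 :: complex)"
    using assms by (intro L1norm_cong_AE) auto
  then show ?thesis using norm_act_diff_le[OF assms(1,2), of x] by (simp add: L1norm_def)
qed

lemma act_shift: "integrable lborel g \<Longrightarrow> act (\<lambda>t. g (t - s)) x = act g (T (- s) x)"
  using T_act[of g "-s" x] T_act_comm[of g "-s" x] by simp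

text \<open>This replaces the formula \<open>f x = \<integral> f(t) T(-t) x dt\<close>: the integral is compared with its sums over a
  simple function approximating the identity, so no integration in the module is needed.\<close>
lemma norm_act_conv_diff_le:
  assumes k: "integrable lborel k" "(\<integral>s. k s \<partial>lborel) = 1" and g: "integrable lborel g"
    and x: "continuous_on UNIV (\<lambda>s. T s x)"
  shows "norm (act (conv k g) x - act g x) \<le> L1norm g * (\<integral>s. norm (k s) * norm (T (- s) x - x) \<partial>lborel)"
proof -
  have [measurable]: "k \<in> borel_measurable borel" "g \<in> borel_measurable borel" using k g by auto
  define W where "W s = norm (T (- s) x - x)" for s
  have Wc: "continuous_on UNIV W"
    unfolding W_def by (intro continuous_intros continuous_on_compose2[OF x]) auto
  have Wm[measurable]: "W \<in> borel_measurable borel" using Wc by (rule borel_measurable_continuous_onI)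
  have Wb: "0 \<le> W s" "W s \<le> 2 * norm x" for s
    using norm_triangle_ineq4[of "T (-s) x" x] by (auto simp: W_def norm_T)
  have "(\<lambda>s. s) \<in> borel_measurable (borel :: (real^'d) measure)" by simp
  from borel_measurable_implies_sequence_metric[OF this, of 0]
  obtain F :: "nat \<Rightarrow> real^'d \<Rightarrow> real^'d" where F: "\<And>i. simple_function borel (F i)" "\<And>s. (\<lambda>i. F i s) \<longlonglongrightarrow> s"
    by auto
  have Fm[measurable]: "F i \<in> borel_measurable borel" for i
    using F(1) by (rule borel_measurable_simple_function)
  have F': "simple_function lborel (F i)" for i
    using F(1)[of i] by (simp cong: simple_function_cong_algebra)
  \<comment> \<open>\<open>a\<close> is the cost of replacing \<open>s\<close> by
    \<open>F i s\<close> inside the convolution, \<open>b\<close> the resulting sum; it converges to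
    the integral in the claim.\<close>
  define a where "a i = (\<integral>s. norm (k s) * L1norm (\<lambda>t. g (t - s) - 1 * g (t - F i s)) \<partial>lborel)" for i
  define b where "b i = (\<integral>s. norm (k s) * W (F i s) \<partial>lborel)" for i
  have am: "(\<lambda>s. L1norm (\<lambda>t. g (t - s) - 1 * g (t - F i s))) \<in> borel_measurable borel" for i
    by (rule measurable_shear_diff[OF k(1) g]) auto
  have "a \<longlonglongrightarrow> (\<integral>s. 0 \<partial>(lborel :: (real^'d) measure))"
    unfolding a_def
  proof (rule integral_dominated_convergence[where w="\<lambda>s. norm (k s) * (L1norm g + L1norm g)"])
    have le: "L1norm (\<lambda>t. g (t - s) - 1 * g (t - F i s)) \<le> L1norm g + L1norm g" for s i
      using L1norm_diff_le[OF integrable_lborel_shift_minus[OF g] integrable_lborel_shift_minus[OF g], of s "F i s"]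
      by (simp add: L1norm_shift)
    show "AE s in lborel. norm (norm (k s) * L1norm (\<lambda>t. g (t - s) - 1 * g (t - F i s))) \<le> norm (k s) * (L1norm g + L1norm g)" for i
      using le by (intro AE_I2) (auto simp: abs_mult L1norm_nonneg intro!: mult_left_mono)
    have "(\<lambda>i. L1norm (\<lambda>t. g (t - s) - 1 * g (t - F i s))) \<longlonglongrightarrow> 0" for s
    proof -
      have "(\<lambda>i. F i s - s) \<longlonglongrightarrow> 0" using tendsto_diff[OF F(2)[of s] tendsto_const[of s]] by simp
      from tendsto_L1norm_shift[OF g this] have "(\<lambda>i. L1norm (\<lambda>t. g (t - (F i s - s)) - g t)) \<longlonglongrightarrow> 0" .
      moreover have "L1norm (\<lambda>t. g (t - (F i s - s)) - g t) = L1norm (\<lambda>t. g (t - s) - 1 * g (t - F i s))" for i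
        using L1norm_shift[of "\<lambda>t. g (t - (F i s - s)) - g t" s]
        by (simp add: L1norm_def norm_minus_commute)
      ultimately show ?thesis by simp
    qed
    then show "AE s in lborel. (\<lambda>i. norm (k s) * L1norm (\<lambda>t. g (t - s) - 1 * g (t - F i s))) \<longlonglongrightarrow> 0"
      by (intro AE_I2 tendsto_mult_right_zero)
  qed (use k am in auto)
  then have a: "a \<longlonglongrightarrow> 0" by simp
  have b: "b \<longlonglongrightarrow> (\<integral>s. norm (k s) * W s \<partial>lborel)"
    unfolding b_def
  proof (rule integral_dominated_convergence[where w="\<lambda>s. norm (k s) * (2 * norm x)"])
    show "AE s in lborel. (\<lambda>i. norm (k s) * W (F i s)) \<longlonglongrightarrow> norm (k s) * W s"
      using F(2) Wc by (intro AE_I2 tendsto_mult_left continuous_on_tendsto_compose[OF Wc]) auto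
    show "AE s in lborel. norm (norm (k s) * W (F i s)) \<le> norm (k s) * (2 * norm x)" for i
      using Wb by (intro AE_I2) (auto simp: abs_mult intro!: mult_left_mono)
  qed (use k in auto)
  have main: "norm (act (conv k g) x - act g x) \<le> a i * norm x + L1norm g * b i" for i
  proof -
    define c where "c j = (\<integral>s. k s * indicator (F i -` {j}) s \<partial>lborel)" for j
    define R where "R = range (F i)"
    have fin: "finite R" unfolding R_def using simple_functionD(1)[OF F'[of i]] by simp
    have kc: "(\<integral>s. k s * \<phi> (F i s) \<partial>lborel) = (\<Sum>j\<in>R. c j * \<phi> j)" for \<phi>
      using integral_simple_comp(1)[OF k(1) F'[of i], of \<phi>] by (simp add: c_def R_def)
    have c1: "(\<Sum>j\<in>R. c j) = 1" using kc[of "\<lambda>_. 1"] k(2) by simp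
    let ?h = "\<lambda>t. \<integral>s. k s * (g (t - s) - 1 * g (t - F i s)) \<partial>lborel"
    let ?S = "\<lambda>t. \<Sum>j\<in>R. c j * g (t - j)"
    have ih: "integrable lborel ?h" by (rule integrable_shear_diff[OF k(1) g]) auto
    have ig: "integrable lborel (\<lambda>t. g (t - j))" for j using g by (rule integrable_lborel_shift_minus)
    have iS: "integrable lborel ?S"
      by (intro Bochner_Integration.integrable_sum integrable_mult_right integrable_lborel_shift_minus g)
    have "AE t in lborel. ?h t = conv k g t - ?S t"
      using integral_shear_diff[OF k(1) g, of "F i" "\<lambda>_. 1"] kc[of "\<lambda>j. g (_ - j)"] by simp
    then have "act ?h x = act (\<lambda>t. conv k g t - ?S t) x"
      using ih iS integrable_conv[OF k(1) g] by (intro act_cong_AE) auto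
    also have "\<dots> = act (conv k g) x - act ?S x"
      using iS integrable_conv[OF k(1) g] by (rule act_diff[rotated])
    finally have 1: "norm (act (conv k g) x - act ?S x) \<le> a i * norm x"
      using norm_act_le[OF ih, of x] mult_right_mono[OF L1norm_shear_diff_le[OF k(1) g, of "F i" "\<lambda>_. 1"], of "norm x"]
      unfolding a_def by simp
    have "act ?S x = (\<Sum>j\<in>R. c j *\<^sub>C act g (T (- j) x))"
      using fin g by (subst act_sum) (auto intro!: ig sum.cong simp: act_cmult[OF ig] act_shift)
    moreover have "act g x = (\<Sum>j\<in>R. c j *\<^sub>C act g x)"
      unfolding scaleC_sum_left[symmetric] c1 by (simp add: scaleC_one)
    ultimately have "act ?S x - act g x = (\<Sum>j\<in>R. c j *\<^sub>C act g (T (- j) x - x))"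
      by (simp add: act_diff_right[OF g] scaleC_diff_right sum_subtractf)
    also have "norm \<dots> \<le> (\<Sum>j\<in>R. norm (c j) * (L1norm g * W j))"
      unfolding W_def by (intro sum_norm_le) (auto simp: norm_scaleC intro!: mult_left_mono norm_act_le g)
    also have "\<dots> = L1norm g * (\<Sum>j\<in>R. norm (c j) * W j)"
      by (simp add: sum_distrib_left mult_ac)
    also have "(\<Sum>j\<in>R. norm (c j) * W j) \<le> b i"
    proof -
      have nk: "integrable lborel (\<lambda>s. norm (k s))" using k by auto
      have "norm (c j) \<le> (\<integral>s. norm (k s) * indicator (F i -` {j}) s \<partial>lborel)" for j
        unfolding c_def by (rule order_trans[OF integral_norm_bound]) (auto simp: norm_mult indicator_def of_bool_def if_distrib cong: if_cong)
      then have "(\<Sum>j\<in>R. norm (c j) * W j) \<le> (\<Sum>j\<in>R. (\<integral>s. norm (k s) * indicator (F i -` {j}) s \<partial>lborel) * W j)"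
        by (intro sum_mono mult_right_mono Wb)
      also have "\<dots> = b i"
        unfolding b_def using integral_simple_comp(1)[OF nk F'[of i], of W] by (simp add: R_def)
      finally show ?thesis .
    qed
    finally have 2: "norm (act ?S x - act g x) \<le> L1norm g * b i"
      by (simp add: mult_left_mono L1norm_nonneg)
    show ?thesis using 1 2 norm_triangle_ineq[of "act (conv k g) x - act ?S x" "act ?S x - act g x"] by simp
  qed
  have "(\<lambda>i. a i * norm x + L1norm g * b i) \<longlonglongrightarrow> 0 * norm x + L1norm g * (\<integral>s. norm (k s) * W s \<partial>lborel)"
    by (intro tendsto_intros a b)
  then show ?thesis
    unfolding W_def using main by (intro LIMSEQ_le_const) (auto simp: W_def)
qed

text \<open>Convergence cannot be estimated against \<open>x\<close> directly, since
  \<open>norm_act_conv_diff_le\<close> compares \<open>act (conv k g) x\<close> only with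
  \<open>act g x\<close>. With \<open>g = k j\<close> it bounds the difference of two smoothed
  elements after a further smoothing, uniformly in \<open>j\<close>; letting \<open>j\<close> grow
  gives a Cauchy sequence. Its limit is identified with \<open>x\<close> by nondegeneracy.\<close>

lemma tendsto_act_ker:
  assumes x: "continuous_on UNIV (\<lambda>s. T s x)"
  shows "(\<lambda>n. act (ker (real (Suc n)) 0) x) \<longlonglongrightarrow> x"
proof -
  define k where "k n = (ker (real (Suc n)) 0 :: real^'d \<Rightarrow> complex)" for n
  have k: "integrable lborel (k n)" "(\<integral>s. k n s \<partial>lborel) = 1" "L1norm (k n) = 1" for n
    unfolding k_def by (auto intro: integrable_ker integral_ker_0 L1norm_ker_0)
  define e where "e n = (\<integral>s. norm (k n s) * norm (T (- s) x - x) \<partial>lborel)" for n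
  have e: "e \<longlonglongrightarrow> 0"
    unfolding e_def k_def
  proof (rule approx_identity)
    have c: "continuous_on UNIV (\<lambda>s. norm (T (- s) x - x))"
      by (intro continuous_intros continuous_on_compose2[OF x]) auto
    show "(\<lambda>s. norm (T (- s) x - x)) \<in> borel_measurable borel"
      using c by (rule borel_measurable_continuous_onI)
    show "\<bar>norm (T (- s) x - x)\<bar> \<le> 2 * norm x" for s
      using norm_triangle_ineq4[of "T (-s) x" x] by (auto simp: norm_T)
    show "(\<lambda>n. norm (T (- X n) x - x)) \<longlonglongrightarrow> 0" if "X \<longlonglongrightarrow> 0" for X
      using continuous_on_tendsto_compose[OF c that] by (simp add: T_zero)
  qed
  have b: "norm (act (k m) x - act (k n) x) \<le> e m + e n" for m n
  proof (rule LIMSEQ_le_const2)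
    let ?z = "act (k m) x - act (k n) x"
    have z: "act (k j) ?z = (act (conv (k m) (k j)) x - act (k j) x) - (act (conv (k n) (k j)) x - act (k j) x)" for j
      using k by (simp add: act_diff_right act_conv act_commute[of "k j" "k _"])
    have "act (k j) (act (k i) x) = act (conv (k i) (k j)) x" for i j
      using k by (simp add: act_conv act_commute[of "k j"])
    then have "(\<lambda>j. act (k j) (act (k i) x)) \<longlonglongrightarrow> act (k i) x" for i
      using tendsto_act_conv_ker[OF k(1)[of i], of x] by (simp add: k_def)
    then have "(\<lambda>j. act (k j) ?z) \<longlonglongrightarrow> ?z"
      using k by (simp add: act_diff_right tendsto_diff)
    then show "(\<lambda>j. norm (act (k j) ?z)) \<longlonglongrightarrow> norm ?z" by (rule tendsto_norm)
    have le: "norm (act (conv (k m) (k j)) x - act (k j) x) \<le> e m" for m j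
      using norm_act_conv_diff_le[OF k(1,2) k(1)[of j] x] k(3) by (simp add: e_def)
    have "norm (act (k j) ?z) \<le> e m + e n" for j
      unfolding z using norm_triangle_ineq4 le[of m j] le[of n j] by (meson add_mono order_trans)
    then show "\<exists>N. \<forall>j\<ge>N. norm (act (k j) ?z) \<le> e m + e n" by blast
  qed
  have "Cauchy (\<lambda>n. act (k n) x)"
  proof (rule CauchyI)
    fix \<epsilon> :: real assume "\<epsilon> > 0"
    then have "\<forall>\<^sub>F n in sequentially. e n < \<epsilon> / 2" using e by (intro order_tendstoD) auto
    then obtain N where N: "\<And>n. n \<ge> N \<Longrightarrow> e n < \<epsilon> / 2" by (auto simp: eventually_sequentially)
    have "norm (act (k m) x - act (k n) x) < \<epsilon>" if "m \<ge> N" "n \<ge> N" for m n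
      using b[of m n] N[OF that(1)] N[OF that(2)] by linarith
    then show "\<exists>M. \<forall>m\<ge>M. \<forall>n\<ge>M. norm (act (k m) x - act (k n) x) < \<epsilon>" by blast
  qed
  then obtain y where y: "(\<lambda>n. act (k n) x) \<longlonglongrightarrow> y" by (auto simp: Cauchy_convergent_iff convergent_def)
  have "y = x"
  proof (rule eq_if_act_eq)
    fix f :: "real^'d \<Rightarrow> complex" assume f: "integrable lborel f"
    have "(\<lambda>n. act f (act (k n) x)) \<longlonglongrightarrow> act f y" using f y by (rule tendsto_act)
    moreover have "(\<lambda>n. act f (act (k n) x)) \<longlonglongrightarrow> act f x"
      using tendsto_act_conv_ker[OF f, of x, folded k_def] by (simp only: act_conv[OF f k(1)])
    ultimately show "act f y = act f x" by (rule LIMSEQ_unique)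
  qed
  then show ?thesis using y by (simp add: k_def)
qed

lemma continuous_on_T_act:
  assumes f: "integrable lborel f"
  shows "continuous_on UNIV (\<lambda>s. T s (act f x))"
  unfolding continuous_on_sequentially o_def
proof (intro allI impI ballI, elim conjE)
  fix X and s :: "real^'d" assume X: "X \<longlonglongrightarrow> s"
  have f': "integrable lborel (\<lambda>t. f (t + s))" for s using f by (rule integrable_lborel_shift)
  have [measurable]: "f \<in> borel_measurable borel" using f by auto
  have "(\<lambda>n. s - X n) \<longlonglongrightarrow> 0" using tendsto_diff[OF tendsto_const[of s] X] by simp
  from tendsto_L1norm_shift[OF f' this, of s]
  have "(\<lambda>n. L1norm (\<lambda>t. f (t + X n) - f (t + s))) \<longlonglongrightarrow> 0" by simp
  then have "(\<lambda>n. L1norm (\<lambda>t. f (t + X n) - f (t + s)) * norm x) \<longlonglongrightarrow> 0"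
    by (rule tendsto_mult_left_zero)
  from tendsto_norm_diff_bound[OF norm_act_diff_le[OF f' f'] this]
  show "(\<lambda>n. T (X n) (act f x)) \<longlonglongrightarrow> T s (act f x)" unfolding T_act[OF f] .
qed

section \<open>The Beurling spectrum and the local theorem of Wiener\<close>

definition spec :: "'m \<Rightarrow> (real^'d) set" where
  "spec x = {\<gamma>. \<forall>f. integrable lborel f \<longrightarrow> act f x = 0 \<longrightarrow> fourier f \<gamma> = 0}"

text \<open>At a point \<gamma> outside the cube, a tent centred at \<gamma> and narrow enough to
  miss the cube belongs to a kernel that annihilates \<open>act k x\<close> but whose transform is
  one at \<gamma>.\<close>

lemma spec_act_subset:
  assumes k: "integrable lborel k" and supp: "\<And>\<xi>. \<exists>l. \<bar>\<xi> $ l\<bar> > r \<Longrightarrow> fourier k \<xi> = 0"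
  shows "spec (act k x) \<subseteq> {\<xi>. \<forall>l. \<bar>\<xi> $ l\<bar> \<le> r}"
proof (rule ccontr)
  assume "\<not> ?thesis"
  then obtain \<gamma> l where g: "\<gamma> \<in> spec (act k x)" and l: "\<bar>\<gamma> $ l\<bar> > r" using not_le_imp_less by blast
  define \<rho> where "\<rho> = \<bar>\<gamma> $ l\<bar> - r"
  have \<rho>: "\<rho> > 0" using l by (simp add: \<rho>_def)
  have "fourier (conv (ker \<rho> \<gamma>) k) \<xi> = 0" for \<xi>
  proof (cases "\<bar>\<xi> $ l\<bar> > r")
    case False
    then have "fourier (ker \<rho> \<gamma>) \<xi> = 0" using \<rho> by (intro fourier_ker_0[where l=l]) (auto simp: \<rho>_def)
    then show ?thesis using k \<rho> by (simp add: fourier_conv integrable_ker)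
  qed (use k \<rho> supp in \<open>auto simp: fourier_conv integrable_ker\<close>)
  then have "act (ker \<rho> \<gamma>) (act k x) = 0"
    using act_eq_0_if_fourier_eq_0[of "conv (ker \<rho> \<gamma>) k" x] k \<rho> by (simp add: integrable_conv integrable_ker act_conv)
  then have "fourier (ker \<rho> \<gamma>) \<gamma> = 0" using g \<rho> by (simp add: spec_def integrable_ker)
  then show False using \<rho> by (simp add: fourier_ker tent_0)
qed

lemma closed_spec: "closed (spec x)"
proof -
  have "spec x = (\<Inter>f\<in>{f. integrable lborel f \<and> act f x = 0}. {\<gamma>. fourier f \<gamma> = 0})"
    by (auto simp: spec_def)
  moreover have "closed {\<gamma>. fourier f \<gamma> = 0}" if "integrable lborel f" for f
    using continuous_on_fourier[OF that] by (intro closed_Collect_eq) auto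
  ultimately show ?thesis by auto
qed

text \<open>Wiener's local argument: for \<open>m\<close> with transform supported near \<open>\<gamma>\<close>, the element \<open>y = m x\<close> is fixed by
  the plateau kernel \<open>V\<close> and killed by \<open>f\<close>, so \<open>y = (V - f * V) y\<close>, while \<open>V - f * V\<close> has small norm.\<close>
lemma act_eq_0_near:
  assumes f: "integrable lborel f" and fx: "act f x = 0" and fg: "fourier f \<gamma> \<noteq> 0"
  obtains \<epsilon> where "\<epsilon> > 0"
    "\<And>m. integrable lborel m \<Longrightarrow> (\<And>\<xi>. \<exists>l. \<bar>\<xi> $ l - \<gamma> $ l\<bar> > \<epsilon> \<Longrightarrow> fourier m \<xi> = 0) \<Longrightarrow> act m x = 0"
proof -
  define h where "h t = inverse (fourier f \<gamma>) * f t" for t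
  have h: "integrable lborel h" unfolding h_def using f by simp
  have hx: "act h x = 0" unfolding h_def using f fx by (simp add: act_cmult scaleC_zero_right)
  have hg: "fourier h \<gamma> = 1" unfolding h_def using fg by (simp add: fourier_cmult)
  have [measurable]: "h \<in> borel_measurable borel" using h by auto
  define v where "v = (plateau 1 1 0 :: real^'d \<Rightarrow> complex)"
  have v: "integrable lborel v" unfolding v_def by (rule integrable_plateau) simp
  have [measurable]: "v \<in> borel_measurable borel" using v by auto
  \<comment> \<open>With this character the integral of \<open>h s * w s\<close> is the transform of
    \<open>h\<close> at \<gamma>, which has been normalised to one.\<close>
  define w where "w s = exp (- \<i> * complex_of_real (s \<bullet> \<gamma>))" for s
  have [measurable]: "w \<in> borel_measurable borel" unfolding w_def by measurable
  have wn: "norm (w s) = 1" for s by (simp add: w_def)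
  define r where "r n = inverse (real (Suc n))" for n
  have r: "r n > 0" for n by (simp add: r_def)
  define V where "V n = plateau 1 (r n) \<gamma>" for n
  have V: "integrable lborel (V n)" for n unfolding V_def using r by (rule integrable_plateau)
  \<comment> \<open>\<open>V n\<close> is a modulated dilate of the fixed cutoff \<open>v\<close>.
    Undoing both turns a shift by \<open>s\<close> into one by \<open>r n *\<^sub>R s\<close>, which
    shrinks; hence convolution with \<open>h\<close> is almost the identity on
    \<open>V n\<close>.\<close>
  have L: "L1norm (\<lambda>t. V n (t - s) - w s * V n (t - 0)) = L1norm (\<lambda>t. v (t - r n *\<^sub>R s) - v t)" for n s
  proof -
    have e: "exp (\<i> * complex_of_real ((t - s) \<bullet> \<gamma>)) = w s * exp (\<i> * complex_of_real (t \<bullet> \<gamma>))" for t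
      unfolding w_def by (simp add: inner_diff_left algebra_simps flip: exp_add)
    have "V n (t - s) - w s * V n (t - 0) =
        w s * exp (\<i> * complex_of_real (t \<bullet> \<gamma>)) * complex_of_real (r n) ^ CARD('d) *
        (v (r n *\<^sub>R t - r n *\<^sub>R s) - v (r n *\<^sub>R t))" for t
      unfolding V_def plateau_scale[OF r] e v_def by (simp add: algebra_simps)
    then have n: "norm (V n (t - s) - w s * V n (t - 0)) =
        r n ^ CARD('d) * norm (v (r n *\<^sub>R t - r n *\<^sub>R s) - v (r n *\<^sub>R t))" for t
      using r[of n] wn by (simp add: norm_mult norm_power)
    have "L1norm (\<lambda>t. V n (t - s) - w s * V n (t - 0)) =
        r n ^ CARD('d) * (\<integral>t. norm (v (r n *\<^sub>R t - r n *\<^sub>R s) - v (r n *\<^sub>R t)) \<partial>lborel)"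
      unfolding L1norm_def n by simp
    also have "\<dots> = L1norm (\<lambda>t. v (t - r n *\<^sub>R s) - v t)"
      using integral_lborel_affine[of "\<lambda>t. norm (v (t - r n *\<^sub>R s) - v t)" "r n" 0] r[of n]
      by (simp add: L1norm_def)
    finally show ?thesis .
  qed
  define a where "a n = (\<integral>s. norm (h s) * L1norm (\<lambda>t. V n (t - s) - w s * V n (t - 0)) \<partial>lborel)" for n
  have "a \<longlonglongrightarrow> (\<integral>s. 0 \<partial>(lborel :: (real^'d) measure))"
    unfolding a_def
  proof (rule integral_dominated_convergence[where w="\<lambda>s. norm (h s) * (L1norm v + L1norm v)"])
    have le: "L1norm (\<lambda>t. v (t - s) - v t) \<le> L1norm v + L1norm v" for s
      using L1norm_diff_le[OF integrable_lborel_shift_minus[OF v] v, of s] by (simp add: L1norm_shift)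
    show "AE s in lborel. norm (norm (h s) * L1norm (\<lambda>t. V n (t - s) - w s * V n (t - 0))) \<le> norm (h s) * (L1norm v + L1norm v)" for n
      unfolding L using le by (intro AE_I2) (auto simp: abs_mult L1norm_nonneg intro!: mult_left_mono)
    have "(\<lambda>n. L1norm (\<lambda>t. v (t - r n *\<^sub>R s) - v t)) \<longlonglongrightarrow> 0" for s
    proof (rule tendsto_L1norm_shift[OF v])
      show "(\<lambda>n. r n *\<^sub>R s) \<longlonglongrightarrow> 0"
        unfolding r_def using tendsto_scaleR[OF LIMSEQ_inverse_real_of_nat tendsto_const[of s]] by simp
    qed
    then show "AE s in lborel. (\<lambda>n. norm (h s) * L1norm (\<lambda>t. V n (t - s) - w s * V n (t - 0))) \<longlonglongrightarrow> 0"
      unfolding L by (intro AE_I2 tendsto_mult_right_zero)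
    have "(\<lambda>s. L1norm (\<lambda>t. V n (t - s) - w s * V n (t - 0))) \<in> borel_measurable borel" for n
      by (rule measurable_shear_diff[OF h V]) (auto simp: wn)
    then show "(\<lambda>s. norm (h s) * L1norm (\<lambda>t. V n (t - s) - w s * V n (t - 0))) \<in> borel_measurable lborel" for n
      by simp
  qed (use h in auto)
  then have "\<forall>\<^sub>F n in sequentially. a n < 1" by (intro order_tendstoD) auto
  then obtain n where n: "a n < 1" by (auto simp: eventually_sequentially)
  let ?h = "\<lambda>t. \<integral>s. h s * (V n (t - s) - w s * V n (t - 0)) \<partial>lborel"
  have ih: "integrable lborel ?h" by (rule integrable_shear_diff[OF h V]) (auto simp: wn)
  have an: "L1norm ?h \<le> a n" unfolding a_def by (rule L1norm_shear_diff_le[OF h V]) (auto simp: wn)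
  have "(\<integral>s. h s * w s \<partial>lborel) = 1" using hg unfolding fourier_def w_def .
  then have ae: "AE t in lborel. ?h t = conv h (V n) t - V n t"
    using integral_shear_diff[OF h V, of "\<lambda>_. 0" w n] by (simp add: hg wn)
  show ?thesis
  proof (rule that[OF r[of n]])
    fix m assume m: "integrable lborel m" and supp: "\<And>\<xi>. \<exists>l. \<bar>\<xi> $ l - \<gamma> $ l\<bar> > r n \<Longrightarrow> fourier m \<xi> = 0"
    let ?y = "act m x"
    have "fourier (conv (V n) m) \<xi> = fourier m \<xi>" for \<xi>
    proof (cases "\<exists>l. \<bar>\<xi> $ l - \<gamma> $ l\<bar> > r n")
      case False
      then have "fourier (V n) \<xi> = 1" unfolding V_def by (intro fourier_plateau_1 r) (auto simp: not_less)
      then show ?thesis by (simp add: fourier_conv V m)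
    qed (simp add: supp fourier_conv V m)
    then have "act (conv (V n) m) x = ?y" using V m by (intro act_cong_fourier integrable_conv)
    then have y1: "act (V n) ?y = ?y" using V m by (simp add: act_conv)
    have "act h ?y = 0" using act_commute[OF h m, of x] by (simp add: hx act_zero_right m)
    then have "act (conv h (V n)) ?y = 0"
      using act_commute[OF h V, of n ?y] V h by (simp add: act_conv act_zero_right)
    moreover have "act ?h ?y = act (\<lambda>t. conv h (V n) t - V n t) ?y"
      using ae ih h V by (intro act_cong_AE Bochner_Integration.integrable_diff integrable_conv) auto
    ultimately have "act ?h ?y = - ?y" using y1 h V by (simp add: act_diff integrable_conv)
    then have "norm ?y \<le> a n * norm ?y"
      using norm_act_le[OF ih, of ?y] mult_right_mono[OF an, of "norm ?y"] by simp
    then have "(1 - a n) * norm ?y \<le> 0" by (simp add: algebra_simps)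
    then show "?y = 0" using n by (simp add: mult_le_0_iff)
  qed
qed

text \<open>Passage from local to global. Each point of \<open>K\<close> has a neighbourhood on
  which \<open>act_eq_0_near\<close> applies; the lattice tents split \<open>m\<close> into pieces
  so small that the Lebesgue number of this cover puts each of them inside one
  neighbourhood.\<close>

lemma act_eq_0_off_spec:
  assumes m: "integrable lborel m" and K: "compact K" "\<And>\<xi>. \<xi> \<notin> K \<Longrightarrow> fourier m \<xi> = 0" and disj: "K \<inter> spec x = {}"
  shows "act m x = 0"
proof -
  have "\<exists>\<epsilon>>0. \<forall>m. integrable lborel m \<longrightarrow> (\<forall>\<xi>. (\<exists>l. \<bar>\<xi> $ l - \<gamma> $ l\<bar> > \<epsilon>) \<longrightarrow> fourier m \<xi> = 0) \<longrightarrow> act m x = 0"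
    if "\<gamma> \<in> K" for \<gamma>
  proof -
    from that disj obtain f where "integrable lborel f" "act f x = 0" "fourier f \<gamma> \<noteq> 0"
      by (auto simp: spec_def)
    then show ?thesis by (metis act_eq_0_near)
  qed
  then obtain \<epsilon> where \<epsilon>: "\<And>\<gamma>. \<gamma> \<in> K \<Longrightarrow> \<epsilon> \<gamma> > 0"
    "\<And>\<gamma> m. \<gamma> \<in> K \<Longrightarrow> integrable lborel m \<Longrightarrow> (\<And>\<xi>. (\<exists>l. \<bar>\<xi> $ l - \<gamma> $ l\<bar> > \<epsilon> \<gamma>) \<Longrightarrow> fourier m \<xi> = 0) \<Longrightarrow> act m x = 0"
    by metis
  define O' where "O' \<gamma> = {\<xi>. \<forall>l. \<bar>\<xi> $ l - \<gamma> $ l\<bar> < \<epsilon> \<gamma>}" for \<gamma>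
  have opn: "open (O' \<gamma>)" for \<gamma>
    unfolding O'_def Collect_all_eq by (intro open_INT ballI open_Collect_less continuous_intros) auto
  have cov: "K \<subseteq> \<Union>(O' ` K)" using \<epsilon>(1) by (auto simp: O'_def)
  obtain e where e: "e > 0" "\<And>\<xi>. \<xi> \<in> K \<Longrightarrow> \<exists>G\<in>O' ` K. ball \<xi> e \<subseteq> G"
    using Heine_Borel_lemma[OF K(1) cov] opn by auto
  \<comment> \<open>The transform of a piece is supported in a cube of side \<open>2 * r\<close>;
    with this \<open>r\<close> any two interior points of the cube are closer than \<open>e\<close>,
    because the norm is at most the sum of the coordinate differences.\<close>
  define r where "r = e / (2 * real CARD('d))"
  have r: "r > 0" using e(1) by (simp add: r_def)
  obtain R where R: "\<And>\<xi>. \<xi> \<in> K \<Longrightarrow> norm \<xi> \<le> R" using compact_imp_bounded[OF K(1)] by (auto simp: bounded_iff)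
  obtain N :: nat where N: "R / r \<le> real N" using real_arch_simple by blast
  define M where "M j = conv m (ker r (r *\<^sub>R lvec j + 0))" for j
  have M: "integrable lborel (M j)" for j unfolding M_def using m r by (intro integrable_conv integrable_ker)
  have fM: "fourier (M j) \<xi> = fourier m \<xi> * fourier (ker r (r *\<^sub>R lvec j + 0)) \<xi>" for j \<xi>
    unfolding M_def using m r by (intro fourier_conv integrable_ker)
  have "act m x = act (\<lambda>t. \<Sum>j\<in>lattice N. M j t) x"
  proof (rule act_cong_fourier)
    fix \<xi>
    have "fourier (\<lambda>t. \<Sum>j\<in>lattice N. M j t) \<xi> = fourier m \<xi> * (\<Sum>j\<in>lattice N. fourier (ker r (r *\<^sub>R lvec j + 0)) \<xi>)"
      using M by (simp add: fourier_sum fM sum_distrib_left)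
    also have "(\<Sum>j\<in>lattice N. fourier (ker r (r *\<^sub>R lvec j + 0)) \<xi>) = fourier (plateau N r 0) \<xi>"
      unfolding plateau_def[abs_def] using r by (intro fourier_sum[symmetric] integrable_ker)
    also have "fourier m \<xi> * fourier (plateau N r 0) \<xi> = fourier m \<xi>"
    proof (cases "\<xi> \<in> K")
      case True
      have "\<bar>\<xi> $ l\<bar> \<le> r * real N" for l
        using component_le_norm_cart[of \<xi> l] R[OF True] N r by (simp add: field_simps)
      then show ?thesis using r by (subst fourier_plateau_1) auto
    qed (simp add: K)
    finally show "fourier m \<xi> = fourier (\<lambda>t. \<Sum>j\<in>lattice N. M j t) \<xi>" ..
  qed (use m M in auto)
  also have "\<dots> = (\<Sum>j\<in>lattice N. act (M j) x)" using M finite_lattice by (intro act_sum)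
  also have "\<dots> = 0"
  proof (rule sum.neutral, rule ballI)
    fix j :: "'d \<Rightarrow> int"
    have near: "\<bar>\<xi> $ l - r * j l\<bar> < r" if "fourier (M j) \<xi> \<noteq> 0" for \<xi> l
    proof (rule ccontr)
      assume "\<not> ?thesis"
      then have "fourier (ker r (r *\<^sub>R lvec j + 0)) \<xi> = 0"
        using r by (intro fourier_ker_0[where l=l]) (auto simp: lvec_def)
      then show False using that by (simp add: fM)
    qed
    show "act (M j) x = 0"
    proof (cases "\<exists>\<xi>0. fourier (M j) \<xi>0 \<noteq> 0")
      case True
      then obtain \<xi>0 where \<xi>0: "fourier (M j) \<xi>0 \<noteq> 0" ..
      then have "\<xi>0 \<in> K" using K(2) by (auto simp: fM)
      then obtain \<gamma> where \<gamma>: "\<gamma> \<in> K" "ball \<xi>0 e \<subseteq> O' \<gamma>" using e(2) by blast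
      show ?thesis
      proof (rule \<epsilon>(2)[OF \<gamma>(1) M])
        fix \<xi> assume far: "\<exists>l. \<bar>\<xi> $ l - \<gamma> $ l\<bar> > \<epsilon> \<gamma>"
        show "fourier (M j) \<xi> = 0"
        proof (rule ccontr)
          assume \<xi>: "fourier (M j) \<xi> \<noteq> 0"
          have "norm (\<xi>0 - \<xi>) \<le> (\<Sum>l\<in>UNIV. \<bar>(\<xi>0 - \<xi>) $ l\<bar>)" by (rule norm_le_l1_cart)
          also have "\<dots> < (\<Sum>l\<in>(UNIV::'d set). 2 * r)"
          proof (rule sum_strict_mono)
            show "\<bar>(\<xi>0 - \<xi>) $ l\<bar> < 2 * r" for l using near[OF \<xi>0, of l] near[OF \<xi>, of l] by simp
          qed auto
          also have "\<dots> = e" by (simp add: r_def)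
          finally have "\<xi> \<in> O' \<gamma>" using \<gamma>(2) by (auto simp: dist_norm)
          then show False using far by (auto simp: O'_def) (meson less_asym)
        qed
      qed
    qed (use act_eq_0_if_fourier_eq_0[OF M] in blast)
  qed
  finally show ?thesis .
qed

text \<open>The function \<open>1 - fourier \<phi>\<close> vanishes near the spectrum but has no
  compact support, so the previous lemma cannot be applied to it. Testing with
  \<open>conv f (ker (Suc n) 0)\<close> confines it to a cube, and these convolutions tend to
  \<open>f\<close>.\<close>

lemma act_eq_self:
  assumes \<phi>: "integrable lborel \<phi>" and U: "open U" "spec x \<subseteq> U" "\<And>\<xi>. \<xi> \<in> U \<Longrightarrow> fourier \<phi> \<xi> = 1"
  shows "act \<phi> x = x"
proof (rule eq_if_act_eq)
  fix f :: "real^'d \<Rightarrow> complex" assume f: "integrable lborel f"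
  define g where "g n = conv f (ker (real (Suc n)) 0)" for n
  have g: "integrable lborel (g n)" for n unfolding g_def using f by (intro integrable_conv integrable_ker) auto
  have "act (g n) (act \<phi> x) = act (g n) x" for n
  proof -
    \<comment> \<open>Removing the open set \<open>U\<close> keeps the cube compact and makes it
      disjoint from the spectrum.\<close>
    define K where "K = cbox (\<chi> l. - real (Suc n)) (\<chi> l. real (Suc n)) - U"
    have "act (\<lambda>t. g n t - conv (g n) \<phi> t) x = 0"
    proof (rule act_eq_0_off_spec[where K=K])
      show "compact K" unfolding K_def using U(1) by (intro compact_diff) auto
      show "K \<inter> spec x = {}" using U(2) by (auto simp: K_def)
      fix \<xi> assume "\<xi> \<notin> K"
      then consider "\<xi> \<in> U" | "\<xi> \<notin> cbox (\<chi> l. - real (Suc n)) (\<chi> l. real (Suc n))" by (auto simp: K_def)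
      then show "fourier (\<lambda>t. g n t - conv (g n) \<phi> t) \<xi> = 0"
      proof cases
        case 1
        then show ?thesis using U(3) g \<phi> by (simp add: fourier_diff integrable_conv fourier_conv)
      next
        case 2
        then obtain l where "\<not> (- real (Suc n) \<le> \<xi> $ l \<and> \<xi> $ l \<le> real (Suc n))"
          by (auto simp: mem_box_cart)
        then have "fourier (ker (real (Suc n)) 0) \<xi> = 0" by (intro fourier_ker_0[where l=l]) auto
        then have "fourier (g n) \<xi> = 0" unfolding g_def using f by (subst fourier_conv) (auto intro: integrable_ker)
        then show ?thesis using g \<phi> by (simp add: fourier_diff integrable_conv fourier_conv)
      qed
    qed (use g \<phi> integrable_conv in auto)
    then show ?thesis using g \<phi> by (simp add: act_diff integrable_conv act_conv)
  qed
  then have "(\<lambda>n. act (g n) (act \<phi> x)) \<longlonglongrightarrow> act f x"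
    using tendsto_act_conv_ker[OF f, of x] by (simp only: g_def)
  moreover have "(\<lambda>n. act (g n) (act \<phi> x)) \<longlonglongrightarrow> act f (act \<phi> x)"
    using tendsto_act_conv_ker[OF f] by (simp only: g_def)
  ultimately show "act f (act \<phi> x) = act f x" by (rule LIMSEQ_unique[rotated])
qed

end

section \<open>Analytic continuation of band-limited elements\<close>

text \<open>Powers of \<alpha> \<bullet> \<xi> are produced by convolving \<open>k\<close>
  repeatedly with \<open>lin_ker\<close>, whose transform is exact wherever that of \<open>k\<close>
  is nonzero. Submultiplicativity of the L^1 norm reduces convergence to that of a scalar power
  series.\<close>

lemma kernel_power_series:
  fixes k :: "real^'d \<Rightarrow> complex" and a :: "nat \<Rightarrow> complex"
  assumes k: "integrable lborel k" and supp: "\<And>\<xi>. \<exists>l. \<bar>\<xi> $ l\<bar> > real N \<Longrightarrow> fourier k \<xi> = 0"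
    and a: "summable (\<lambda>n. norm (a n) * L1norm (lin_ker \<alpha> N) ^ n)"
  obtains g where "integrable lborel g"
    "\<And>\<xi>. (\<lambda>n. a n * complex_of_real (\<alpha> \<bullet> \<xi>) ^ n * fourier k \<xi>) sums fourier g \<xi>"
    "L1norm g \<le> (\<Sum>n. norm (a n) * L1norm (lin_ker \<alpha> N) ^ n) * L1norm k"
proof -
  let ?d = "lin_ker \<alpha> N"
  define P where "P n = (conv ?d ^^ n) k" for n
  have P: "integrable lborel (P n)" for n
    unfolding P_def by (induction n) (auto simp: k integrable_conv integrable_lin_ker)
  have PL: "L1norm (P n) \<le> L1norm ?d ^ n * L1norm k" for n
  proof (induction n)
    case (Suc n)
    have "L1norm (P (Suc n)) \<le> L1norm ?d * L1norm (P n)"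
      using L1norm_conv_le[OF integrable_lin_ker P[of n]] by (simp add: P_def)
    also have "\<dots> \<le> L1norm ?d * (L1norm ?d ^ n * L1norm k)"
      using Suc by (intro mult_left_mono L1norm_nonneg)
    finally show ?case by (simp add: mult.assoc)
  qed (simp add: P_def)
  have PF: "fourier (P n) \<xi> = complex_of_real (\<alpha> \<bullet> \<xi>) ^ n * fourier k \<xi>" for n \<xi>
  proof -
    have "fourier (P n) \<xi> = fourier ?d \<xi> ^ n * fourier k \<xi>"
      by (induction n) (use P in \<open>auto simp: P_def fourier_conv integrable_lin_ker mult.assoc\<close>)
    then show ?thesis
      using supp[of \<xi>] fourier_lin_ker[where \<xi>=\<xi> and N=N and \<alpha>=\<alpha>] by (cases "\<exists>l. \<bar>\<xi> $ l\<bar> > real N") (auto simp: not_less)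
  qed
  have f: "integrable lborel (\<lambda>t. a n * P n t)" for n using P by simp
  have fL: "L1norm (\<lambda>t. a n * P n t) \<le> norm (a n) * L1norm ?d ^ n * L1norm k" for n
    using mult_left_mono[OF PL[of n], of "norm (a n)"] by (simp add: L1norm_def norm_mult mult.assoc)
  have s2: "summable (\<lambda>n. norm (a n) * L1norm ?d ^ n * L1norm k)" using a by (rule summable_mult2)
  have s1: "summable (\<lambda>n. L1norm (\<lambda>t. a n * P n t))"
    using fL by (intro summable_comparison_test'[OF s2, of 0]) (auto simp: L1norm_nonneg)
  obtain g where g: "integrable lborel g" "\<And>\<xi>. (\<lambda>n. fourier (\<lambda>t. a n * P n t) \<xi>) sums fourier g \<xi>"
      "L1norm g \<le> (\<Sum>n. L1norm (\<lambda>t. a n * P n t))"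
    using L1_series[OF f s1] by blast
  show ?thesis
  proof (rule that[OF g(1)])
    show "(\<lambda>n. a n * complex_of_real (\<alpha> \<bullet> \<xi>) ^ n * fourier k \<xi>) sums fourier g \<xi>" for \<xi>
      using g(2)[of \<xi>] by (simp add: fourier_cmult PF mult.assoc)
    have "(\<Sum>n. L1norm (\<lambda>t. a n * P n t)) \<le> (\<Sum>n. norm (a n) * L1norm ?d ^ n * L1norm k)"
      using fL s1 s2 by (rule suminf_le)
    also have "\<dots> = (\<Sum>n. norm (a n) * L1norm ?d ^ n) * L1norm k" using suminf_mult2[OF a] by simp
    finally show "L1norm g \<le> (\<Sum>n. norm (a n) * L1norm ?d ^ n) * L1norm k" using g(3) by simp
  qed
qed

lemma exp_sums_divide: "(\<lambda>n. x ^ n / fact n) sums exp (x :: 'a::{real_normed_field,banach})"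
  using exp_converges[of x] by (simp add: scaleR_conv_of_real divide_inverse mult.commute)

lemma exp_kernel:
  fixes k :: "real^'d \<Rightarrow> complex"
  assumes k: "integrable lborel k" and supp: "\<And>\<xi>. \<exists>l. \<bar>\<xi> $ l\<bar> > real N \<Longrightarrow> fourier k \<xi> = 0"
  obtains g where "integrable lborel g" "\<And>\<xi>. fourier g \<xi> = exp (c * complex_of_real (\<alpha> \<bullet> \<xi>)) * fourier k \<xi>"
    "L1norm g \<le> exp (norm c * L1norm (lin_ker \<alpha> N)) * L1norm k"
proof -
  let ?D = "L1norm (lin_ker \<alpha> N)"
  have eq: "norm (c ^ n / fact n) * ?D ^ n = (norm c * ?D) ^ n / fact n" for n
    by (simp add: norm_divide norm_power power_mult_distrib)
  have s: "(\<lambda>n. norm (c ^ n / fact n) * ?D ^ n) sums exp (norm c * ?D)"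
    unfolding eq by (rule exp_sums_divide)
  obtain g where g: "integrable lborel g"
    "\<And>\<xi>. (\<lambda>n. c ^ n / fact n * complex_of_real (\<alpha> \<bullet> \<xi>) ^ n * fourier k \<xi>) sums fourier g \<xi>"
    "L1norm g \<le> (\<Sum>n. norm (c ^ n / fact n) * ?D ^ n) * L1norm k"
    using kernel_power_series[OF k supp sums_summable[OF s]] by blast
  have "(\<lambda>n. (c * complex_of_real (\<alpha> \<bullet> \<xi>)) ^ n / fact n * fourier k \<xi>) sums (exp (c * complex_of_real (\<alpha> \<bullet> \<xi>)) * fourier k \<xi>)" for \<xi>
    by (intro sums_mult2 exp_sums_divide)
  then have "fourier g \<xi> = exp (c * complex_of_real (\<alpha> \<bullet> \<xi>)) * fourier k \<xi>" for \<xi>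
    using g(2)[of \<xi>] by (intro sums_unique2[of "\<lambda>n. c ^ n / fact n * complex_of_real (\<alpha> \<bullet> \<xi>) ^ n * fourier k \<xi>"])
      (simp_all add: power_mult_distrib)
  then show ?thesis using that g s by (simp add: sums_iff)
qed

text \<open>Dropping the terms of degree 0, 1 and 2 leaves a factor \<open>norm c ^ 3\<close>
  throughout, as \<open>norm c \<le> 1\<close>. The order three is what the maximum principle below
  tolerates.\<close>

lemma exp_kernel_remainder:
  fixes k :: "real^'d \<Rightarrow> complex"
  assumes k: "integrable lborel k" and supp: "\<And>\<xi>. \<exists>l. \<bar>\<xi> $ l\<bar> > real N \<Longrightarrow> fourier k \<xi> = 0"
    and c: "norm c \<le> 1"
  obtains g where "integrable lborel g"
    "\<And>\<xi>. fourier g \<xi> = (exp (c * complex_of_real (\<alpha> \<bullet> \<xi>)) - 1 - c * complex_of_real (\<alpha> \<bullet> \<xi>)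
        - c\<^sup>2 / 2 * complex_of_real (\<alpha> \<bullet> \<xi>) ^ 2) * fourier k \<xi>"
    "L1norm g \<le> norm c ^ 3 * exp (L1norm (lin_ker \<alpha> N)) * L1norm k"
proof -
  let ?D = "L1norm (lin_ker \<alpha> N)"
  define a where "a n = (if n \<in> {..<3} then 0 else c ^ n / fact n)" for n :: nat
  have le: "norm (a n) * ?D ^ n \<le> norm c ^ 3 * (?D ^ n / fact n)" for n
  proof (cases "n < 3")
    case False
    then have "norm c ^ n \<le> norm c ^ 3" using c by (intro power_decreasing) auto
    then have "norm c ^ n * (?D ^ n / fact n) \<le> norm c ^ 3 * (?D ^ n / fact n)"
      by (rule mult_right_mono) (simp add: L1norm_nonneg)
    then show ?thesis using False by (simp add: a_def norm_divide norm_power)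
  qed (simp add: a_def L1norm_nonneg)
  have s2: "(\<lambda>n. norm c ^ 3 * (?D ^ n / fact n)) sums (norm c ^ 3 * exp ?D)"
    by (intro sums_mult exp_sums_divide)
  have s1: "summable (\<lambda>n. norm (a n) * ?D ^ n)"
    using le by (intro summable_comparison_test'[OF sums_summable[OF s2], of 0]) (auto simp: L1norm_nonneg)
  have b: "(\<Sum>n. norm (a n) * ?D ^ n) \<le> norm c ^ 3 * exp ?D"
    using suminf_le[OF le s1 sums_summable[OF s2]] s2 by (simp add: sums_iff)
  obtain g where g: "integrable lborel g"
    "\<And>\<xi>. (\<lambda>n. a n * complex_of_real (\<alpha> \<bullet> \<xi>) ^ n * fourier k \<xi>) sums fourier g \<xi>"
    "L1norm g \<le> (\<Sum>n. norm (a n) * ?D ^ n) * L1norm k"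
    using kernel_power_series[OF k supp s1] by blast
  show ?thesis
  proof (rule that[OF g(1)])
    fix \<xi>
    define u where "u = complex_of_real (\<alpha> \<bullet> \<xi>)"
    have "(\<lambda>n. (c * u) ^ n / fact n - (if n \<in> {..<3} then (c * u) ^ n / fact n else 0)) sums
        (exp (c * u) - (\<Sum>n<3. (c * u) ^ n / fact n))"
      by (intro sums_diff exp_sums_divide sums_If_finite_set) simp
    from sums_mult2[OF this, of "fourier k \<xi>"]
    have "(\<lambda>n. a n * u ^ n * fourier k \<xi>) sums ((exp (c * u) - (\<Sum>n<3. (c * u) ^ n / fact n)) * fourier k \<xi>)"
      by (rule sums_cong[THEN iffD1, rotated]) (auto simp: a_def power_mult_distrib)
    with g(2)[of \<xi>] have "fourier g \<xi> = (exp (c * u) - (\<Sum>n<3. (c * u) ^ n / fact n)) * fourier k \<xi>"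
      unfolding u_def by (rule sums_unique2)
    also have "(\<Sum>n<3. (c * u) ^ n / fact n) = 1 + c * u + c\<^sup>2 / 2 * u ^ 2"
      by (simp add: numeral_3_eq_3 power_mult_distrib power2_eq_square)
    finally show "fourier g \<xi> = (exp (c * complex_of_real (\<alpha> \<bullet> \<xi>)) - 1 - c * complex_of_real (\<alpha> \<bullet> \<xi>)
        - c\<^sup>2 / 2 * complex_of_real (\<alpha> \<bullet> \<xi>) ^ 2) * fourier k \<xi>"
      by (simp add: u_def algebra_simps)
    show "L1norm g \<le> norm c ^ 3 * exp ?D * L1norm k"
      using g(3) mult_right_mono[OF b L1norm_nonneg[of k]] by simp
  qed
qed

lemma fourier_plateau_support:
  "\<exists>l. \<bar>\<xi> $ l\<bar> > real (N + 1) \<Longrightarrow> fourier (plateau N 1 0) \<xi> = 0"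
  using fourier_plateau_0[where r=1 and N=N and \<xi>=\<xi> and \<gamma>=0] by (auto intro: less_imp_le simp: add.commute)

lemma fourier_plateau_eq_1:
  "\<not> (\<exists>l. \<bar>\<xi> $ l\<bar> > real N) \<Longrightarrow> fourier (plateau N 1 0) \<xi> = 1"
  by (rule fourier_plateau_1) (auto simp: not_less)

text \<open>Only the transform matters for the action, but estimates need a controlled norm, so the
  choice fixes both. The index \<open>N + 1\<close> in the bound appears because the transform of
  the cutoff decays to zero over one more unit.\<close>

definition expker :: "real^'d \<Rightarrow> nat \<Rightarrow> complex \<Rightarrow> real^'d \<Rightarrow> complex" where
  "expker \<alpha> N c = (SOME g. integrable lborel g \<and>
     (\<forall>\<xi>. fourier g \<xi> = exp (c * complex_of_real (\<alpha> \<bullet> \<xi>)) * fourier (plateau N 1 0) \<xi>) \<and>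
     L1norm g \<le> exp (norm c * L1norm (lin_ker \<alpha> (N + 1))) * L1norm (plateau N 1 0 :: real^'d \<Rightarrow> complex))"

lemma
  fixes \<alpha> :: "real^'d"
  shows integrable_expker: "integrable lborel (expker \<alpha> N c)"
    and fourier_expker: "fourier (expker \<alpha> N c) \<xi> = exp (c * complex_of_real (\<alpha> \<bullet> \<xi>)) * fourier (plateau N 1 0) \<xi>"
    and L1norm_expker_le: "L1norm (expker \<alpha> N c) \<le>
      exp (norm c * L1norm (lin_ker \<alpha> (N + 1))) * L1norm (plateau N 1 0 :: real^'d \<Rightarrow> complex)"
proof -
  have "\<exists>g. integrable lborel g \<and>
     (\<forall>\<xi>. fourier g \<xi> = exp (c * complex_of_real (\<alpha> \<bullet> \<xi>)) * fourier (plateau N 1 0) \<xi>) \<and>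
     L1norm g \<le> exp (norm c * L1norm (lin_ker \<alpha> (N + 1))) * L1norm (plateau N 1 0 :: real^'d \<Rightarrow> complex)"
    using exp_kernel[OF integrable_plateau[OF zero_less_one] fourier_plateau_support, where c=c and \<alpha>=\<alpha>] by metis
  from someI_ex[OF this] show "integrable lborel (expker \<alpha> N c)"
    "fourier (expker \<alpha> N c) \<xi> = exp (c * complex_of_real (\<alpha> \<bullet> \<xi>)) * fourier (plateau N 1 0) \<xi>"
    "L1norm (expker \<alpha> N c) \<le>
      exp (norm c * L1norm (lin_ker \<alpha> (N + 1))) * L1norm (plateau N 1 0 :: real^'d \<Rightarrow> complex)"
    unfolding expker_def by blast+
qed

text \<open>The four points of a discrete Laplacian: \<open>g\<close> and \<open>g'\<close> are
  first-order terms and cancel in pairs, \<open>h\<close> is the quadratic term and changes sign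
  between the real and the imaginary direction.\<close>

lemma laplacian_sum:
  "(a - y - g - h) + (b - y - - g - h) + (c - y - g' - - h) + (d - y - - g' - - h) = (a + b + c + d) - (y + y + y + y)"
  for a :: "'a::ab_group_add"
  by (simp add: algebra_simps)

lemma four_scaleR: "4 *\<^sub>R x = x + x + x + (x :: 'a::real_vector)"
  using scaleR_add_left[of 2 2 x] by (simp add: scaleR_2 add.assoc)

text \<open>A midpoint inequality with a cubic defect forces the maximum to the boundary, by perturbing with \<open>\<eta> s\<^sup>2\<close>.\<close>
lemma max_principle_midpoint:
  fixes f :: "real \<Rightarrow> real"
  assumes c: "continuous_on {0..1} f"
    and mid: "\<And>s r. 0 < r \<Longrightarrow> 0 \<le> s - r \<Longrightarrow> s + r \<le> 1 \<Longrightarrow> f (s + r) + f (s - r) - 2 * f s \<ge> - C * r ^ 3"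
    and s: "s \<in> {0..1}"
  shows "f s \<le> max (f 0) (f 1)"
proof (rule ccontr)
  assume "\<not> ?thesis"
  then have gt: "f s > max (f 0) (f 1)" by linarith
  \<comment> \<open>Half of the assumed excess: adding at most \<eta> to the boundary values still
    leaves them below the interior maximum.\<close>
  define \<eta> where "\<eta> = (f s - max (f 0) (f 1)) / 2"
  have \<eta>: "\<eta> > 0" "f 0 + 2 * \<eta> \<le> f s" "f 1 + 2 * \<eta> \<le> f s" using gt by (auto simp: \<eta>_def field_simps)
  define g where "g u = f u + \<eta> * u\<^sup>2" for u
  have "continuous_on {0..1} g" unfolding g_def by (intro continuous_intros c)
  then obtain m where m: "m \<in> {0..1}" "\<And>u. u \<in> {0..1} \<Longrightarrow> g u \<le> g m"
    using continuous_attains_sup[of "{0..1::real}" g] by auto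
  have "\<eta> * s\<^sup>2 \<ge> 0" using \<eta> by simp
  then have "g m \<ge> f s" using m(2)[OF s] by (simp add: g_def)
  then have "m \<noteq> 0" "m \<noteq> 1" using \<eta> by (auto simp: g_def)
  with m(1) have m01: "0 < m" "m < 1" by auto
  \<comment> \<open>The second bound makes the cubic defect at most
    \<open>\<eta> * r\<^sup>2\<close>, whereas the perturbation contributes
    \<open>2 * \<eta> * r\<^sup>2\<close> to the second difference.\<close>
  define r where "r = min (min m (1 - m)) (\<eta> / (\<bar>C\<bar> + 1))"
  have r: "r > 0" "0 \<le> m - r" "m + r \<le> 1" using m01 \<eta> by (auto simp: r_def)
  have "r * (\<bar>C\<bar> + 1) \<le> \<eta>"
    using pos_le_divide_eq[of "\<bar>C\<bar> + 1" r \<eta>] by (simp add: r_def)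
  moreover have "C * r \<le> (\<bar>C\<bar> + 1) * r" using r(1) by (intro mult_right_mono) auto
  ultimately have "C * r \<le> \<eta>" by (simp add: mult.commute)
  then have "C * r ^ 3 \<le> \<eta> * r\<^sup>2"
    using mult_right_mono[of "C * r" \<eta> "r\<^sup>2"] by (simp add: power3_eq_cube power2_eq_square mult.assoc)
  moreover have "g (m + r) \<le> g m" "g (m - r) \<le> g m" using m01 r by (auto intro!: m(2))
  then have "f (m + r) + f (m - r) - 2 * f m \<le> - 2 * (\<eta> * r\<^sup>2)"
    by (simp add: g_def power2_eq_square algebra_simps)
  moreover have "\<eta> * r\<^sup>2 > 0" using \<eta> r by simp
  ultimately show False using mid[OF r] by simp
qed

lemma has_derivative_0_quadratic:
  fixes f :: "real \<Rightarrow> 'a::real_normed_vector"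
  assumes "\<And>u. u \<in> S \<Longrightarrow> \<bar>u - s\<bar> \<le> 1 \<Longrightarrow> norm (f u - f s) \<le> K * (u - s)\<^sup>2"
  shows "(f has_derivative (\<lambda>_. 0)) (at s within S)"
proof (rule has_derivativeI_sandwich[where e=1 and H="\<lambda>u. K * \<bar>u - s\<bar>"])
  show "norm (f u - f s - 0) / norm (u - s) \<le> K * \<bar>u - s\<bar>" if "u \<in> S" "u \<noteq> s" "dist u s < 1" for u
    using assms[of u] that by (simp add: dist_real_def divide_le_eq power2_eq_square abs_mult_self_eq mult.assoc)
  show "((\<lambda>u. K * \<bar>u - s\<bar>) \<longlongrightarrow> 0) (at s within S)" by (auto intro!: tendsto_eq_intros)
qed auto

context l1_banach_module
begin

section \<open>Band-limited elements and their entire extension\<close>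

text \<open>A substitute for having spectrum in a cube: being fixed by a cutoff is an algebraic
  condition, inherited by differences and under every \<open>act f\<close>.\<close>

definition band :: "nat \<Rightarrow> 'm \<Rightarrow> bool" where
  "band N x \<longleftrightarrow> act (plateau N 1 0) x = x"

text \<open>For band-limited \<open>x\<close> this is the entire extension of
  \<open>t \<mapsto> T (t *\<^sub>R \<alpha>) x\<close>, parametrised so that \<i> times a real
  \<open>t\<close> gives the group and \<open>c = 1\<close> gives the functional calculus at
  \<open>exp_fun \<alpha>\<close>.\<close>

definition ext :: "real^'d \<Rightarrow> nat \<Rightarrow> complex \<Rightarrow> 'm \<Rightarrow> 'm" where
  "ext \<alpha> N c x = act (expker \<alpha> N c) x"

abbreviation (input) pl where "pl N \<equiv> (plateau N 1 0 :: real^'d \<Rightarrow> complex)"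

lemma integrable_pl: "integrable lborel (pl N)" by (rule integrable_plateau) simp

lemma band_act: "integrable lborel f \<Longrightarrow> band N x \<Longrightarrow> band N (act f x)"
  unfolding band_def using act_commute[OF integrable_pl, of f N x] by simp

lemma band_diff: "band N x \<Longrightarrow> band N y \<Longrightarrow> band N (x - y)"
  unfolding band_def by (simp add: act_diff_right integrable_pl)

lemma band_ext: "band N x \<Longrightarrow> band N (ext \<alpha> N c x)"
  unfolding ext_def by (intro band_act integrable_expker)

lemma band_act_kernel:
  assumes k: "integrable lborel k" and supp: "\<And>\<xi>. \<exists>l. \<bar>\<xi> $ l\<bar> > real N \<Longrightarrow> fourier k \<xi> = 0"
  shows "band N (act k x)"
proof -
  have "act (conv (pl N) k) x = act k x"
  proof (rule act_cong_fourier)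
    fix \<xi>
    show "fourier (conv (pl N) k) \<xi> = fourier k \<xi>"
      using supp[of \<xi>] fourier_plateau_eq_1[where \<xi>=\<xi> and N=N]
      by (cases "\<exists>l. \<bar>\<xi> $ l\<bar> > real N") (auto simp: fourier_conv integrable_pl k)
  qed (use k integrable_pl integrable_conv in auto)
  then show ?thesis by (simp add: band_def act_conv integrable_pl k)
qed

text \<open>\<open>x\<close> is fixed by two cutoffs. Attaching to each exponential kernel the
  cutoff of the other gives equal transforms. This makes \<open>ext\<close> independent of
  \<open>N\<close> and identifies it with the value in \<open>fc_graph\<close>.\<close>

lemma ext_eq_act:
  assumes "band N x" "integrable lborel g"
    "\<And>\<xi>. fourier g \<xi> = exp (c * complex_of_real (\<alpha> \<bullet> \<xi>)) * fourier \<phi> \<xi>"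
    and \<phi>: "integrable lborel \<phi>" "act \<phi> x = x"
  shows "ext \<alpha> N c x = act g x"
proof -
  have "act (expker \<alpha> N c) (act \<phi> x) = act g (act (pl N) x)"
    using assms act_cong_fourier[of "conv (expker \<alpha> N c) \<phi>" "conv g (pl N)" x]
    by (simp add: act_conv integrable_conv fourier_conv integrable_expker integrable_pl fourier_expker mult_ac)
  then show ?thesis using assms by (simp add: ext_def band_def)
qed

lemma ext_indep:
  assumes "band N x" "band M x"
  shows "ext \<alpha> N c x = ext \<alpha> M c x"
  unfolding ext_def[of \<alpha> M]
  by (rule ext_eq_act[where \<phi>="pl M"]) (use assms in \<open>auto simp: band_def integrable_pl integrable_expker fourier_expker\<close>)

lemma ext_0: "band N x \<Longrightarrow> ext \<alpha> N 0 x = x"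
  using ext_eq_act[of N x "pl N" 0 \<alpha> "pl N"] by (simp add: band_def integrable_pl)

lemma ext_add:
  assumes "band N x" shows "ext \<alpha> N (c + h) x = ext \<alpha> N h (ext \<alpha> N c x)"
proof -
  have "act (expker \<alpha> N (c + h)) x = act (conv (expker \<alpha> N h) (expker \<alpha> N c)) x"
  proof (rule trans[OF _ act_cong_fourier])
    show "act (expker \<alpha> N (c + h)) x = act (conv (expker \<alpha> N (c + h)) (pl N)) x"
      using assms by (simp add: act_conv integrable_expker integrable_pl band_def)
  qed (auto simp: integrable_conv integrable_expker integrable_pl fourier_conv fourier_expker distrib_right exp_add mult_ac)
  then show ?thesis by (simp add: ext_def act_conv integrable_expker)
qed

lemma ext_diff: "ext \<alpha> N c (x - y) = ext \<alpha> N c x - ext \<alpha> N c y"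
  by (simp add: ext_def act_diff_right integrable_expker)

lemma T_eq_ext:
  assumes "band N x" shows "T (t *\<^sub>R \<alpha>) x = ext \<alpha> N (\<i> * complex_of_real t) x"
proof -
  have "ext \<alpha> N (\<i> * complex_of_real t) x = act (\<lambda>s. pl N (s + t *\<^sub>R \<alpha>)) x"
    using assms integrable_pl[of N]
    by (intro ext_eq_act[where \<phi>="pl N"] integrable_lborel_shift)
       (auto simp: fourier_shift band_def mult.assoc)
  also have "\<dots> = T (t *\<^sub>R \<alpha>) x" using T_act[OF integrable_pl[of N], of "t *\<^sub>R \<alpha>" x] assms by (simp add: band_def)
  finally show ?thesis ..
qed

lemma norm_ext_le:
  "norm (ext \<alpha> N c x) \<le> exp (norm c * L1norm (lin_ker \<alpha> (N + 1))) * L1norm (pl N) * norm x"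
  unfolding ext_def
  by (rule order_trans[OF norm_act_le[OF integrable_expker]]) (intro mult_right_mono L1norm_expker_le norm_ge_zero)

text \<open>The generator of \<open>ext\<close> on \<open>band N\<close>, bounded because
  frequencies are. \<open>lin_ker\<close> is taken at \<open>N + 1\<close>, where its transform is
  exact on the whole support of the transform of \<open>plateau N 1 0\<close>.\<close>

definition gen :: "real^'d \<Rightarrow> nat \<Rightarrow> 'm \<Rightarrow> 'm" where "gen \<alpha> N x = act (lin_ker \<alpha> (N + 1)) x"

text \<open>The exponential kernel minus its second-order Taylor polynomial has the same transform
  as the remainder kernel, hence acts in the same way.\<close>

lemma ext_taylor2:
  assumes x: "band N x" and h: "norm h \<le> 1"
  shows "norm (ext \<alpha> N h x - x - h *\<^sub>C gen \<alpha> N x - (h\<^sup>2 / 2) *\<^sub>C gen \<alpha> N (gen \<alpha> N x))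
    \<le> exp (L1norm (lin_ker \<alpha> (N + 1))) * L1norm (pl N) * norm h ^ 3 * norm x"
proof -
  let ?d = "lin_ker \<alpha> (N + 1)"
  obtain g where g: "integrable lborel g"
    "\<And>\<xi>. fourier g \<xi> = (exp (h * complex_of_real (\<alpha> \<bullet> \<xi>)) - 1 - h * complex_of_real (\<alpha> \<bullet> \<xi>)
        - h\<^sup>2 / 2 * complex_of_real (\<alpha> \<bullet> \<xi>) ^ 2) * fourier (pl N) \<xi>"
    "L1norm g \<le> norm h ^ 3 * exp (L1norm ?d) * L1norm (pl N)"
    using exp_kernel_remainder[OF integrable_pl fourier_plateau_support h, where \<alpha>=\<alpha>] by blast
  let ?f = "\<lambda>t. expker \<alpha> N h t - pl N t - h * conv ?d (pl N) t - (h\<^sup>2 / 2) * conv ?d (conv ?d (pl N)) t"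
  note I = integrable_expker integrable_pl integrable_lin_ker integrable_conv
  have d: "fourier ?d \<xi> * fourier (pl N) \<xi> = complex_of_real (\<alpha> \<bullet> \<xi>) * fourier (pl N) \<xi>" for \<xi>
    using fourier_plateau_support[where \<xi>=\<xi> and N=N] fourier_lin_ker[where \<xi>=\<xi> and N="N+1" and \<alpha>=\<alpha>]
    by (cases "\<exists>l. \<bar>\<xi> $ l\<bar> > real (N + 1)") (auto simp: not_less)
  have "act ?f x = act g x"
  proof (rule act_cong_fourier)
    fix \<xi>
    have "fourier ?f \<xi> = fourier (expker \<alpha> N h) \<xi> - fourier (pl N) \<xi> - h * (fourier ?d \<xi> * fourier (pl N) \<xi>)
      - (h\<^sup>2 / 2) * (fourier ?d \<xi> * (fourier ?d \<xi> * fourier (pl N) \<xi>))"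
      by (simp add: fourier_diff fourier_cmult fourier_conv I del: times_divide_eq_left)
    also have "\<dots> = fourier g \<xi>"
    proof -
      have "fourier ?d \<xi> * (fourier ?d \<xi> * fourier (pl N) \<xi>) = complex_of_real (\<alpha> \<bullet> \<xi>) ^ 2 * fourier (pl N) \<xi>"
        using d by (simp only: power2_eq_square mult.assoc mult.left_commute[of "fourier ?d \<xi>"])
      then show ?thesis unfolding g(2) fourier_expker d by (auto simp: algebra_simps)
    qed
    finally show "fourier ?f \<xi> = fourier g \<xi>" .
  qed (auto simp: I g)
  moreover have "act ?f x = ext \<alpha> N h x - x - h *\<^sub>C gen \<alpha> N x - (h\<^sup>2 / 2) *\<^sub>C gen \<alpha> N (gen \<alpha> N x)"
    using x by (simp add: act_diff act_cmult act_conv I ext_def gen_def band_def del: times_divide_eq_left)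
  ultimately have "norm (ext \<alpha> N h x - x - h *\<^sub>C gen \<alpha> N x - (h\<^sup>2 / 2) *\<^sub>C gen \<alpha> N (gen \<alpha> N x)) \<le> L1norm g * norm x"
    using norm_act_le[OF g(1), of x] by simp
  also have "\<dots> \<le> (norm h ^ 3 * exp (L1norm ?d) * L1norm (pl N)) * norm x"
    by (intro mult_right_mono g norm_ge_zero)
  finally show ?thesis by (simp add: mult_ac)
qed

lemma ext_taylor1:
  assumes x: "band N x"
  obtains K where "K \<ge> 0" "\<And>h. norm h \<le> 1 \<Longrightarrow> norm (ext \<alpha> N h x - x - h *\<^sub>C gen \<alpha> N x) \<le> K * norm h ^ 2"
proof
  let ?K = "exp (L1norm (lin_ker \<alpha> (N + 1))) * L1norm (pl N) * norm x"
  let ?G = "gen \<alpha> N (gen \<alpha> N x)"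
  show "?K + norm ?G \<ge> 0" by (simp add: L1norm_nonneg)
  fix h :: complex assume h: "norm h \<le> 1"
  have "norm (ext \<alpha> N h x - x - h *\<^sub>C gen \<alpha> N x) \<le>
     norm (ext \<alpha> N h x - x - h *\<^sub>C gen \<alpha> N x - (h\<^sup>2 / 2) *\<^sub>C ?G) + norm ((h\<^sup>2 / 2) *\<^sub>C ?G)"
    by norm
  also have "\<dots> \<le> ?K * norm h ^ 3 + norm h ^ 2 * norm ?G"
    using ext_taylor2[OF x h, of \<alpha>] by (intro add_mono) (auto simp: norm_scaleC norm_divide norm_power mult_ac intro!: mult_right_mono)
  also have "?K * norm h ^ 3 \<le> ?K * norm h ^ 2"
    using h by (intro mult_left_mono power_decreasing) (auto simp: L1norm_nonneg)
  finally show "norm (ext \<alpha> N h x - x - h *\<^sub>C gen \<alpha> N x) \<le> (?K + norm ?G) * norm h ^ 2"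
    by (simp add: algebra_simps)
qed

lemma continuous_ext:
  assumes x: "band N x" shows "continuous_on UNIV (\<lambda>s. ext \<alpha> N (complex_of_real s) x)"
proof (rule continuous_at_imp_continuous_on, rule ballI)
  fix s :: real
  let ?y = "ext \<alpha> N (complex_of_real s) x"
  obtain K where K: "K \<ge> 0" "\<And>h. norm h \<le> 1 \<Longrightarrow> norm (ext \<alpha> N h ?y - ?y - h *\<^sub>C gen \<alpha> N ?y) \<le> K * norm h ^ 2"
    using ext_taylor1[OF band_ext[OF x]] by blast
  have "((\<lambda>u. ext \<alpha> N (complex_of_real u) x - ?y) \<longlongrightarrow> 0) (at s)"
  proof (rule Lim_null_comparison)
    show "((\<lambda>u. K * \<bar>u - s\<bar> ^ 2 + \<bar>u - s\<bar> * norm (gen \<alpha> N ?y)) \<longlongrightarrow> 0) (at s)"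
      by (auto intro!: tendsto_eq_intros)
    have "\<forall>\<^sub>F u in at s. \<bar>u - s\<bar> < 1"
      unfolding eventually_at by (intro exI[of _ 1]) (auto simp: dist_real_def)
    then show "\<forall>\<^sub>F u in at s. norm (ext \<alpha> N (complex_of_real u) x - ?y) \<le> K * \<bar>u - s\<bar> ^ 2 + \<bar>u - s\<bar> * norm (gen \<alpha> N ?y)"
    proof eventually_elim
      case (elim u)
      define h where "h = complex_of_real (u - s)"
      have h: "norm h = \<bar>u - s\<bar>" by (simp add: h_def flip: of_real_diff)
      have "ext \<alpha> N (complex_of_real u) x = ext \<alpha> N h ?y"
        using ext_add[OF x, of \<alpha> "complex_of_real s" h] by (simp add: h_def)
      moreover have "norm (ext \<alpha> N h ?y - ?y) \<le> norm (ext \<alpha> N h ?y - ?y - h *\<^sub>C gen \<alpha> N ?y) + norm (h *\<^sub>C gen \<alpha> N ?y)"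
        by norm
      ultimately show ?case using K(2)[of h] elim h by (simp add: norm_scaleC)
    qed
  qed
  then show "isCont (\<lambda>s. ext \<alpha> N (complex_of_real s) x) s"
    unfolding isCont_def by (rule LIM_zero_cancel)
qed

text \<open>A three lines theorem. Since the imaginary translates of \<open>ext s x\<close> have the same norm, the
  discrete Laplacian of the harmonic function \<open>ext c x\<close> gives convexity in \<open>s\<close> up to a cubic error.\<close>
lemma norm_ext_le_max:
  assumes x: "band N x" and s: "s \<in> {0..1}"
  shows "norm (ext \<alpha> N (complex_of_real s) x) \<le> max (norm x) (norm (ext \<alpha> N 1 x))"
proof -
  let ?E = "\<lambda>s. ext \<alpha> N (complex_of_real s) x"
  define C where "C = exp (L1norm (lin_ker \<alpha> (N + 1))) * L1norm (pl N)"
  have C: "C \<ge> 0" by (simp add: C_def L1norm_nonneg)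
  have "norm (?E s) \<le> max (norm (?E 0)) (norm (?E 1))"
  proof (rule max_principle_midpoint[OF _ _ s, where C="4 * C * (C * norm x)"])
    show "continuous_on {0..1} (\<lambda>s. norm (?E s))"
      by (intro continuous_on_norm continuous_on_subset[OF continuous_ext[OF x]]) auto
    fix s r :: real assume r: "0 < r" "0 \<le> s - r" "s + r \<le> 1"
    let ?y = "?E s" and ?g = "gen \<alpha> N" and ?r = "complex_of_real r"
    have y: "band N ?y" using x by (rule band_ext)
    define R where "R h = ext \<alpha> N h ?y - ?y - h *\<^sub>C ?g ?y - (h\<^sup>2 / 2) *\<^sub>C ?g (?g ?y)" for h
    have R: "norm (R h) \<le> C * r ^ 3 * norm ?y" if "norm h = r" for h
      unfolding R_def using ext_taylor2[OF y, of h \<alpha>] r that by (simp add: C_def mult_ac)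
    \<comment> \<open>The defect constant in the midpoint inequality must not depend on
      \<open>s\<close>; as \<open>s\<close> stays in the unit interval, one exponential bounds all
      values.\<close>
    have ny: "norm ?y \<le> C * norm x"
    proof -
      have "exp (norm (complex_of_real s) * L1norm (lin_ker \<alpha> (N + 1))) \<le> exp (L1norm (lin_ker \<alpha> (N + 1)))"
        using r by (simp add: mult_left_le_one_le L1norm_nonneg)
      then have "exp (norm (complex_of_real s) * L1norm (lin_ker \<alpha> (N + 1))) * L1norm (pl N) * norm x \<le> C * norm x"
        unfolding C_def by (intro mult_right_mono) (auto simp: L1norm_nonneg)
      then show ?thesis using norm_ext_le[of \<alpha> N "complex_of_real s" x] by simp
    qed
    have e1: "ext \<alpha> N ?r ?y = ?E (s + r)" "ext \<alpha> N (- ?r) ?y = ?E (s - r)"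
      using ext_add[OF x, of \<alpha> "complex_of_real s" ?r] ext_add[OF x, of \<alpha> "complex_of_real s" "- ?r"] by simp_all
    have e2: "norm (ext \<alpha> N (\<i> * ?r) ?y) = norm ?y" "norm (ext \<alpha> N (- (\<i> * ?r)) ?y) = norm ?y"
      using T_eq_ext[OF y, of r \<alpha>] T_eq_ext[OF y, of "-r" \<alpha>] norm_T by (metis, metis mult_minus_right of_real_minus norm_T)
    \<comment> \<open>Opposite squares for real and imaginary increments: the quadratic terms cancel
      in the sum over the four points, and only cubic remainders are left.\<close>
    have sq: "(\<i> * ?r)\<^sup>2 / 2 = - (?r\<^sup>2 / 2)" "(- (\<i> * ?r))\<^sup>2 / 2 = - (?r\<^sup>2 / 2)" "(- ?r)\<^sup>2 / 2 = ?r\<^sup>2 / 2"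
      by (simp_all add: power_mult_distrib)
    have "R ?r + R (- ?r) + R (\<i> * ?r) + R (- (\<i> * ?r)) =
        (?E (s + r) + ?E (s - r) + ext \<alpha> N (\<i> * ?r) ?y + ext \<alpha> N (- (\<i> * ?r)) ?y) - 4 *\<^sub>R ?y"
      unfolding R_def sq e1 scaleC_minus_left four_scaleR by (rule laplacian_sum)
    then have "4 *\<^sub>R ?y = (?E (s + r) + ?E (s - r) + ext \<alpha> N (\<i> * ?r) ?y + ext \<alpha> N (- (\<i> * ?r)) ?y)
        - (R ?r + R (- ?r) + R (\<i> * ?r) + R (- (\<i> * ?r)))" by (simp add: algebra_simps)
    moreover have tri: "norm (a + b + c + d) \<le> norm a + norm b + norm c + norm d" for a b c d :: 'm
      by norm
    ultimately have "norm (4 *\<^sub>R ?y) \<le> (norm (?E (s + r)) + norm (?E (s - r)) + norm (ext \<alpha> N (\<i> * ?r) ?y) + norm (ext \<alpha> N (- (\<i> * ?r)) ?y))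
        + (norm (R ?r) + norm (R (- ?r)) + norm (R (\<i> * ?r)) + norm (R (- (\<i> * ?r))))"
      by (simp only:) (rule order_trans[OF norm_triangle_ineq4 add_mono[OF tri tri]])
    also have "\<dots> \<le> norm (?E (s + r)) + norm (?E (s - r)) + norm ?y + norm ?y
        + (C * r ^ 3 * norm ?y + C * r ^ 3 * norm ?y + C * r ^ 3 * norm ?y + C * r ^ 3 * norm ?y)"
      unfolding e2 using r by (intro add_mono order_refl R) (auto simp: norm_mult)
    finally have "norm (?E (s + r)) + norm (?E (s - r)) - 2 * norm ?y \<ge> - (4 * (C * r ^ 3 * norm ?y))" by simp
    moreover have "C * r ^ 3 * norm ?y \<le> C * r ^ 3 * (C * norm x)"
      using ny C r by (intro mult_left_mono) auto
    ultimately show "norm (?E (s + r)) + norm (?E (s - r)) - 2 * norm ?y \<ge> - (4 * C * (C * norm x)) * r ^ 3"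
      by (simp add: mult_ac)
  qed
  then show ?thesis using x by (simp add: ext_0)
qed

text \<open>A curve whose derivative \<open>W\<close> is \<open>-\<i>\<close> times its derivative along the group is the analytic
  continuation of its initial value: after smoothing by \<open>k\<close>, continuing back along \<open>ext\<close> gives a constant.\<close>
lemma act_flow_eq:
  assumes \<delta>: "\<delta> \<ge> 0"
    and real: "\<And>s. s \<in> {0..\<delta>} \<Longrightarrow> \<exists>K. \<forall>u\<in>{0..\<delta>}. \<bar>u - s\<bar> \<le> 1 \<longrightarrow> norm (y u - y s - (u - s) *\<^sub>R W s) \<le> K * (u - s)\<^sup>2"
    and imag: "\<And>s. s \<in> {0..\<delta>} \<Longrightarrow> \<exists>K. \<forall>t. \<bar>t\<bar> \<le> 1 \<longrightarrow> norm (T (t *\<^sub>R \<alpha>) (y s) - y s - (\<i> * complex_of_real t) *\<^sub>C W s) \<le> K * t\<^sup>2"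
    and k: "integrable lborel k" and supp: "\<And>\<xi>. \<exists>l. \<bar>\<xi> $ l\<bar> > real N \<Longrightarrow> fourier k \<xi> = 0"
    and k': "integrable lborel k'" "\<And>\<xi>. fourier k' \<xi> = exp (complex_of_real (\<delta> * (\<alpha> \<bullet> \<xi>))) * fourier k \<xi>"
  shows "act k (y \<delta>) = act k' (y 0)"
proof -
  define z where "z s = act k (y s)" for s
  have z: "band N (z s)" for s unfolding z_def using k supp by (rule band_act_kernel)
  \<comment> \<open>The group orbit of \<open>z s\<close> has two first-order expansions: one from
    \<open>imag\<close> after applying \<open>k\<close>, one from band limitation. Comparing them as
    \<open>t\<close> tends to 0 identifies the generator.\<close>
  have gz: "gen \<alpha> N (z s) = act k (W s)" if s: "s \<in> {0..\<delta>}" for s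
  proof -
    obtain K where K: "\<And>t. \<bar>t\<bar> \<le> 1 \<Longrightarrow> norm (T (t *\<^sub>R \<alpha>) (y s) - y s - (\<i> * complex_of_real t) *\<^sub>C W s) \<le> K * t\<^sup>2"
      using imag[OF s] by blast
    obtain K' where K': "\<And>h. norm h \<le> 1 \<Longrightarrow> norm (ext \<alpha> N h (z s) - z s - h *\<^sub>C gen \<alpha> N (z s)) \<le> K' * norm h ^ 2"
      using ext_taylor1[OF z] by blast
    let ?v = "gen \<alpha> N (z s) - act k (W s)"
    define L where "L = L1norm k * K + K'"
    have le: "norm ?v \<le> L * t" if t: "0 < t" "t \<le> 1" for t
    proof -
      let ?t = "\<i> * complex_of_real t"
      let ?A = "act k (T (t *\<^sub>R \<alpha>) (y s) - y s - ?t *\<^sub>C W s)"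
      let ?B = "ext \<alpha> N ?t (z s) - z s - ?t *\<^sub>C gen \<alpha> N (z s)"
      have "norm ?A \<le> L1norm k * (K * t\<^sup>2)"
        using K[of t] t by (intro order_trans[OF norm_act_le[OF k]] mult_left_mono) (auto simp: L1norm_nonneg)
      moreover have "norm ?B \<le> K' * t\<^sup>2" using K'[of ?t] t by (simp add: norm_mult)
      moreover have "?A = ext \<alpha> N ?t (z s) - z s - ?t *\<^sub>C act k (W s)"
        using k by (simp add: act_diff_right act_scaleC z_def flip: T_act_comm T_eq_ext[OF z, unfolded z_def])
      then have "?A - ?B = ?t *\<^sub>C ?v" by (simp add: scaleC_diff_right)
      then have "t * norm ?v = norm (?A - ?B)" using t by (simp add: norm_scaleC norm_mult)
      ultimately have "t * norm ?v \<le> L * t * t"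
        using norm_triangle_ineq4[of ?A ?B] by (simp add: L_def algebra_simps power2_eq_square)
      then show ?thesis using t by simp
    qed
    have "norm ?v \<le> 0"
    proof (rule LIMSEQ_le_const)
      show "(\<lambda>n. L * inverse (real (Suc n))) \<longlonglongrightarrow> 0"
        using LIMSEQ_inverse_real_of_nat by (rule tendsto_mult_right_zero)
      show "\<exists>N. \<forall>n\<ge>N. norm ?v \<le> L * inverse (real (Suc n))"
        by (intro exI allI impI le) (auto simp: field_simps)
    qed
    then show ?thesis by simp
  qed
  define Y where "Y s = ext \<alpha> N (complex_of_real (\<delta> - s)) (z s)" for s
  define M where "M = exp (\<delta> * L1norm (lin_ker \<alpha> (N + 1))) * L1norm (pl N)"
  have M: "M \<ge> 0" by (simp add: M_def L1norm_nonneg)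
  have nM: "norm (ext \<alpha> N (complex_of_real (\<delta> - u)) w) \<le> M * norm w" if "u \<in> {0..\<delta>}" for u w
  proof -
    have "norm (complex_of_real (\<delta> - u)) \<le> \<delta>" using that unfolding norm_of_real by simp
    then have "exp (norm (complex_of_real (\<delta> - u)) * L1norm (lin_ker \<alpha> (N + 1))) * L1norm (pl N) * norm w \<le> M * norm w"
      unfolding M_def by (intro mult_right_mono) (auto simp: L1norm_nonneg mult_right_mono)
    then show ?thesis using norm_ext_le order_trans by blast
  qed
  have "(Y has_derivative (\<lambda>_. 0)) (at s within {0..\<delta>})" if s: "s \<in> {0..\<delta>}" for s
  proof -
    obtain K where K: "\<And>u. u \<in> {0..\<delta>} \<Longrightarrow> \<bar>u - s\<bar> \<le> 1 \<Longrightarrow> norm (y u - y s - (u - s) *\<^sub>R W s) \<le> K * (u - s)\<^sup>2"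
      using real[OF s] by blast
    obtain K' where K': "\<And>h. norm h \<le> 1 \<Longrightarrow> norm (ext \<alpha> N h (z s) - z s - h *\<^sub>C gen \<alpha> N (z s)) \<le> K' * norm h ^ 2"
      using ext_taylor1[OF z] by blast
    show ?thesis
    proof (rule has_derivative_0_quadratic)
      fix u assume u: "u \<in> {0..\<delta>}" "\<bar>u - s\<bar> \<le> 1"
      let ?h = "complex_of_real (u - s)"
      let ?A = "act k (y u - y s - ?h *\<^sub>C W s)"
      let ?B = "ext \<alpha> N ?h (z s) - z s - ?h *\<^sub>C gen \<alpha> N (z s)"
      have h: "norm ?h = \<bar>u - s\<bar>" by (rule norm_of_real)
      have A: "norm ?A \<le> L1norm k * (K * (u - s)\<^sup>2)"
        using K[OF u] unfolding scaleC_of_real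
        by (intro order_trans[OF norm_act_le[OF k]] mult_left_mono) (auto simp: L1norm_nonneg)
      have B: "norm ?B \<le> K' * (u - s)\<^sup>2" using K'[of ?h] u(2) unfolding h by simp
      \<comment> \<open>Transport over \<open>\<delta> - s\<close> factors through the time
        \<open>u\<close>. So \<open>Y u - Y s\<close> is the transport of
        \<open>z u - ext \<alpha> N ?h (z s)\<close>, whose first-order terms agree by
        \<open>gz\<close>.\<close>
      have "ext \<alpha> N (complex_of_real (\<delta> - s)) (z s) = ext \<alpha> N (complex_of_real (\<delta> - u)) (ext \<alpha> N ?h (z s))"
        using ext_add[OF z, of \<alpha> ?h "complex_of_real (\<delta> - u)" s] by simp
      then have "Y u - Y s = ext \<alpha> N (complex_of_real (\<delta> - u)) (z u - ext \<alpha> N ?h (z s))"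
        by (simp add: Y_def ext_diff)
      also have "z u - ext \<alpha> N ?h (z s) = ?A - ?B"
        using k by (simp add: gz[OF s] act_diff_right act_scaleC) (simp add: z_def)
      also have "norm (ext \<alpha> N (complex_of_real (\<delta> - u)) (?A - ?B)) \<le> M * norm (?A - ?B)"
        using u(1) by (rule nM)
      also have "\<dots> \<le> M * (L1norm k * (K * (u - s)\<^sup>2) + K' * (u - s)\<^sup>2)"
        using norm_triangle_ineq4[of ?A ?B] A B M by (intro mult_left_mono) linarith
      finally show "norm (Y u - Y s) \<le> (M * (L1norm k * K + K')) * (u - s)\<^sup>2"
        by (simp add: algebra_simps)
    qed
  qed
  then obtain c where "\<And>s. s \<in> {0..\<delta>} \<Longrightarrow> Y s = c"
    using has_derivative_zero_constant[of "{0..\<delta>}" Y] by auto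
  then have "Y \<delta> = Y 0" using \<delta> by simp
  moreover have "Y \<delta> = act k (y \<delta>)" using ext_0[OF z] by (simp add: Y_def z_def)
  moreover have "Y 0 = act k' (y 0)"
  proof -
    have "act (conv (expker \<alpha> N (complex_of_real \<delta>)) k) (y 0) = act k' (y 0)"
    proof (rule act_cong_fourier)
      fix \<xi>
      show "fourier (conv (expker \<alpha> N (complex_of_real \<delta>)) k) \<xi> = fourier k' \<xi>"
        using supp[of \<xi>] fourier_plateau_eq_1[where \<xi>=\<xi> and N=N]
        by (cases "\<exists>l. \<bar>\<xi> $ l\<bar> > real N") (auto simp: fourier_conv integrable_expker k k' fourier_expker)
    qed (auto simp: integrable_conv integrable_expker k k')
    then show ?thesis by (simp add: Y_def ext_def z_def act_conv integrable_expker k)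
  qed
  ultimately show ?thesis by simp
qed

section \<open>Membership in the domain of the functional calculus\<close>

text \<open>The hypothesis \<open>xz\<close> says, after every smoothing, that \<open>z\<close> is
  the value of the functional calculus at \<open>x\<close>. The approximants are \<open>x\<close>
  smoothed by Fejer kernels; continuity of both orbits is what lets smoothing converge at
  \<open>x\<close> and at \<open>z\<close>.\<close>

lemma fc_approximation:
  assumes x: "continuous_on UNIV (\<lambda>s. T s x)" and z: "continuous_on UNIV (\<lambda>s. T s z)"
    and xz: "\<And>k k' N. integrable lborel k \<Longrightarrow> (\<And>\<xi>. \<exists>l. \<bar>\<xi> $ l\<bar> > real N \<Longrightarrow> fourier k \<xi> = 0) \<Longrightarrow>
      integrable lborel k' \<Longrightarrow> (\<And>\<xi>. fourier k' \<xi> = exp_fun \<beta> \<xi> * fourier k \<xi>) \<Longrightarrow> act k z = act k' x"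
  obtains X g where "\<And>n. compact (spec (X n))"
    "\<And>n. \<exists>\<phi>. integrable lborel \<phi> \<and> compact (closure {\<xi>. fourier \<phi> \<xi> \<noteq> 0}) \<and>
        (\<exists>U. open U \<and> spec (X n) \<subseteq> U \<and> (\<forall>\<xi>\<in>U. fourier \<phi> \<xi> = 1)) \<and>
        integrable lborel (g n) \<and> (\<forall>\<xi>. fourier (g n) \<xi> = exp_fun \<beta> \<xi> * fourier \<phi> \<xi>)"
    "X \<longlonglongrightarrow> x" "(\<lambda>n. act (g n) (X n)) \<longlonglongrightarrow> z"
proof -
  define k where "k n = (ker (real (Suc n)) 0 :: real^'d \<Rightarrow> complex)" for n
  have k: "integrable lborel (k n)" for n unfolding k_def by (rule integrable_ker) simp
  have ks: "fourier (k n) \<xi> = 0" if "\<exists>l. \<bar>\<xi> $ l\<bar> > real (Suc n)" for n \<xi>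
    unfolding k_def using that fourier_ker_0[where c=0 and \<xi>=\<xi> and r="real (Suc n)"] by (auto intro: less_imp_le)
  have box: "{\<xi>::real^'d. \<forall>l. \<bar>\<xi> $ l\<bar> \<le> r} = cbox (\<chi> l. - r) (\<chi> l. r)" for r
    by (auto simp: mem_box_cart abs_le_iff) (metis minus_le_iff)+
  \<comment> \<open>The spectrum of \<open>act (k n) x\<close> lies in the closed cube of half-side
    \<open>Suc n\<close>. One unit more gives an open cube around it on which the cutoff is still
    one.\<close>
  define g where "g n = expker \<beta> (Suc (Suc n)) 1" for n
  have g: "integrable lborel (g n)" for n unfolding g_def by (rule integrable_expker)
  have fg: "fourier (g n) \<xi> = exp_fun \<beta> \<xi> * fourier (pl (Suc (Suc n))) \<xi>" for n \<xi>
    by (simp add: g_def fourier_expker exp_fun_def exp_of_real)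
  have sp: "spec (act (k n) x) \<subseteq> {\<xi>. \<forall>l. \<bar>\<xi> $ l\<bar> \<le> real (Suc n)}" for n
    by (rule spec_act_subset[OF k ks])
  show ?thesis
  proof (rule that[of "\<lambda>n. act (k n) x" g])
    fix n
    show "compact (spec (act (k n) x))"
      using compact_Int_closed[OF compact_cbox closed_spec] sp[of n] unfolding box
      by (metis Int_absorb1)
    show "\<exists>\<phi>. integrable lborel \<phi> \<and> compact (closure {\<xi>. fourier \<phi> \<xi> \<noteq> 0}) \<and>
        (\<exists>U. open U \<and> spec (act (k n) x) \<subseteq> U \<and> (\<forall>\<xi>\<in>U. fourier \<phi> \<xi> = 1)) \<and>
        integrable lborel (g n) \<and> (\<forall>\<xi>. fourier (g n) \<xi> = exp_fun \<beta> \<xi> * fourier \<phi> \<xi>)"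
    proof (intro exI[of _ "pl (Suc (Suc n))"] conjI allI)
      have "{\<xi>. fourier (pl (Suc (Suc n))) \<xi> \<noteq> 0} \<subseteq> {\<xi>. \<forall>l. \<bar>\<xi> $ l\<bar> \<le> real (Suc (Suc n) + 1)}"
        using fourier_plateau_support[where N="Suc (Suc n)"] not_less by blast
      then have "bounded {\<xi>. fourier (pl (Suc (Suc n))) \<xi> \<noteq> 0}"
        unfolding box using bounded_cbox bounded_subset by blast
      then show "compact (closure {\<xi>. fourier (pl (Suc (Suc n))) \<xi> \<noteq> 0})" by (simp add: compact_closure)
      let ?U = "{\<xi>::real^'d. \<forall>l. \<bar>\<xi> $ l\<bar> < real (Suc (Suc n))}"
      show "\<exists>U. open U \<and> spec (act (k n) x) \<subseteq> U \<and> (\<forall>\<xi>\<in>U. fourier (pl (Suc (Suc n))) \<xi> = 1)"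
      proof (intro exI[of _ ?U] conjI ballI)
        show "open ?U"
          unfolding Collect_all_eq by (intro open_INT ballI open_Collect_less continuous_intros) auto
        show "spec (act (k n) x) \<subseteq> ?U"
        proof
          fix \<xi> assume "\<xi> \<in> spec (act (k n) x)"
          then have "\<bar>\<xi> $ l\<bar> \<le> real (Suc n)" for l using sp[of n] by auto
          then have "\<bar>\<xi> $ l\<bar> < real (Suc (Suc n))" for l by (rule le_less_trans) simp
          then show "\<xi> \<in> ?U" by simp
        qed
        show "fourier (pl (Suc (Suc n))) \<xi> = 1" if "\<xi> \<in> ?U" for \<xi>
          using that by (intro fourier_plateau_eq_1) (auto simp: not_less intro: less_imp_le)
      qed
    qed (rule integrable_pl g fg)+
  next
    show "(\<lambda>n. act (k n) x) \<longlonglongrightarrow> x" unfolding k_def using x by (rule tendsto_act_ker)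
    have "act (g n) (act (k n) x) = act (k n) z" for n
    proof -
      have "fourier (conv (g n) (k n)) \<xi> = exp_fun \<beta> \<xi> * fourier (k n) \<xi>" for \<xi>
      proof (cases "\<exists>l. \<bar>\<xi> $ l\<bar> > real (Suc n)")
        case False
        then have "fourier (pl (Suc (Suc n))) \<xi> = 1" by (intro fourier_plateau_eq_1) (metis less_trans of_nat_less_iff lessI)
        then show ?thesis by (simp add: fourier_conv g k fg)
      qed (simp add: fourier_conv g k ks)
      from xz[OF k ks integrable_conv[OF g k] this] have "act (k n) z = act (conv (g n) (k n)) x" .
      then show ?thesis by (simp add: act_conv g k)
    qed
    then show "(\<lambda>n. act (g n) (act (k n) x)) \<longlonglongrightarrow> z"
      unfolding k_def using tendsto_act_ker[OF z] by simp
  qed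
qed

text \<open>Here the spectral condition in \<open>fc_graph\<close> is traded for invariance:
  \<open>act_eq_self\<close> gives \<open>act \<phi> x = x\<close>, and the compact support of the
  transform of \<phi> provides a cube.\<close>

lemma band_of_graph:
  assumes \<phi>: "integrable lborel \<phi>" "compact (closure {\<xi>. fourier \<phi> \<xi> \<noteq> 0})"
    and U: "open U" "spec x \<subseteq> U" "\<And>\<xi>. \<xi> \<in> U \<Longrightarrow> fourier \<phi> \<xi> = 1"
    and g: "integrable lborel g" "\<And>\<xi>. fourier g \<xi> = exp_fun \<alpha> \<xi> * fourier \<phi> \<xi>"
  obtains N where "\<And>M. M \<ge> N \<Longrightarrow> band M x" "\<And>M. M \<ge> N \<Longrightarrow> ext \<alpha> M 1 x = act g x"
proof -
  have x: "act \<phi> x = x" using \<phi>(1) U by (rule act_eq_self)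
  obtain b where b: "\<And>\<xi>. fourier \<phi> \<xi> \<noteq> 0 \<Longrightarrow> norm \<xi> \<le> b"
    using bounded_subset[OF compact_imp_bounded[OF \<phi>(2)] closure_subset] by (auto simp: bounded_iff)
  obtain N :: nat where N: "b \<le> real N" using real_arch_simple by blast
  have band: "band M x" if "M \<ge> N" for M
  proof -
    have "fourier \<phi> \<xi> = 0" if l: "\<exists>l. \<bar>\<xi> $ l\<bar> > real M" for \<xi>
    proof (rule ccontr)
      assume "fourier \<phi> \<xi> \<noteq> 0"
      then have "norm \<xi> \<le> real M" using b N \<open>M \<ge> N\<close> by (meson of_nat_mono order_trans)
      then show False using l component_le_norm_cart[of \<xi>] by (meson not_less order_trans)
    qed
    then show ?thesis using band_act_kernel[OF \<phi>(1), of M x] x by simp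
  qed
  have "ext \<alpha> M 1 x = act g x" if "M \<ge> N" for M
    using band[OF that] g(1) _ \<phi>(1) x by (rule ext_eq_act) (simp add: g exp_fun_def exp_of_real)
  with band show ?thesis by (rule that)
qed

end

section \<open>Operators and their inverses\<close>

lemma cblin_bounded_linear: "A \<in> cblin \<Longrightarrow> bounded_linear A"
  and cblin_scaleC: "A \<in> cblin \<Longrightarrow> A (c *\<^sub>C v) = c *\<^sub>C A v"
  by (auto simp: cblin_def)

lemma cblin_zero: "(\<lambda>_. 0) \<in> cblin"
  by (simp add: cblin_def scaleC_zero_right)

lemma cblin_add: "A \<in> cblin \<Longrightarrow> B \<in> cblin \<Longrightarrow> (\<lambda>v. A v + B v) \<in> cblin"
  by (simp add: cblin_def bounded_linear_add scaleC_add_right)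

lemma cblin_minus: "A \<in> cblin \<Longrightarrow> (\<lambda>v. - A v) \<in> cblin"
  by (simp add: cblin_def bounded_linear_minus scaleC_minus_right)

lemma cblin_diff: "A \<in> cblin \<Longrightarrow> B \<in> cblin \<Longrightarrow> (\<lambda>v. A v - B v) \<in> cblin"
  by (simp add: cblin_def bounded_linear_sub scaleC_diff_right)

lemma onorm_scaleC: "bounded_linear A \<Longrightarrow> onorm (\<lambda>v. c *\<^sub>C A v) = norm c * onorm A"
  using onorm_scaleR[of A "norm c"] by (simp add: onorm_def norm_scaleC)

lemma cblin_scaleC_fun: "A \<in> cblin \<Longrightarrow> (\<lambda>v. c *\<^sub>C A v) \<in> cblin"
proof -
  assume A: "A \<in> cblin"
  have "bounded_linear (\<lambda>v. c *\<^sub>C v)"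
    by (rule bounded_linear_intro[where K="norm c"])
       (simp_all add: scaleC_add_right norm_scaleC scaleC_scaleC mult.commute flip: scaleC_of_real)
  from bounded_linear_compose[OF this cblin_bounded_linear[OF A]] show ?thesis
    using A by (simp add: cblin_def scaleC_scaleC mult.commute)
qed

lemma cblin_comp: "A \<in> cblin \<Longrightarrow> B \<in> cblin \<Longrightarrow> (\<lambda>v. B (A v)) \<in> cblin"
  by (simp add: cblin_def bounded_linear_compose)

text \<open>The set \<open>cblin\<close> as a type, so that the operator norm makes it an instance
  of the classes required by \<open>l1_banach_module\<close>.\<close>

typedef (overloaded) ('u, 'v) cop = "cblin :: ('u::complex_normed_vector \<Rightarrow> 'v::complex_normed_vector) set"
  morphisms cop_apply Cop
  using cblin_zero by blast

lemma cop_eqI: "(\<And>v. cop_apply X v = cop_apply Y v) \<Longrightarrow> X = Y"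
  by (metis cop_apply_inject ext)

instantiation cop :: (complex_normed_vector, complex_normed_vector) complex_normed_vector
begin

definition zero_cop where "0 = Cop (\<lambda>_. 0)"
definition plus_cop where "X + Y = Cop (\<lambda>v. cop_apply X v + cop_apply Y v)"
definition minus_cop where "X - Y = Cop (\<lambda>v. cop_apply X v - cop_apply Y v)"
definition uminus_cop where "- X = Cop (\<lambda>v. - cop_apply X v)"
definition scaleC_cop where "c *\<^sub>C X = Cop (\<lambda>v. c *\<^sub>C cop_apply X v)"
definition scaleR_cop where "r *\<^sub>R X = Cop (\<lambda>v. complex_of_real r *\<^sub>C cop_apply X v)" for X :: "('a, 'b) cop"
definition norm_cop where "norm X = onorm (cop_apply X)"
definition dist_cop where "dist X Y = norm (X - Y :: ('a, 'b) cop)"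
definition sgn_cop where "sgn X = inverse (norm X) *\<^sub>R (X :: ('a, 'b) cop)"
definition uniformity_cop where "(uniformity :: (('a, 'b) cop \<times> ('a, 'b) cop) filter) = (INF e\<in>{0 <..}. principal {(x, y). dist x y < e})"
definition open_cop where "open S = (\<forall>x\<in>S. \<forall>\<^sub>F (x', y) in uniformity. x' = x \<longrightarrow> y \<in> S)" for S :: "('a, 'b) cop set"

lemma cop_apply_zero: "cop_apply (0 :: ('a, 'b) cop) = (\<lambda>_. 0)"
  by (simp add: zero_cop_def Cop_inverse cblin_zero)
lemma cop_apply_plus: "cop_apply (X + Y :: ('a, 'b) cop) = (\<lambda>v. cop_apply X v + cop_apply Y v)"
  by (simp add: plus_cop_def Cop_inverse cblin_add cop_apply)
lemma cop_apply_minus: "cop_apply (X - Y :: ('a, 'b) cop) = (\<lambda>v. cop_apply X v - cop_apply Y v)"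
  by (simp add: minus_cop_def Cop_inverse cblin_diff cop_apply)
lemma cop_apply_uminus: "cop_apply (- X :: ('a, 'b) cop) = (\<lambda>v. - cop_apply X v)"
  by (simp add: uminus_cop_def Cop_inverse cblin_minus cop_apply)
lemma cop_apply_scaleC: "cop_apply (c *\<^sub>C X :: ('a, 'b) cop) = (\<lambda>v. c *\<^sub>C cop_apply X v)"
  by (simp add: scaleC_cop_def Cop_inverse cblin_scaleC_fun cop_apply)
lemma cop_apply_scaleR: "cop_apply (r *\<^sub>R X :: ('a, 'b) cop) = (\<lambda>v. r *\<^sub>R cop_apply X v)"
  unfolding scaleR_cop_def by (subst Cop_inverse[OF cblin_scaleC_fun[OF cop_apply]]) (simp add: scaleC_of_real)

lemmas cop_apply_simps = cop_apply_zero cop_apply_plus cop_apply_minus cop_apply_uminus cop_apply_scaleC cop_apply_scaleR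

instance
proof
  fix X Y Z :: "('a, 'b) cop" and r s :: real and c d :: complex
  have bl: "bounded_linear (cop_apply X)" for X :: "('a, 'b) cop" by (rule cblin_bounded_linear[OF cop_apply])
  show "dist X Y = norm (X - Y)" by (rule dist_cop_def)
  show "sgn X = inverse (norm X) *\<^sub>R X" by (rule sgn_cop_def)
  show "(uniformity :: (('a, 'b) cop \<times> ('a, 'b) cop) filter) = (INF e\<in>{0 <..}. principal {(x, y). dist x y < e})"
    by (rule uniformity_cop_def)
  show "open U = (\<forall>x\<in>U. \<forall>\<^sub>F (x', y) in uniformity. x' = x \<longrightarrow> y \<in> U)" for U :: "('a, 'b) cop set"
    by (rule open_cop_def)
  show "norm X = 0 \<longleftrightarrow> X = 0"
    unfolding norm_cop_def onorm_eq_0[OF bl] by (auto simp: cop_apply_zero intro: cop_eqI)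
  show "norm (X + Y) \<le> norm X + norm Y"
    unfolding norm_cop_def cop_apply_plus by (rule onorm_triangle[OF bl bl])
  show "norm (r *\<^sub>R X) = \<bar>r\<bar> * norm X"
    unfolding norm_cop_def cop_apply_scaleR by (rule onorm_scaleR[OF bl])
  show "norm (c *\<^sub>C X) = norm c * norm X"
    unfolding norm_cop_def cop_apply_scaleC by (rule onorm_scaleC[OF bl])
qed (auto intro!: cop_eqI simp: cop_apply_simps algebra_simps scaleC_add_right scaleC_add_left scaleC_scaleC scaleC_one scaleC_of_real)

end

lemma norm_cop_apply_le: "norm (cop_apply X v) \<le> norm X * norm v"
  unfolding norm_cop_def by (rule onorm[OF cblin_bounded_linear[OF cop_apply]])

lemma norm_cop_le: "0 \<le> b \<Longrightarrow> (\<And>v. norm (cop_apply X v) \<le> b * norm v) \<Longrightarrow> norm X \<le> b"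
  unfolding norm_cop_def by (rule onorm_bound)

text \<open>Completeness is inherited from the bounded real-linear maps: the inclusion is isometric,
  and complex homogeneity survives pointwise limits.\<close>

instance cop :: (complex_normed_vector, "{complex_normed_vector,banach}") banach
proof
  fix X :: "nat \<Rightarrow> ('a, 'b) cop" assume X: "Cauchy X"
  have bl: "bounded_linear (cop_apply X)" for X :: "('a, 'b) cop" by (rule cblin_bounded_linear[OF cop_apply])
  define Z where "Z n = Blinfun (cop_apply (X n))" for n
  have Za: "blinfun_apply (Z n) = cop_apply (X n)" for n
    unfolding Z_def by (rule bounded_linear_Blinfun_apply[OF bl])
  have nZ: "norm (Z m - Z n) = norm (X m - X n)" for m n
    by (simp add: norm_blinfun.rep_eq norm_cop_def cop_apply_minus minus_blinfun.rep_eq Za)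
  have "Cauchy Z" using X unfolding Cauchy_iff nZ .
  then obtain L where L: "Z \<longlonglongrightarrow> L" by (auto simp: Cauchy_convergent_iff convergent_def)
  have pw: "(\<lambda>n. cop_apply (X n) v) \<longlonglongrightarrow> blinfun_apply L v" for v
    using bounded_linear.tendsto[OF blinfun.bounded_linear_left L, of v] by (simp add: Za)
  have "blinfun_apply L (c *\<^sub>C v) = c *\<^sub>C blinfun_apply L v" for c v
  proof -
    have "norm (c *\<^sub>C cop_apply (X n) v - c *\<^sub>C blinfun_apply L v) \<le> norm c * norm (cop_apply (X n) v - blinfun_apply L v)" for n
      by (simp add: norm_scaleC flip: scaleC_diff_right)
    moreover have "(\<lambda>n. norm c * norm (cop_apply (X n) v - blinfun_apply L v)) \<longlonglongrightarrow> 0"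
      using pw[of v] by (intro tendsto_mult_right_zero tendsto_norm_zero LIM_zero)
    ultimately have "(\<lambda>n. c *\<^sub>C cop_apply (X n) v) \<longlonglongrightarrow> c *\<^sub>C blinfun_apply L v" by (rule tendsto_norm_diff_bound)
    then show ?thesis using pw[of "c *\<^sub>C v"] by (simp add: cblin_scaleC[OF cop_apply] LIMSEQ_unique)
  qed
  then have "blinfun_apply L \<in> cblin" by (simp add: cblin_def blinfun.bounded_linear_right)
  then have La: "cop_apply (Cop (blinfun_apply L)) = blinfun_apply L" by (rule Cop_inverse)
  have "norm (X n - Cop (blinfun_apply L)) \<le> norm (Z n - L)" for n
    by (simp add: norm_blinfun.rep_eq norm_cop_def cop_apply_minus minus_blinfun.rep_eq Za La)
  moreover have "(\<lambda>n. norm (Z n - L)) \<longlonglongrightarrow> 0" using L by (intro tendsto_norm_zero LIM_zero)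
  ultimately have "X \<longlonglongrightarrow> Cop (blinfun_apply L)" by (rule tendsto_norm_diff_bound)
  then show "convergent X" by (auto simp: convergent_def)
qed

text \<open>Every product in the inversion argument has this shape, an operator between two
  inverses, so all its formulas stay within one operator space.\<close>

definition comp3 :: "('y::complex_normed_vector, 'x::complex_normed_vector) cop \<Rightarrow> ('x, 'y) cop \<Rightarrow> ('y, 'x) cop \<Rightarrow> ('y, 'x) cop" where
  "comp3 R W S = Cop (\<lambda>v. cop_apply R (cop_apply W (cop_apply S v)))"

lemma cop_apply_comp3: "cop_apply (comp3 R W S) v = cop_apply R (cop_apply W (cop_apply S v))"
  unfolding comp3_def
  by (subst Cop_inverse[OF cblin_comp[OF cblin_comp[OF cop_apply cop_apply] cop_apply]]) (rule refl)

lemma linear_cop_apply: "linear (cop_apply X)"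
  using cblin_bounded_linear[OF cop_apply] bounded_linear.linear by blast

lemmas cop_linear = linear_add[OF linear_cop_apply] linear_diff[OF linear_cop_apply] linear_0[OF linear_cop_apply]
  linear_neg[OF linear_cop_apply] cblin_scaleC[OF cop_apply]

lemma norm_comp3_le: "norm (comp3 R W S) \<le> norm R * norm W * norm S"
proof (rule norm_cop_le)
  fix v
  have "norm (cop_apply R (cop_apply W (cop_apply S v))) \<le> norm R * (norm W * (norm S * norm v))"
    by (meson norm_cop_apply_le mult_left_mono norm_ge_zero order_trans)
  then show "norm (cop_apply (comp3 R W S) v) \<le> norm R * norm W * norm S * norm v"
    by (simp add: cop_apply_comp3 mult.assoc)
qed simp

section \<open>Inverse pairs and their perturbation\<close>

definition inverse_pair :: "('x::complex_normed_vector, 'y::complex_normed_vector) cop \<Rightarrow> ('y, 'x) cop \<Rightarrow> bool" where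
  "inverse_pair X R \<longleftrightarrow> mutually_inverse (cop_apply X) (cop_apply R)"

lemma inverse_pairD:
  assumes "inverse_pair X R"
  shows "cop_apply R (cop_apply X v) = v" "cop_apply X (cop_apply R w) = w"
  using assms by (auto simp: inverse_pair_def mutually_inverse_def fun_eq_iff)

lemma resolvent_identity:
  assumes "inverse_pair X R" "inverse_pair X' R'"
  shows "R' - R = - comp3 R' (X' - X) R"
  using inverse_pairD[OF assms(1)] inverse_pairD[OF assms(2)]
  by (intro cop_eqI) (simp add: cop_apply_simps cop_apply_comp3 cop_linear)

lemma norm_inverse_diff_le:
  assumes "inverse_pair X R" "inverse_pair X' R'"
  shows "norm (R' - R) \<le> norm R' * norm (X' - X) * norm R"
  using norm_comp3_le[of R' "X' - X" R] by (simp add: resolvent_identity[OF assms])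

text \<open>First-order Taylor formula for inversion, \<open>D\<close> being the linear part of
  \<open>X' - X\<close>. The term with \<open>M\<^sup>2\<close> comes from the remainder of
  \<open>X'\<close>; the one with \<open>M ^ 3\<close> comes from replacing \<open>R'\<close> by
  \<open>R\<close> in front of \<open>D\<close>, where the difference is itself of order
  \<open>e\<close>.\<close>

lemma inverse_expansion:
  assumes X: "inverse_pair X R" "inverse_pair X' R'" and M: "norm R \<le> M" "norm R' \<le> M"
    and K: "norm (X' - X - D) \<le> K1 * e\<^sup>2" "norm D \<le> K2 * e" and e: "0 \<le> e" "e \<le> 1" and K0: "0 \<le> K1" "0 \<le> K2"
  shows "norm (R' - R + comp3 R D R) \<le> (M\<^sup>2 * K1 + M ^ 3 * (K1 + K2) * K2) * e\<^sup>2"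
proof -
  have M0: "0 \<le> M" using M(1) norm_ge_zero order_trans by blast
  have eq: "R' - R + comp3 R D R = - comp3 R' (X' - X - D) R - comp3 (R' - R) D R"
    using inverse_pairD[OF X(1)] inverse_pairD[OF X(2)]
    by (intro cop_eqI) (simp add: cop_apply_simps cop_apply_comp3 cop_linear)
  have "norm (comp3 R' (X' - X - D) R) \<le> M * (K1 * e\<^sup>2) * M"
    using M K M0 K0 by (intro order_trans[OF norm_comp3_le] mult_mono) auto
  moreover have "norm (R' - R) \<le> M * ((K1 + K2) * e) * M"
  proof -
    have "norm (X' - X) \<le> norm (X' - X - D) + norm D" by norm
    also have "\<dots> \<le> K1 * e\<^sup>2 + K2 * e" using K by simp
    also have "K1 * e\<^sup>2 \<le> K1 * e" using e K0 by (intro mult_left_mono) (auto simp: power2_eq_square mult_left_le)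
    finally have "norm (X' - X) \<le> (K1 + K2) * e" by (simp add: algebra_simps)
    then show ?thesis
      using M M0 K0 e by (intro order_trans[OF norm_inverse_diff_le[OF X]] mult_mono) auto
  qed
  then have "norm (comp3 (R' - R) D R) \<le> M * ((K1 + K2) * e) * M * (K2 * e) * M"
    using M K M0 e K0 by (intro order_trans[OF norm_comp3_le] mult_mono) auto
  ultimately have "norm (R' - R + comp3 R D R) \<le> M * (K1 * e\<^sup>2) * M + M * ((K1 + K2) * e) * M * (K2 * e) * M"
    unfolding eq using norm_triangle_ineq4[of "- comp3 R' (X' - X - D) R" "comp3 (R' - R) D R"] by simp
  then show ?thesis by (simp add: power2_eq_square power3_eq_cube algebra_simps)
qed

text \<open>The Neumann series in the form of two fixed point equations with contraction constant
  1/2. The fixed point \<open>R\<close> is a right inverse and \<open>S\<close> a left inverse, so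
  they coincide; the fixed point equation also yields the bound \<open>2 * norm B\<close>, uniform
  over all such \<open>X\<close>.\<close>

lemma ex_inverse_near:
  fixes A :: "('x::{complex_normed_vector,banach}, 'y::{complex_normed_vector,banach}) cop"
  assumes AB: "inverse_pair A B" and near: "norm B * norm (X - A) \<le> 1 / 2"
  shows "\<exists>R. inverse_pair X R \<and> norm R \<le> 2 * norm B"
proof -
  have near': "norm B * norm (A - X) \<le> 1 / 2" using near by (simp add: norm_minus_commute)
  have "\<exists>!R. B + comp3 B (A - X) R = R"
  proof (rule banach_fix_type[where c="1/2"], simp, simp, intro allI)
    fix R S :: "('y, 'x) cop"
    have "(B + comp3 B (A - X) R) - (B + comp3 B (A - X) S) = comp3 B (A - X) (R - S)"
      by (intro cop_eqI) (simp add: cop_apply_simps cop_apply_comp3 cop_linear)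
    then show "dist (B + comp3 B (A - X) R) (B + comp3 B (A - X) S) \<le> 1 / 2 * dist R S"
      using norm_comp3_le[of B "A - X" "R - S"] mult_right_mono[OF near', of "norm (R - S)"] by (simp add: dist_norm)
  qed
  then obtain R where R: "B + comp3 B (A - X) R = R" by blast
  have "\<exists>!R. B + comp3 R (A - X) B = R"
  proof (rule banach_fix_type[where c="1/2"], simp, simp, intro allI)
    fix R S :: "('y, 'x) cop"
    have "(B + comp3 R (A - X) B) - (B + comp3 S (A - X) B) = comp3 (R - S) (A - X) B"
      by (intro cop_eqI) (simp add: cop_apply_simps cop_apply_comp3 cop_linear)
    then show "dist (B + comp3 R (A - X) B) (B + comp3 S (A - X) B) \<le> 1 / 2 * dist R S"
      using norm_comp3_le[of "R - S" "A - X" B] mult_right_mono[OF near', of "norm (R - S)"]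
      by (simp add: dist_norm mult_ac)
  qed
  then obtain S where S: "B + comp3 S (A - X) B = S" by blast
  have XR: "cop_apply X (cop_apply R v) = v" for v
  proof -
    have "cop_apply A (cop_apply R v) = cop_apply A (cop_apply (B + comp3 B (A - X) R) v)" using R by simp
    also have "\<dots> = v + (cop_apply A (cop_apply R v) - cop_apply X (cop_apply R v))"
      by (simp add: cop_apply_simps cop_apply_comp3 cop_linear inverse_pairD[OF AB])
    finally show ?thesis by simp
  qed
  have SX: "cop_apply S (cop_apply X v) = v" for v
  proof -
    have "cop_apply S (cop_apply A v) = cop_apply (B + comp3 S (A - X) B) (cop_apply A v)" using S by simp
    also have "\<dots> = v + (cop_apply S (cop_apply A v) - cop_apply S (cop_apply X v))"
      by (simp add: cop_apply_simps cop_apply_comp3 cop_linear inverse_pairD[OF AB])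
    finally show ?thesis by simp
  qed
  have "S = R" using SX[of "cop_apply R _"] XR by (intro cop_eqI) simp
  then have "inverse_pair X R" using XR SX by (auto simp: inverse_pair_def mutually_inverse_def fun_eq_iff)
  moreover have "norm R \<le> norm B + 1 / 2 * norm R"
    using norm_triangle_ineq[of B "comp3 B (A - X) R"] norm_comp3_le[of B "A - X" R]
      mult_right_mono[OF near', of "norm R"] by (simp add: R)
  ultimately show ?thesis by (intro exI[of _ R]) auto
qed

section \<open>From module structures on operator functions to the Banach module locale\<close>

lemma Cop_simps:
  assumes "A \<in> cblin" "B \<in> cblin"
  shows "Cop A + Cop B = Cop (\<lambda>v. A v + B v)" "Cop A - Cop B = Cop (\<lambda>v. A v - B v)" "c *\<^sub>C Cop A = Cop (\<lambda>v. c *\<^sub>C A v)"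
    "norm (Cop A) = onorm A"
  using assms by (simp_all add: plus_cop_def minus_cop_def scaleC_cop_def norm_cop_def Cop_inverse)

lemma Cop_eq_0_iff: "A \<in> cblin \<Longrightarrow> Cop A = 0 \<longleftrightarrow> A = (\<lambda>_. 0)"
  unfolding zero_cop_def by (simp add: Cop_inject cblin_zero)

lemma l1_banach_module_cop:
  fixes T :: "real^'d \<Rightarrow> ('u::complex_normed_vector \<Rightarrow> 'v::{complex_normed_vector,banach}) \<Rightarrow> ('u \<Rightarrow> 'v)"
  assumes "L1_module T act"
  shows "l1_banach_module (\<lambda>t X. Cop (T t (cop_apply X))) (\<lambda>f X. Cop (act f (cop_apply X)))"
proof -
  note L = assms[unfolded L1_module_def]
  have T1: "T t A \<in> cblin" if "A \<in> cblin" for t A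
    using that by (rule L[THEN conjunct1, rule_format])
  have T2: "T t (\<lambda>v. A v + B v) = (\<lambda>v. T t A v + T t B v)" if "A \<in> cblin" "B \<in> cblin" for t A B
    using that by (rule L[THEN conjunct2, THEN conjunct1, rule_format])
  have T3: "T t (\<lambda>v. c *\<^sub>C A v) = (\<lambda>v. c *\<^sub>C T t A v)" if "A \<in> cblin" for t c A
    using that by (rule L[THEN conjunct2, THEN conjunct2, THEN conjunct1, rule_format])
  have T4: "onorm (T t A) = onorm A" if "A \<in> cblin" for t A
    using that by (rule L[THEN conjunct2, THEN conjunct2, THEN conjunct2, THEN conjunct1, rule_format])
  have T5: "T 0 A = A" if "A \<in> cblin" for A
    using that by (rule L[THEN conjunct2, THEN conjunct2, THEN conjunct2, THEN conjunct2, THEN conjunct1, rule_format])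
  have T6: "T (s + t) A = T s (T t A)" if "A \<in> cblin" for s t A
    using that by (rule L[THEN conjunct2, THEN conjunct2, THEN conjunct2, THEN conjunct2, THEN conjunct2, THEN conjunct1, rule_format])
  have A1: "act f A \<in> cblin" if "integrable lborel f" "A \<in> cblin" for f A
    using that by (rule L[THEN conjunct2, THEN conjunct2, THEN conjunct2, THEN conjunct2, THEN conjunct2, THEN conjunct2, THEN conjunct1, rule_format])
  have A2: "act (\<lambda>s. f s + g s) A = (\<lambda>v. act f A v + act g A v)" if "integrable lborel f" "integrable lborel g" "A \<in> cblin" for f g A
    using that by (rule L[THEN conjunct2, THEN conjunct2, THEN conjunct2, THEN conjunct2, THEN conjunct2, THEN conjunct2, THEN conjunct2, THEN conjunct1, rule_format])
  have A3: "act (\<lambda>s. c * f s) A = (\<lambda>v. c *\<^sub>C act f A v)" if "integrable lborel f" "A \<in> cblin" for f c A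
    using that by (rule L[THEN conjunct2, THEN conjunct2, THEN conjunct2, THEN conjunct2, THEN conjunct2, THEN conjunct2, THEN conjunct2, THEN conjunct2, THEN conjunct1, rule_format])
  have A4: "act f (\<lambda>v. A v + B v) = (\<lambda>v. act f A v + act f B v)" if "integrable lborel f" "A \<in> cblin" "B \<in> cblin" for f A B
    using that by (rule L[THEN conjunct2, THEN conjunct2, THEN conjunct2, THEN conjunct2, THEN conjunct2, THEN conjunct2, THEN conjunct2, THEN conjunct2, THEN conjunct2, THEN conjunct1, rule_format])
  have A5: "act f (\<lambda>v. c *\<^sub>C A v) = (\<lambda>v. c *\<^sub>C act f A v)" if "integrable lborel f" "A \<in> cblin" for f c A
    using that by (rule L[THEN conjunct2, THEN conjunct2, THEN conjunct2, THEN conjunct2, THEN conjunct2, THEN conjunct2, THEN conjunct2, THEN conjunct2, THEN conjunct2, THEN conjunct2, THEN conjunct1, rule_format])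
  have A6: "act (conv f g) A = act f (act g A)" if "integrable lborel f" "integrable lborel g" "A \<in> cblin" for f g A
    using that by (rule L[THEN conjunct2, THEN conjunct2, THEN conjunct2, THEN conjunct2, THEN conjunct2, THEN conjunct2, THEN conjunct2, THEN conjunct2, THEN conjunct2, THEN conjunct2, THEN conjunct2, THEN conjunct1, rule_format])
  have A7: "onorm (act f A) \<le> L1norm f * onorm A" if "integrable lborel f" "A \<in> cblin" for f A
    using that by (rule L[THEN conjunct2, THEN conjunct2, THEN conjunct2, THEN conjunct2, THEN conjunct2, THEN conjunct2, THEN conjunct2, THEN conjunct2, THEN conjunct2, THEN conjunct2, THEN conjunct2, THEN conjunct2, THEN conjunct1, rule_format])
  have A8: "T t (act f A) = act (\<lambda>s. f (s + t)) A" if "integrable lborel f" "A \<in> cblin" for t f A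
    by (rule L[THEN conjunct2, THEN conjunct2, THEN conjunct2, THEN conjunct2, THEN conjunct2, THEN conjunct2, THEN conjunct2, THEN conjunct2, THEN conjunct2, THEN conjunct2, THEN conjunct2, THEN conjunct2, THEN conjunct2, THEN conjunct1, rule_format, OF that, THEN conjunct1])
  have A8': "T t (act f A) = act f (T t A)" if "integrable lborel f" "A \<in> cblin" for t f A
    by (rule L[THEN conjunct2, THEN conjunct2, THEN conjunct2, THEN conjunct2, THEN conjunct2, THEN conjunct2, THEN conjunct2, THEN conjunct2, THEN conjunct2, THEN conjunct2, THEN conjunct2, THEN conjunct2, THEN conjunct2, THEN conjunct1, rule_format, OF that, THEN conjunct2])
  have A9: "A = (\<lambda>_. 0)" if "A \<in> cblin" "\<And>f. integrable lborel f \<Longrightarrow> act f A = (\<lambda>_. 0)" for A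
    using L[THEN conjunct2, THEN conjunct2, THEN conjunct2, THEN conjunct2, THEN conjunct2, THEN conjunct2, THEN conjunct2, THEN conjunct2, THEN conjunct2, THEN conjunct2, THEN conjunct2, THEN conjunct2, THEN conjunct2, THEN conjunct2, rule_format] that by simp
  show ?thesis
  proof
    fix x :: "('u, 'v) cop" assume a: "\<And>f. integrable lborel f \<Longrightarrow> Cop (act f (cop_apply x)) = 0"
    have "cop_apply x = (\<lambda>_. 0)"
      using a Cop_eq_0_iff[OF A1[OF _ cop_apply]] by (intro A9[OF cop_apply]) blast
    then show "x = 0" by (intro cop_eqI) (simp add: cop_apply_zero)
  next
    fix f :: "real^'d \<Rightarrow> complex" and x :: "('u, 'v) cop" assume f: "integrable lborel f"
    show "norm (Cop (act f (cop_apply x))) \<le> L1norm f * norm x"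
      using A7[OF f cop_apply] A1[OF f cop_apply] by (simp add: norm_cop_def Cop_inverse)
  next
    fix t and x :: "('u, 'v) cop"
    show "norm (Cop (T t (cop_apply x))) = norm x" by (simp add: norm_cop_def Cop_inverse T1 T4 cop_apply)
    show "Cop (T 0 (cop_apply x)) = x" by (simp add: T5 cop_apply cop_apply_inverse)
  next
    fix t c and x :: "('u, 'v) cop"
    show "Cop (T t (cop_apply (c *\<^sub>C x))) = c *\<^sub>C Cop (T t (cop_apply x))"
      using Cop_simps(3)[OF T1[OF cop_apply] T1[OF cop_apply]] by (simp add: cop_apply_scaleC T3 cop_apply)
  next
    fix f :: "real^'d \<Rightarrow> complex" and c and x :: "('u, 'v) cop" assume f: "integrable lborel f"
    show "Cop (act (\<lambda>s. c * f s) (cop_apply x)) = c *\<^sub>C Cop (act f (cop_apply x))"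
      using Cop_simps(3)[OF A1[OF f cop_apply] A1[OF f cop_apply]] by (simp add: A3 f cop_apply)
    show "Cop (act f (cop_apply (c *\<^sub>C x))) = c *\<^sub>C Cop (act f (cop_apply x))"
      using Cop_simps(3)[OF A1[OF f cop_apply] A1[OF f cop_apply]] by (simp add: cop_apply_scaleC A5 f cop_apply)
    show "Cop (T t (cop_apply (Cop (act f (cop_apply x))))) = Cop (act f (cop_apply (Cop (T t (cop_apply x)))))" for t
      by (simp add: Cop_inverse T1 A1 f A8'[OF f cop_apply] cop_apply)
  qed (simp_all add: Cop_inverse Cop_simps T1 T2 T6 A1 A2 A4 A6 A8 cop_apply cop_apply_plus)
qed

lemma tendsto_onorm_opdiff_iff:
  assumes "\<And>n. X n \<in> cblin" "Y \<in> cblin"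
  shows "((\<lambda>n. onorm (opdiff (X n) Y)) \<longlongrightarrow> 0) F \<longleftrightarrow> ((\<lambda>n. Cop (X n)) \<longlongrightarrow> Cop Y) F"
proof -
  have "onorm (opdiff (X n) Y) = norm (Cop (X n) - Cop Y)" for n
    using assms by (simp add: opdiff_def Cop_simps cblin_diff)
  then show ?thesis using LIM_zero_iff[of "\<lambda>n. Cop (X n)" "Cop Y" F] by (simp add: tendsto_norm_zero_iff)
qed

section \<open>Coupled representations and the continuation of inverses\<close>

text \<open>The coupling is the only link between the two modules: it recognises
  \<open>T2 t R\<close> as the inverse of \<open>T1 t X\<close>.\<close>

locale coupled_modules =
  M1: l1_banach_module T1 act1 + M2: l1_banach_module T2 act2
  for T1 :: "real^'d \<Rightarrow> ('x::{complex_normed_vector,banach}, 'y::{complex_normed_vector,banach}) cop \<Rightarrow> ('x, 'y) cop"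
    and act1 :: "(real^'d \<Rightarrow> complex) \<Rightarrow> ('x, 'y) cop \<Rightarrow> ('x, 'y) cop"
    and T2 :: "real^'d \<Rightarrow> ('y, 'x) cop \<Rightarrow> ('y, 'x) cop"
    and act2 :: "(real^'d \<Rightarrow> complex) \<Rightarrow> ('y, 'x) cop \<Rightarrow> ('y, 'x) cop" +
  assumes coupled: "inverse_pair X R \<Longrightarrow> inverse_pair (T1 t X) (T2 t R)"
begin

text \<open>All inverses along the orbit have the norm of \<open>R\<close>, so the bound for
  differences of inverses transfers continuity. It is applied to \<open>b\<close> and to the inverse
  of the continued operator.\<close>

lemma continuous_orbit_inverse:
  assumes XR: "inverse_pair X R" and X: "continuous_on UNIV (\<lambda>s. T1 s X)"
  shows "continuous_on UNIV (\<lambda>s. T2 s R)"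
proof (rule continuous_at_imp_continuous_on, rule ballI)
  fix t
  have "((\<lambda>s. T1 s X) \<longlongrightarrow> T1 t X) (at t)"
    using X by (simp add: continuous_on_eq_continuous_at isCont_def)
  then have "((\<lambda>s. norm R * norm (T1 s X - T1 t X) * norm R) \<longlongrightarrow> 0) (at t)"
    by (intro tendsto_mult_left_zero tendsto_mult_right_zero tendsto_norm_zero LIM_zero)
  moreover have "norm (T2 s R - T2 t R) \<le> norm R * norm (T1 s X - T1 t X) * norm R" for s
    using norm_inverse_diff_le[OF coupled[OF XR, of t] coupled[OF XR, of s]] by (simp add: M2.norm_T)
  ultimately show "isCont (\<lambda>s. T2 s R) t"
    unfolding isCont_def by (intro tendsto_norm_diff_bound[of "\<lambda>s. T2 s R" "T2 t R"])
qed

text \<open>A single expansion of the inverse for complex increments supplies both hypotheses of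
  \<open>act_flow_eq\<close>: a real increment compares \<open>R u\<close> with \<open>R s\<close>,
  an imaginary one compares \<open>T2 (t *\<^sub>R \<alpha>) (R s)\<close> with \<open>R s\<close>.
  That the same \<open>W\<close> occurs in both is the Cauchy-Riemann equation.\<close>

lemma act_inverse_flow_eq:
  assumes \<delta>: "\<delta> \<ge> 0" and x: "M1.band N x"
    and R: "\<And>s. s \<in> {0..\<delta>} \<Longrightarrow> inverse_pair (M1.ext \<alpha> N (complex_of_real s) x) (R s)"
      "\<And>s. s \<in> {0..\<delta>} \<Longrightarrow> norm (R s) \<le> B"
    and k: "integrable lborel k" and supp: "\<And>\<xi>. \<exists>l. \<bar>\<xi> $ l\<bar> > real M \<Longrightarrow> fourier k \<xi> = 0"
    and k': "integrable lborel k'" "\<And>\<xi>. fourier k' \<xi> = exp (complex_of_real (\<delta> * (\<alpha> \<bullet> \<xi>))) * fourier k \<xi>"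
  shows "act2 k (R \<delta>) = act2 k' (R 0)"
proof -
  define E where "E s = M1.ext \<alpha> N (complex_of_real s) x" for s
  have bE: "M1.band N (E s)" for s unfolding E_def by (rule M1.band_ext[OF x])
  define G where "G s = M1.gen \<alpha> N (E s)" for s
  \<comment> \<open>The derivative of inversion at \<open>E s\<close> in the direction
    \<open>G s\<close>.\<close>
  define W where "W s = - comp3 (R s) (G s) (R s)" for s
  \<comment> \<open>The inverse at the displaced point is left arbitrary, so that it can be
    \<open>R u\<close> as well as an element of the group orbit of \<open>R s\<close>; only its
    bound \<open>B\<close> enters the constant.\<close>
  have expansion: "\<exists>K. \<forall>h X' R'. norm h \<le> 1 \<longrightarrow> inverse_pair X' R' \<longrightarrow> X' = M1.ext \<alpha> N h (E s) \<longrightarrow> norm R' \<le> B \<longrightarrow>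
      norm (R' - R s - h *\<^sub>C W s) \<le> K * (norm h)\<^sup>2" if s: "s \<in> {0..\<delta>}" for s
  proof -
    obtain K1 where K1: "K1 \<ge> 0" "\<And>h. norm h \<le> 1 \<Longrightarrow> norm (M1.ext \<alpha> N h (E s) - E s - h *\<^sub>C G s) \<le> K1 * norm h ^ 2"
      using M1.ext_taylor1[OF bE[of s], of \<alpha>] unfolding G_def by blast
    have "norm (R' - R s - h *\<^sub>C W s) \<le> (B\<^sup>2 * K1 + B ^ 3 * (K1 + norm (G s)) * norm (G s)) * (norm h)\<^sup>2"
      if h: "norm h \<le> 1" and X': "inverse_pair X' R'" "X' = M1.ext \<alpha> N h (E s)" "norm R' \<le> B" for h X' R'
    proof -
      have "comp3 (R s) (h *\<^sub>C G s) (R s) = h *\<^sub>C comp3 (R s) (G s) (R s)"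
        by (intro cop_eqI) (simp add: cop_apply_simps cop_apply_comp3 cop_linear)
      then have "R' - R s - h *\<^sub>C W s = R' - R s + comp3 (R s) (h *\<^sub>C G s) (R s)"
        by (simp add: W_def scaleC_minus_right)
      moreover have "norm (R' - R s + comp3 (R s) (h *\<^sub>C G s) (R s)) \<le> (B\<^sup>2 * K1 + B ^ 3 * (K1 + norm (G s)) * norm (G s)) * (norm h)\<^sup>2"
      proof (rule inverse_expansion)
        show "inverse_pair (E s) (R s)" unfolding E_def using s by (rule R)
        show "inverse_pair X' R'" by fact
        show "norm (X' - E s - h *\<^sub>C G s) \<le> K1 * (norm h)\<^sup>2" unfolding X'(2) using h by (rule K1)
        show "norm (h *\<^sub>C G s) \<le> norm (G s) * norm h" by (simp add: norm_scaleC)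
      qed (use h s R(2) X'(3) K1(1) in auto)
      ultimately show ?thesis by (simp only:)
    qed
    then show ?thesis by blast
  qed
  show ?thesis
  proof (rule M2.act_flow_eq[where W=W, OF \<delta> _ _ k supp k'])
    fix s assume s: "s \<in> {0..\<delta>}"
    obtain K where K: "\<And>h X' R'. norm h \<le> 1 \<Longrightarrow> inverse_pair X' R' \<Longrightarrow> X' = M1.ext \<alpha> N h (E s) \<Longrightarrow> norm R' \<le> B \<Longrightarrow>
      norm (R' - R s - h *\<^sub>C W s) \<le> K * (norm h)\<^sup>2" using expansion[OF s] by blast
    show "\<exists>K. \<forall>u\<in>{0..\<delta>}. \<bar>u - s\<bar> \<le> 1 \<longrightarrow> norm (R u - R s - (u - s) *\<^sub>R W s) \<le> K * (u - s)\<^sup>2"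
    proof (intro exI ballI impI)
      fix u assume u: "u \<in> {0..\<delta>}" "\<bar>u - s\<bar> \<le> 1"
      have h: "norm (complex_of_real (u - s)) = \<bar>u - s\<bar>" by (rule norm_of_real)
      have "M1.ext \<alpha> N (complex_of_real u) x = M1.ext \<alpha> N (complex_of_real (u - s)) (E s)"
        unfolding E_def using M1.ext_add[OF x, of \<alpha> "complex_of_real s" "complex_of_real (u - s)"] by simp
      then show "norm (R u - R s - (u - s) *\<^sub>R W s) \<le> K * (u - s)\<^sup>2"
        using K[of "complex_of_real (u - s)", OF _ R(1)[OF u(1)] _ R(2)[OF u(1)]] u(2)
        unfolding h scaleC_of_real by simp
    qed
    show "\<exists>K. \<forall>t. \<bar>t\<bar> \<le> 1 \<longrightarrow> norm (T2 (t *\<^sub>R \<alpha>) (R s) - R s - (\<i> * complex_of_real t) *\<^sub>C W s) \<le> K * t\<^sup>2"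
    proof (intro exI allI impI)
      fix t :: real assume t: "\<bar>t\<bar> \<le> 1"
      have "inverse_pair (T1 (t *\<^sub>R \<alpha>) (E s)) (T2 (t *\<^sub>R \<alpha>) (R s))"
        unfolding E_def by (rule coupled[OF R(1)[OF s]])
      from K[OF _ this M1.T_eq_ext[OF bE]] show "norm (T2 (t *\<^sub>R \<alpha>) (R s) - R s - (\<i> * complex_of_real t) *\<^sub>C W s) \<le> K * t\<^sup>2"
        using t R(2)[OF s] by (simp add: norm_mult M2.norm_T)
    qed
  qed
qed

text \<open>\<open>z\<close> is the inverse of the limit of the continuations at time \<delta>. Its
  relation to \<open>b\<close> is stated only after smoothing, which is the form that
  \<open>fc_approximation\<close> consumes.\<close>

lemma inverse_analytic:
  assumes ab: "inverse_pair a b" and a: "continuous_on UNIV (\<lambda>s. T1 s a)"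
    and band: "\<And>n M. M \<ge> N n \<Longrightarrow> M1.band M (x n)" and ext1: "\<And>n M. M \<ge> N n \<Longrightarrow> M1.ext \<alpha> M 1 (x n) = y n"
    and x: "x \<longlonglongrightarrow> a" and y: "y \<longlonglongrightarrow> c"
  obtains \<delta> z where "\<delta> > 0" "continuous_on UNIV (\<lambda>s. T2 s b)" "continuous_on UNIV (\<lambda>s. T2 s z)"
    "\<And>k k' M. integrable lborel k \<Longrightarrow> (\<And>\<xi>. \<exists>l. \<bar>\<xi> $ l\<bar> > real M \<Longrightarrow> fourier k \<xi> = 0) \<Longrightarrow>
      integrable lborel k' \<Longrightarrow> (\<And>\<xi>. fourier k' \<xi> = exp_fun (\<delta> *\<^sub>R \<alpha>) \<xi> * fourier k \<xi>) \<Longrightarrow> act2 k z = act2 k' b"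
proof -
  define E where "E n s = M1.ext \<alpha> (N n) (complex_of_real s) (x n)" for n s
  have E0: "E n 0 = x n" for n unfolding E_def using M1.ext_0[OF band[OF order_refl]] by simp
  have E_diff: "norm (E m s - E n s) \<le> max (norm (x m - x n)) (norm (y m - y n))" if "s \<in> {0..1}" for m n s
  proof -
    \<comment> \<open>The approximants have different cubes; a common one turns the difference of
      two extensions into the extension of a difference.\<close>
    let ?M = "max (N m) (N n)"
    have bM: "M1.band ?M (x m)" "M1.band ?M (x n)" by (auto intro: band)
    have "E m s - E n s = M1.ext \<alpha> ?M (complex_of_real s) (x m - x n)"
      unfolding E_def M1.ext_diff
      by (simp add: M1.ext_indep[OF band[OF order_refl] bM(1)] M1.ext_indep[OF band[OF order_refl] bM(2)])
    moreover have "M1.ext \<alpha> ?M 1 (x m - x n) = y m - y n"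
      unfolding M1.ext_diff by (simp add: ext1)
    ultimately show ?thesis using M1.norm_ext_le_max[OF M1.band_diff[OF bM] that, of \<alpha>] by simp
  qed
  \<comment> \<open>The radius within which \<open>ex_inverse_near\<close> applies around
    \<open>a\<close>; the added one excludes division by zero.\<close>
  define \<eta> where "\<eta> = 1 / (2 * (norm b + 1))"
  have b1: "norm b + 1 > 0" by (simp add: add_nonneg_pos)
  have \<eta>: "\<eta> > 0" "norm b * \<eta> \<le> 1 / 2" using b1 by (auto simp: \<eta>_def divide_le_eq)
  have "Cauchy x" "Cauchy y" using x y by (auto intro: LIMSEQ_imp_Cauchy)
  then have "\<exists>n1. \<forall>m\<ge>n1. \<forall>n\<ge>n1. norm (x m - x n) < \<epsilon>" "\<exists>n2. \<forall>m\<ge>n2. \<forall>n\<ge>n2. norm (y m - y n) < \<epsilon>" if "\<epsilon> > 0" for \<epsilon>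
    using that by (auto simp: Cauchy_iff)
  then have unif: "\<exists>n0. \<forall>m\<ge>n0. \<forall>n\<ge>n0. \<forall>s\<in>{0..1}. norm (E m s - E n s) < \<epsilon>" if \<epsilon>: "\<epsilon> > 0" for \<epsilon>
  proof -
    obtain n1 n2 where n: "\<And>m n. m \<ge> n1 \<Longrightarrow> n \<ge> n1 \<Longrightarrow> norm (x m - x n) < \<epsilon>" "\<And>m n. m \<ge> n2 \<Longrightarrow> n \<ge> n2 \<Longrightarrow> norm (y m - y n) < \<epsilon>"
      using \<open>\<And>\<epsilon>. \<epsilon> > 0 \<Longrightarrow> \<exists>n1. \<forall>m\<ge>n1. \<forall>n\<ge>n1. norm (x m - x n) < \<epsilon>\<close>
        \<open>\<And>\<epsilon>. \<epsilon> > 0 \<Longrightarrow> \<exists>n2. \<forall>m\<ge>n2. \<forall>n\<ge>n2. norm (y m - y n) < \<epsilon>\<close> \<epsilon> by meson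
    have "norm (E m s - E n s) < \<epsilon>" if "m \<ge> max n1 n2" "n \<ge> max n1 n2" "s \<in> {0..1}" for m n s
      using E_diff[OF that(3), of m n] n(1)[of m n] n(2)[of m n] that by auto
    then show ?thesis by blast
  qed
  have \<eta>3: "\<eta> / 3 > 0" using \<eta>(1) by simp
  obtain n1 where n1: "\<And>m n s. m \<ge> n1 \<Longrightarrow> n \<ge> n1 \<Longrightarrow> s \<in> {0..1} \<Longrightarrow> norm (E m s - E n s) < \<eta> / 3"
    using unif[OF \<eta>3] by blast
  obtain n2 where n2: "\<And>n. n \<ge> n2 \<Longrightarrow> norm (x n - a) < \<eta> / 3"
    using LIMSEQ_D[OF x, of "\<eta> / 3"] \<eta>(1) by auto
  \<comment> \<open>One index from which the approximants are uniformly close to each other on the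
    unit interval and close to \<open>a\<close> at time 0. Continuity in \<open>s\<close> is then
    required of the curve \<open>E n0\<close> alone, which makes \<delta> independent of
    \<open>n\<close>.\<close>
  define n0 where "n0 = max n1 n2"
  have "isCont (\<lambda>s. E n0 s) 0"
    unfolding E_def using M1.continuous_ext[OF band[OF order_refl]] by (simp add: continuous_on_eq_continuous_at)
  then obtain d where d: "d > 0" "\<And>s. \<bar>s\<bar> < d \<Longrightarrow> norm (E n0 s - E n0 0) < \<eta> / 3"
    using \<eta>3 unfolding continuous_at_eps_delta
    by (simp only: dist_norm real_norm_def diff_zero) blast
  \<comment> \<open>At most 1, since the uniform estimate covers only the unit interval, and
    strictly below the modulus of continuity \<open>d\<close>.\<close>
  define \<delta> where "\<delta> = min 1 (d / 2)"
  have \<delta>: "\<delta> > 0" "\<delta> \<le> 1" "\<delta> < d" using d(1) by (auto simp: \<delta>_def)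
  have near: "norm (E n s - a) < \<eta>" if "n \<ge> n0" "s \<in> {0..\<delta>}" for n s
  proof -
    have "norm (E n s - E n0 s) < \<eta> / 3" using that \<delta> by (intro n1) (auto simp: n0_def)
    moreover have "norm (E n0 s - x n0) < \<eta> / 3" using d(2)[of s] that \<delta> by (simp add: E0)
    moreover have "norm (x n0 - a) < \<eta> / 3" by (rule n2) (simp add: n0_def)
    moreover have "norm (E n s - a) \<le> norm (E n s - E n0 s) + norm (E n0 s - x n0) + norm (x n0 - a)" by norm
    ultimately show ?thesis by simp
  qed
  have ex: "\<exists>R. inverse_pair X R \<and> norm R \<le> 2 * norm b" if "norm (X - a) \<le> \<eta>" for X
  proof (rule ex_inverse_near[OF ab])
    have "norm b * norm (X - a) \<le> norm b * \<eta>" using that by (intro mult_left_mono) auto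
    then show "norm b * norm (X - a) \<le> 1 / 2" using \<eta>(2) by simp
  qed
  then have "\<forall>n s. \<exists>R. n \<ge> n0 \<longrightarrow> s \<in> {0..\<delta>} \<longrightarrow> inverse_pair (E n s) R \<and> norm R \<le> 2 * norm b"
    using near by (meson less_imp_le)
  then obtain R where R: "\<And>n s. n \<ge> n0 \<Longrightarrow> s \<in> {0..\<delta>} \<Longrightarrow> inverse_pair (E n s) (R n s)"
    "\<And>n s. n \<ge> n0 \<Longrightarrow> s \<in> {0..\<delta>} \<Longrightarrow> norm (R n s) \<le> 2 * norm b"
    by metis
  have "Cauchy (\<lambda>n. E n \<delta>)"
    unfolding Cauchy_iff using unif \<delta> by (meson atLeastAtMost_iff less_imp_le)
  then obtain e where e: "(\<lambda>n. E n \<delta>) \<longlonglongrightarrow> e" by (auto simp: Cauchy_convergent_iff convergent_def)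
  have "norm (e - a) \<le> \<eta>"
  proof (rule LIMSEQ_le_const2)
    show "(\<lambda>n. norm (E n \<delta> - a)) \<longlonglongrightarrow> norm (e - a)" by (intro tendsto_intros e)
    show "\<exists>N. \<forall>n\<ge>N. norm (E n \<delta> - a) \<le> \<eta>" using near \<delta> by (intro exI[of _ n0]) (auto intro: less_imp_le)
  qed
  then obtain z where z: "inverse_pair e z" "norm z \<le> 2 * norm b" using ex by blast
  \<comment> \<open>The index is shifted by \<open>n0\<close> because \<open>R n\<close> is an
    inverse with controlled norm only from there on.\<close>
  have lim: "(\<lambda>n. R (n + n0) s) \<longlonglongrightarrow> w" if s: "s \<in> {0..\<delta>}" and uw: "inverse_pair u w" and u: "(\<lambda>n. E n s) \<longlonglongrightarrow> u" for s u w
  proof (rule tendsto_norm_diff_bound)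
    have "(\<lambda>n. E (n + n0) s) \<longlonglongrightarrow> u" using u by (rule LIMSEQ_ignore_initial_segment)
    then show "(\<lambda>n. 2 * norm b * norm (E (n + n0) s - u) * norm w) \<longlonglongrightarrow> 0"
      by (intro tendsto_mult_left_zero tendsto_mult_right_zero tendsto_norm_zero LIM_zero)
    show "norm (R (n + n0) s - w) \<le> 2 * norm b * norm (E (n + n0) s - u) * norm w" for n
      using s by (intro order_trans[OF norm_inverse_diff_le[OF uw R(1)]] mult_right_mono R(2)) auto
  qed
  have lim0: "(\<lambda>n. R (n + n0) 0) \<longlonglongrightarrow> b" using \<delta> x by (intro lim[OF _ ab]) (auto simp: E0)
  have lim\<delta>: "(\<lambda>n. R (n + n0) \<delta>) \<longlonglongrightarrow> z" using \<delta> e by (intro lim[OF _ z(1)]) auto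
  \<comment> \<open>Each \<open>E n \<delta>\<close> is of the form \<open>act f x\<close> and so
    has a continuous orbit; as the group is isometric, convergence at one point of the orbit is
    uniform along it.\<close>
  have ce: "continuous_on UNIV (\<lambda>s. T1 s e)"
  proof (rule uniform_limit_theorem[where f="\<lambda>n s. T1 s (E n \<delta>)" and F=sequentially])
    show "\<forall>\<^sub>F n in sequentially. continuous_on UNIV (\<lambda>s. T1 s (E n \<delta>))"
      unfolding E_def M1.ext_def by (intro always_eventually allI M1.continuous_on_T_act integrable_expker)
    show "uniform_limit UNIV (\<lambda>n s. T1 s (E n \<delta>)) (\<lambda>s. T1 s e) sequentially"
    proof (rule uniform_limitI)
      fix \<epsilon> :: real assume "\<epsilon> > 0"
      with e have "\<forall>\<^sub>F n in sequentially. dist (E n \<delta>) e < \<epsilon>" by (rule tendstoD)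
      then show "\<forall>\<^sub>F n in sequentially. \<forall>s\<in>UNIV. dist (T1 s (E n \<delta>)) (T1 s e) < \<epsilon>"
        by eventually_elim (simp add: dist_norm M1.norm_T flip: M1.T_diff)
    qed
  qed simp
  show ?thesis
  proof (rule that[OF \<delta>(1) continuous_orbit_inverse[OF ab a] continuous_orbit_inverse[OF z(1) ce]])
    fix k k' M
    assume k: "integrable lborel k" and supp: "\<And>\<xi>. \<exists>l. \<bar>\<xi> $ l\<bar> > real M \<Longrightarrow> fourier k \<xi> = 0"
      and k': "integrable lborel k'" "\<And>\<xi>. fourier k' \<xi> = exp_fun (\<delta> *\<^sub>R \<alpha>) \<xi> * fourier k \<xi>"
    have k'': "fourier k' \<xi> = exp (complex_of_real (\<delta> * (\<alpha> \<bullet> \<xi>))) * fourier k \<xi>" for \<xi>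
      unfolding k' by (simp only: exp_fun_def exp_of_real inner_scaleR_left)
    have "act2 k (R (n + n0) \<delta>) = act2 k' (R (n + n0) 0)" for n
    proof (rule act_inverse_flow_eq[OF less_imp_le[OF \<delta>(1)] band[OF order_refl] _ _ k supp k'(1) k''])
      fix s assume s: "s \<in> {0..\<delta>}"
      show "inverse_pair (M1.ext \<alpha> (N (n + n0)) (complex_of_real s) (x (n + n0))) (R (n + n0) s)"
        using R(1)[OF _ s, of "n + n0"] by (simp add: E_def)
      show "norm (R (n + n0) s) \<le> 2 * norm b" using R(2)[OF _ s, of "n + n0"] by simp
    qed
    then have "(\<lambda>n. act2 k (R (n + n0) \<delta>)) \<longlonglongrightarrow> act2 k' b"
      using M2.tendsto_act[OF k'(1) lim0] by simp
    moreover have "(\<lambda>n. act2 k (R (n + n0) \<delta>)) \<longlonglongrightarrow> act2 k z" by (rule M2.tendsto_act[OF k lim\<delta>])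
    ultimately show "act2 k z = act2 k' b" by (rule LIMSEQ_unique[rotated])
  qed
qed

end

section \<open>Return to operator functions\<close>

lemma cop_spec_eq:
  fixes T :: "real^'d \<Rightarrow> ('u::complex_normed_vector \<Rightarrow> 'v::{complex_normed_vector,banach}) \<Rightarrow> ('u \<Rightarrow> 'v)"
  assumes L: "L1_module T act"
  shows "l1_banach_module.spec (\<lambda>f X. Cop (act f (cop_apply X))) X = beurling_spectrum act (cop_apply X)"
proof -
  have "Cop (act f (cop_apply X)) = 0 \<longleftrightarrow> act f (cop_apply X) = (\<lambda>_. 0)" if "integrable lborel f" for f
    using L[unfolded L1_module_def, THEN conjunct2, THEN conjunct2, THEN conjunct2, THEN conjunct2, THEN conjunct2, THEN conjunct2, THEN conjunct1] that
    by (intro Cop_eq_0_iff) (simp add: cop_apply)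
  then show ?thesis
    unfolding l1_banach_module.spec_def[OF l1_banach_module_cop[OF L]] beurling_spectrum_def by auto
qed

theorem mainTheorem8:
  fixes TXY :: "real^'d \<Rightarrow> ('x::{complex_normed_vector,banach} \<Rightarrow> 'y::{complex_normed_vector,banach}) \<Rightarrow> ('x \<Rightarrow> 'y)"
    and TYX :: "real^'d \<Rightarrow> ('y \<Rightarrow> 'x) \<Rightarrow> ('y \<Rightarrow> 'x)"
    and TXX :: "real^'d \<Rightarrow> ('x \<Rightarrow> 'x) \<Rightarrow> ('x \<Rightarrow> 'x)"
    and TYY :: "real^'d \<Rightarrow> ('y \<Rightarrow> 'y) \<Rightarrow> ('y \<Rightarrow> 'y)"
    and actXY :: "(real^'d \<Rightarrow> complex) \<Rightarrow> ('x \<Rightarrow> 'y) \<Rightarrow> ('x \<Rightarrow> 'y)"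
    and actYX :: "(real^'d \<Rightarrow> complex) \<Rightarrow> ('y \<Rightarrow> 'x) \<Rightarrow> ('y \<Rightarrow> 'x)"
    and actXX :: "(real^'d \<Rightarrow> complex) \<Rightarrow> ('x \<Rightarrow> 'x) \<Rightarrow> ('x \<Rightarrow> 'x)"
    and actYY :: "(real^'d \<Rightarrow> complex) \<Rightarrow> ('y \<Rightarrow> 'y) \<Rightarrow> ('y \<Rightarrow> 'y)"
    and \<alpha> :: "real^'d" and A :: "'x \<Rightarrow> 'y" and B :: "'y \<Rightarrow> 'x"
  assumes modXY: "L1_module TXY actXY" and modYX: "L1_module TYX actYX"
    and modXX: "L1_module TXX actXX" and modYY: "L1_module TYY actYY"
    and compat_XXX: "rep_compat TXX TXX TXX"
    and compat_XXY: "rep_compat TXX TXY TXY"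
    and compat_XYX: "rep_compat TXY TYX TXX"
    and compat_XYY: "rep_compat TXY TYY TXY"
    and compat_YXX: "rep_compat TYX TXX TYX"
    and compat_YXY: "rep_compat TYX TXY TYY"
    and compat_YYX: "rep_compat TYY TYX TYX"
    and compat_YYY: "rep_compat TYY TYY TYY"
    and coupled: "\<forall>t C D. C \<in> cblin \<longrightarrow> D \<in> cblin \<longrightarrow>
                    (mutually_inverse C D \<longleftrightarrow> mutually_inverse (TXY t C) (TYX t D))"
    and alpha_sign: "(\<forall>i. \<alpha> $ i > 0) \<or> (\<forall>i. \<alpha> $ i < 0)"
    and A_lin: "A \<in> cblin"
    and A_cont: "T_continuous TXY A"
    and A_dom: "A \<in> fc_domain actXY (exp_fun \<alpha>)"
    and B_lin: "B \<in> cblin"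
    and inv: "mutually_inverse A B"
  shows "\<exists>\<beta>::real^'d. (\<forall>i. sgn (\<beta> $ i) = sgn (\<alpha> $ i)) \<and>
           T_continuous TYX B \<and> B \<in> fc_domain actYX (exp_fun \<beta>)"
proof -
  let ?T1 = "\<lambda>t X. Cop (TXY t (cop_apply X))" and ?act1 = "\<lambda>f X. Cop (actXY f (cop_apply X))"
  let ?T2 = "\<lambda>t X. Cop (TYX t (cop_apply X))" and ?act2 = "\<lambda>f X. Cop (actYX f (cop_apply X))"
  interpret M1: l1_banach_module ?T1 ?act1 by (rule l1_banach_module_cop[OF modXY])
  interpret M2: l1_banach_module ?T2 ?act2 by (rule l1_banach_module_cop[OF modYX])
  have TXY: "TXY t C \<in> cblin" if "C \<in> cblin" for t C
    using modXY that unfolding L1_module_def by (elim conjE) simp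
  have TYX: "TYX t C \<in> cblin" if "C \<in> cblin" for t C
    using modYX that unfolding L1_module_def by (elim conjE) simp
  have actXY: "actXY f C \<in> cblin" if "integrable lborel f" "C \<in> cblin" for f C
    using modXY[unfolded L1_module_def, THEN conjunct2, THEN conjunct2, THEN conjunct2, THEN conjunct2, THEN conjunct2, THEN conjunct2, THEN conjunct1] that by simp
  have actYX: "actYX f C \<in> cblin" if "integrable lborel f" "C \<in> cblin" for f C
    using modYX[unfolded L1_module_def, THEN conjunct2, THEN conjunct2, THEN conjunct2, THEN conjunct2, THEN conjunct2, THEN conjunct2, THEN conjunct1] that by simp
  interpret coupled_modules ?T1 ?act1 ?T2 ?act2
  proof
    fix X :: "('x, 'y) cop" and R t assume "inverse_pair X R"
    then show "inverse_pair (?T1 t X) (?T2 t R)"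
      using coupled cop_apply[of X] cop_apply[of R] by (simp add: inverse_pair_def Cop_inverse TXY TYX)
  qed
  have ab: "inverse_pair (Cop A) (Cop B)" using inv A_lin B_lin by (simp add: inverse_pair_def Cop_inverse)
  have cA: "continuous_on UNIV (\<lambda>s. ?T1 s (Cop A))"
    using A_cont A_lin unfolding T_continuous_def
    by (simp add: continuous_on_eq_continuous_at isCont_def Cop_inverse tendsto_onorm_opdiff_iff TXY)
  obtain C As Cs where C: "C \<in> cblin" "\<And>n. (As n, Cs n) \<in> fc_graph actXY (exp_fun \<alpha>)"
    "(\<lambda>n. onorm (opdiff (As n) A)) \<longlonglongrightarrow> 0" "(\<lambda>n. onorm (opdiff (Cs n) C)) \<longlonglongrightarrow> 0"
    using A_dom unfolding fc_domain_def by auto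
  \<comment> \<open>Every element of the graph carries its own cutoff, so the cube depends on
    \<open>n\<close>.\<close>
  have "\<exists>N. As n \<in> cblin \<and> Cs n \<in> cblin \<and> (\<forall>M\<ge>N. M1.band M (Cop (As n)) \<and> M1.ext \<alpha> M 1 (Cop (As n)) = Cop (Cs n))" for n
  proof -
    from C(2)[of n] obtain g \<phi> U where g: "Cs n = actXY g (As n)" "As n \<in> cblin"
      "integrable lborel \<phi>" "compact (closure {\<xi>. fourier \<phi> \<xi> \<noteq> 0})"
      "open U" "beurling_spectrum actXY (As n) \<subseteq> U" "\<And>\<xi>. \<xi> \<in> U \<Longrightarrow> fourier \<phi> \<xi> = 1"
      "integrable lborel g" "\<And>\<xi>. fourier g \<xi> = exp_fun \<alpha> \<xi> * fourier \<phi> \<xi>"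
      unfolding fc_graph_def by auto
    have "M1.spec (Cop (As n)) \<subseteq> U" using g(2,6) by (simp add: cop_spec_eq[OF modXY] Cop_inverse)
    from M1.band_of_graph[OF g(3,4,5) this g(7,8,9)]
    obtain N where "\<And>M. M \<ge> N \<Longrightarrow> M1.band M (Cop (As n))" "\<And>M. M \<ge> N \<Longrightarrow> M1.ext \<alpha> M 1 (Cop (As n)) = Cop (actXY g (cop_apply (Cop (As n))))"
      by blast
    then show ?thesis using g(1,2,8) actXY by (intro exI[of _ N]) (simp add: Cop_inverse)
  qed
  then obtain N where N: "\<And>n. As n \<in> cblin" "\<And>n. Cs n \<in> cblin" "\<And>n M. M \<ge> N n \<Longrightarrow> M1.band M (Cop (As n))"
      "\<And>n M. M \<ge> N n \<Longrightarrow> M1.ext \<alpha> M 1 (Cop (As n)) = Cop (Cs n)"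
    by metis
  have lims: "(\<lambda>n. Cop (As n)) \<longlonglongrightarrow> Cop A" "(\<lambda>n. Cop (Cs n)) \<longlonglongrightarrow> Cop C"
    using C(3,4) tendsto_onorm_opdiff_iff[of As, OF N(1) A_lin] tendsto_onorm_opdiff_iff[of Cs, OF N(2) C(1)] by auto
  \<comment> \<open>The exponent for \<open>B\<close> is \<beta> = \<delta>\<alpha>, and
    \<open>z\<close> is the future value of the closed operator at \<open>B\<close>.\<close>
  obtain \<delta> z where \<delta>: "\<delta> > 0" and cb: "continuous_on UNIV (\<lambda>s. ?T2 s (Cop B))" and cz: "continuous_on UNIV (\<lambda>s. ?T2 s z)"
    and kz: "\<And>k k' M. integrable lborel k \<Longrightarrow> (\<And>\<xi>. \<exists>l. \<bar>\<xi> $ l\<bar> > real M \<Longrightarrow> fourier k \<xi> = 0) \<Longrightarrow>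
      integrable lborel k' \<Longrightarrow> (\<And>\<xi>. fourier k' \<xi> = exp_fun (\<delta> *\<^sub>R \<alpha>) \<xi> * fourier k \<xi>) \<Longrightarrow> ?act2 k z = ?act2 k' (Cop B)"
    using inverse_analytic[OF ab cA N(3,4) lims] by blast
  obtain X g where X: "\<And>n. compact (M2.spec (X n))"
    "\<And>n. \<exists>\<phi>. integrable lborel \<phi> \<and> compact (closure {\<xi>. fourier \<phi> \<xi> \<noteq> 0}) \<and>
        (\<exists>U. open U \<and> M2.spec (X n) \<subseteq> U \<and> (\<forall>\<xi>\<in>U. fourier \<phi> \<xi> = 1)) \<and>
        integrable lborel (g n) \<and> (\<forall>\<xi>. fourier (g n) \<xi> = exp_fun (\<delta> *\<^sub>R \<alpha>) \<xi> * fourier \<phi> \<xi>)"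
    "X \<longlonglongrightarrow> Cop B" "(\<lambda>n. ?act2 (g n) (X n)) \<longlonglongrightarrow> z"
  proof (rule M2.fc_approximation[OF cb cz, where \<beta>="\<delta> *\<^sub>R \<alpha>"])
    fix k k' M
    assume "integrable lborel k" "\<And>\<xi>. \<exists>l. \<bar>\<xi> $ l\<bar> > real M \<Longrightarrow> fourier k \<xi> = 0"
      "integrable lborel k'" "\<And>\<xi>. fourier k' \<xi> = exp_fun (\<delta> *\<^sub>R \<alpha>) \<xi> * fourier k \<xi>"
    then show "?act2 k z = ?act2 k' (Cop B)" by (rule kz)
  qed (rule that)
  have g: "integrable lborel (g n)" for n using X(2)[of n] by blast
  \<comment> \<open>The witnesses are the value \<open>z\<close>, the approximants
    \<open>X n\<close> of compact spectrum and their images under the kernels \<open>g n\<close>,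
    all read as functions.\<close>
  have "B \<in> fc_domain actYX (exp_fun (\<delta> *\<^sub>R \<alpha>))"
    unfolding fc_domain_def
  proof (rule CollectI, rule conjI[OF B_lin], rule bexI[OF _ cop_apply[of z]],
      rule exI[of _ "\<lambda>n. cop_apply (X n)"], rule exI[of _ "\<lambda>n. actYX (g n) (cop_apply (X n))"], intro conjI allI)
    fix n
    show "(cop_apply (X n), actYX (g n) (cop_apply (X n))) \<in> fc_graph actYX (exp_fun (\<delta> *\<^sub>R \<alpha>))"
      using X(1,2)[of n] cop_apply[of "X n"] unfolding fc_graph_def cop_spec_eq[OF modYX] by blast
  next
    show "(\<lambda>n. onorm (opdiff (cop_apply (X n)) B)) \<longlonglongrightarrow> 0"
      using X(3) by (subst tendsto_onorm_opdiff_iff) (auto simp: cop_apply B_lin cop_apply_inverse)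
    show "(\<lambda>n. onorm (opdiff (actYX (g n) (cop_apply (X n))) (cop_apply z))) \<longlonglongrightarrow> 0"
      using X(4) g by (subst tendsto_onorm_opdiff_iff) (auto simp: cop_apply actYX cop_apply_inverse)
  qed
  moreover have "T_continuous TYX B"
    using cb B_lin unfolding T_continuous_def
    by (simp add: continuous_on_eq_continuous_at isCont_def Cop_inverse tendsto_onorm_opdiff_iff TYX)
  moreover have "sgn ((\<delta> *\<^sub>R \<alpha>) $ i) = sgn (\<alpha> $ i)" for i
    using \<delta> by (simp add: sgn_mult)
  ultimately show ?thesis by blast
qed

end
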